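(* Let $k\ge 2$ and let $f$ be a nonnegative and nondegenerate $k$-regular sequence, with minimal nondegenerate linear representation $(\mathbf u,\mathcal A,\mathbf v)$, and let $G$ and $g$ be the associated compact abelian group and its generator. Let $\mathcal M$ be the set of Borel probability measures on $\mathbb T$ with the weak topology. Then there is a continuous map $\Psi_f\colon G\to\mathcal M$, $h\mapsto \mu_h$, such that the set of ghost measures of $f$ is exactly $\Psi_f(G)$. Moreover, for every sequence of indices $n_j\to\infty$ and every $\mu\in\mathcal M$, one has $\lim_{j\to\infty}\mu_{n_j}=\mu$ (weakly) if and only if $\mu=\mu_h$ for every accumulation point $h$ of $(g^{n_j})_j$ in $G$.
   Context: Regular sequences. Fix an integer $k\ge2$. For $n\ge1$ let $(n)_k=i_s\cdots i_0$ be the base-$k$ expansion ($i_s\ne0$), and for $d\times d$ matrices $\mathbf A_0,\dots,\mathbf A_{k-1}$ put $\mathbf A_{(n)_k}=\mathbf A_{i_s}\cdots\mathbf A_{i_0}$, with $\mathbf A_{(0)_k}$ the identity. A real sequence $f=(f(n))_{n\ge0}$ is $k$-regular if its $k$-kernel $\{(f(k^\ell n+r))_{n\ge 0}:\ell\ge0,\ 0\le r<k^\ell\}$ spans a finite-dimensional real vector space $V_k(f)$; $\dim V_k(f)$ is the degree of $f$. A linear representation of $f$ of degree $d$ is a tuple $(\mathbf u,\mathcal A,\mathbf v)$ with $\mathbf u,\mathbf v\in\mathbb R^{d}$ (columns), $\mathcal A=\{\mathbf A_0,\dots,\mathbf A_{k-1}\}\subset\mathbb R^{d\times d}$ and $f(n)=\mathbf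 u^T\mathbf A_{(n)_k}\mathbf v$ for all $n\ge 0$; it is minimal if $d=\dim V_k(f)$. Put $\mathbf A=\sum_{j=0}^{k-1}\mathbf A_j$. Ghost measures. For nonnegative $f$ put $\Sigma_f(N)=\sum_{m=k^N}^{k^{N+1}-1}f(m)$ and, when $\Sigma_f(N)\neq0$, $\mu_N=\frac1{\Sigma_f(N)}\sum_{m=0}^{k^{N+1}-k^N-1}f(k^N+m)\,\delta_{m/(k^N(k-1))}$, a probability measure on $\mathbb T=[0,1)$ with addition mod $1$. Ghost measures of $f$ are the weak accumulation points of $(\mu_N)_N$. Group and nondegeneracy. Let $V\subset\mathbb R^d$ be the subspace with $V^T=\mathrm{span}\{\mathbf u^T\mathbf A_{(n)_k}:n\ge1\}$, $\mathbf P_V$ the orthogonal projection onto $V$, $\widetilde{\mathbf A}=\mathbf P_V\mathbf A\mathbf P_V$, $\rho=\rho(\widetilde{\mathbf A})$ the spectral radius, $\sigma_p=\{g_1\rho,\dots,g_s\rho\}$ the set of eigenvalues of $\widetilde{\mathbf A}$ of modulus $\rho$ ($|g_i|=1$). Put $g=(g_1,\dots,g_s)\in S^s$, $S$ the complex unit circle, and $G=\overline{\{g^n:n\in\mathbb N\}}$, a compact abelian group under componentwise multiplication. For $h=(h_1,\dots,h_s)\in G$ let $\mathbf R_h$ be the linear map which is multiplication by $h_m$ on the generalised eigenspace in $V$ (complexified) of $\widetilde{\mathbf A}$ for the eigenvalue $g_m\rho$, and the identity on the generalised eigenspaces in $V$ of all other eigenvalues and on $V^\perp$; put $\mathbf R=\mathbf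 R_{g^{-1}}$. Let $r$ be the maximal size of a Jordan block of $\widetilde{\mathbf A}$ for an eigenvalue in $\sigma_p$, $c_n=\frac{(r-1)!}{n^{r-1}\rho^{n-r+1}}$, and $\mathbf P=\lim_{n\to\infty}c_n\mathbf R^n\widetilde{\mathbf A}^n$ (the limit exists). The representation is nondegenerate if $\rho>0$ and $\mathbf u^T(\mathbf A-\mathbf A_0)\mathbf R_h\mathbf P\mathbf v>0$ for all $h\in G$. The sequence $f$ is nondegenerate if it has a minimal nondegenerate linear representation. Then $\mu_N$ is defined for all sufficiently large $N$. *)

theory Defs
  imports
    "HOL-Probability.Probability"
    "HOL-Library.Function_Algebras"
    "Jordan_Normal_Form.Spectral_Radius"
    "Jordan_Normal_Form.Matrix_Kernel"
begin

text \<open>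
  Matrices and vectors are those of \<^theory>\<open>Jordan_Normal_Form.Matrix\<close>, so that the degree \<open>d\<close> of a
  linear representation is an ordinary natural number. A family \<open>A\<^sub>0, \<dots>, A\<^sub>k\<^sub>-\<^sub>1\<close> of matrices is a function
  \<open>A :: nat \<Rightarrow> real mat\<close> of which only the values below \<open>k\<close> matter.
\<close>

unbundle no inner_syntax
unbundle no vec_syntax
hide_const (open) Finite_Cartesian_Product.mat Finite_Cartesian_Product.vec
hide_type (open) Finite_Cartesian_Product.vec


subsection \<open>Regular sequences and linear representations\<close>

text \<open>The real vector space of real sequences with pointwise operations.\<close>

interpretation seq: vector_space "\<lambda>(c::real) (f::nat \<Rightarrow> real) n. c * f n"
  by unfold_locales (auto simp: fun_eq_iff algebra_simps)

definition k_kernel :: "nat \<Rightarrow> (nat \<Rightarrow> real) \<Rightarrow> (nat \<Rightarrow> real) set" where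
  "k_kernel k f = {(\<lambda>n. f (k ^ l * n + r)) | l r. r < k ^ l}"

definition V_seq :: "nat \<Rightarrow> (nat \<Rightarrow> real) \<Rightarrow> (nat \<Rightarrow> real) set" where
  "V_seq k f = seq.span (k_kernel k f)"

text \<open>\<^const>\<open>seq.dim\<close> is only meaningful on finite-dimensional spaces, so finite-dimensionality is
  expressed by a finite spanning set.\<close>

definition k_regular :: "nat \<Rightarrow> (nat \<Rightarrow> real) \<Rightarrow> bool" where
  "k_regular k f \<longleftrightarrow> (\<exists>B. finite B \<and> seq.span B = V_seq k f)"

definition seq_degree :: "nat \<Rightarrow> (nat \<Rightarrow> real) \<Rightarrow> nat" where
  "seq_degree k f = seq.dim (V_seq k f)"

text \<open>The word \<open>i\<^sub>s \<dots> i\<^sub>0\<close>, most significant digit first; the word of \<open>0\<close> is empty.\<close>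

fun base_expansion :: "nat \<Rightarrow> nat \<Rightarrow> nat list" where
  "base_expansion k n =
     (if n = 0 \<or> k < 2 then [] else base_expansion k (n div k) @ [n mod k])"

declare base_expansion.simps [simp del]

definition word_mat :: "nat \<Rightarrow> (nat \<Rightarrow> real mat) \<Rightarrow> nat list \<Rightarrow> real mat" where
  "word_mat d A w = foldr (\<lambda>i M. A i * M) w (1\<^sub>m d)"

definition linear_representation ::
  "nat \<Rightarrow> nat \<Rightarrow> real vec \<Rightarrow> (nat \<Rightarrow> real mat) \<Rightarrow> real vec \<Rightarrow> (nat \<Rightarrow> real) \<Rightarrow> bool" where
  "linear_representation k d u A v f \<longleftrightarrow>
     u \<in> carrier_vec d \<and> v \<in> carrier_vec d \<and> (\<forall>j<k. A j \<in> carrier_mat d d) \<and>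
     (\<forall>n. f n = u \<bullet> (word_mat d A (base_expansion k n) *\<^sub>v v))"

definition minimal_linear_representation ::
  "nat \<Rightarrow> nat \<Rightarrow> real vec \<Rightarrow> (nat \<Rightarrow> real mat) \<Rightarrow> real vec \<Rightarrow> (nat \<Rightarrow> real) \<Rightarrow> bool" where
  "minimal_linear_representation k d u A v f \<longleftrightarrow>
     linear_representation k d u A v f \<and> d = seq_degree k f"


subsection \<open>Probability measures on the circle and ghost measures\<close>

text \<open>
  The circle is the set \<open>[0,1)\<close>. Its Borel sets are the Borel subsets of the real line contained in
  \<open>[0,1)\<close>, and its continuous real functions are the restrictions of the continuous functions of
  period \<open>1\<close> on the real line.
\<close>

definition circle_borel :: "real measure" where
  "circle_borel = restrict_space borel {0..<1}"

definition circle_prob :: "real measure set" where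
  "circle_prob = {\<mu>. prob_space \<mu> \<and> sets \<mu> = sets circle_borel}"

definition circle_cont :: "(real \<Rightarrow> real) set" where
  "circle_cont = {\<phi>. continuous_on UNIV \<phi> \<and> (\<forall>x. \<phi> (x + 1) = \<phi> x)}"

text \<open>The coarsest topology making \<open>\<mu> \<mapsto> \<integral>\<phi> d\<mu>\<close> continuous for every test function \<open>\<phi>\<close>.\<close>

definition weak_topology :: "real measure topology" where
  "weak_topology =
     pullback_topology circle_prob (\<lambda>\<mu>. \<lambda>\<phi>\<in>circle_cont. \<integral>x. \<phi> x \<partial>\<mu>)
       (product_topology (\<lambda>_. euclideanreal) circle_cont)"

definition block_sum :: "nat \<Rightarrow> (nat \<Rightarrow> real) \<Rightarrow> nat \<Rightarrow> real" where
  "block_sum k f N = (\<Sum>m\<in>{k ^ N..<k ^ (N + 1)}. f m)"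

text \<open>
  The image of the weights \<open>f (k\<^sup>N + m) / \<Sigma>\<^sub>f(N)\<close> under \<open>m \<mapsto> m / (k\<^sup>N (k - 1))\<close>, that is, the sum of
  weighted Dirac measures. If \<open>\<Sigma>\<^sub>f(N) = 0\<close> this is the null measure, which is not in
  \<^const>\<open>circle_prob\<close> and hence in no open set of \<^const>\<open>weak_topology\<close>: such indices affect neither
  limits nor accumulation points.
\<close>

definition mu_N :: "nat \<Rightarrow> (nat \<Rightarrow> real) \<Rightarrow> nat \<Rightarrow> real measure" where
  "mu_N k f N =
     distr (point_measure {..<k ^ (N + 1) - k ^ N}
              (\<lambda>m. ennreal (f (k ^ N + m) / block_sum k f N)))
           circle_borel
           (\<lambda>m. real m / (real k ^ N * (real k - 1)))"

definition accumulation_point :: "'a topology \<Rightarrow> (nat \<Rightarrow> 'a) \<Rightarrow> 'a \<Rightarrow> bool" where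
  "accumulation_point X s x \<longleftrightarrow>
     x \<in> topspace X \<and> (\<forall>U. openin X U \<and> x \<in> U \<longrightarrow> (\<exists>\<^sub>F n in sequentially. s n \<in> U))"

definition ghost_measures :: "nat \<Rightarrow> (nat \<Rightarrow> real) \<Rightarrow> real measure set" where
  "ghost_measures k f = {\<mu>. accumulation_point weak_topology (mu_N k f) \<mu>}"


subsection \<open>The restricted matrix and its peripheral spectrum\<close>

definition sum_mat :: "nat \<Rightarrow> nat \<Rightarrow> (nat \<Rightarrow> real mat) \<Rightarrow> real mat" where
  "sum_mat k d A = mat d d (\<lambda>(i, j). \<Sum>l<k. A l $$ (i, j))"

definition V_rep :: "nat \<Rightarrow> nat \<Rightarrow> real vec \<Rightarrow> (nat \<Rightarrow> real mat) \<Rightarrow> real vec set" where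
  "V_rep k d u A = LinearCombinations.module.span class_ring (module_vec TYPE(real) d)
     {transpose_mat (word_mat d A (base_expansion k n)) *\<^sub>v u | n. n \<ge> 1}"

definition orth_compl :: "nat \<Rightarrow> real vec set \<Rightarrow> real vec set" where
  "orth_compl d V = {x \<in> carrier_vec d. \<forall>y\<in>V. x \<bullet> y = 0}"

definition orth_proj :: "nat \<Rightarrow> real vec set \<Rightarrow> real mat" where
  "orth_proj d V = (THE M. M \<in> carrier_mat d d \<and>
     (\<forall>x\<in>carrier_vec d. M *\<^sub>v x \<in> V \<and> x - M *\<^sub>v x \<in> orth_compl d V))"

definition complexification :: "nat \<Rightarrow> real vec set \<Rightarrow> complex vec set" where
  "complexification d V = {w \<in> carrier_vec d. map_vec Re w \<in> V \<and> map_vec Im w \<in> V}"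

definition A_tilde :: "nat \<Rightarrow> nat \<Rightarrow> real vec \<Rightarrow> (nat \<Rightarrow> real mat) \<Rightarrow> complex mat" where
  "A_tilde k d u A =
     (let P = orth_proj d (V_rep k d u A) in map_mat complex_of_real (P * sum_mat k d A * P))"

definition rho :: "nat \<Rightarrow> nat \<Rightarrow> real vec \<Rightarrow> (nat \<Rightarrow> real mat) \<Rightarrow> real" where
  "rho k d u A = spectral_radius (A_tilde k d u A)"

definition peripheral :: "nat \<Rightarrow> nat \<Rightarrow> real vec \<Rightarrow> (nat \<Rightarrow> real mat) \<Rightarrow> complex set" where
  "peripheral k d u A = {z. eigenvalue (A_tilde k d u A) z \<and> cmod z = rho k d u A}"


subsection \<open>The compact group and nondegeneracy\<close>

text \<open>
  A tuple \<open>(h\<^sub>1, \<dots>, h\<^sub>s)\<close> of complex units, where \<open>s\<close> is the number of peripheral eigenvalues, is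
  encoded as the function on the natural numbers with these values at \<open>0, \<dots>, s - 1\<close> and value \<open>1\<close>
  from \<open>s\<close> on. The tuple \<open>g\<close> is an enumeration of the peripheral eigenvalues divided by \<open>\<rho>\<close>.
\<close>

definition phase_tuple ::
  "nat \<Rightarrow> nat \<Rightarrow> real vec \<Rightarrow> (nat \<Rightarrow> real mat) \<Rightarrow> (nat \<Rightarrow> complex) \<Rightarrow> bool" where
  "phase_tuple k d u A g \<longleftrightarrow>
     bij_betw (\<lambda>m. g m * complex_of_real (rho k d u A))
       {..<card (peripheral k d u A)} (peripheral k d u A) \<and>
     (\<forall>m\<ge>card (peripheral k d u A). g m = 1)"

text \<open>The closure is taken in the product topology.\<close>

definition phase_group :: "(nat \<Rightarrow> complex) \<Rightarrow> (nat \<Rightarrow> complex) set" where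
  "phase_group g = closure (range (\<lambda>n m. g m ^ n))"

definition gen_eigenspace_in :: "complex vec set \<Rightarrow> complex mat \<Rightarrow> complex \<Rightarrow> complex vec set" where
  "gen_eigenspace_in W M z = {w \<in> W. \<exists>n. w \<in> mat_kernel (char_matrix M z ^\<^sub>m n)}"

text \<open>The matrix \<open>R\<^sub>h\<close>; it is unique because the generalised eigenspaces in the complexified \<open>V\<close>
  together with the complexified orthogonal complement of \<open>V\<close> span the whole space.\<close>

definition R_mat ::
  "nat \<Rightarrow> nat \<Rightarrow> real vec \<Rightarrow> (nat \<Rightarrow> real mat) \<Rightarrow> (nat \<Rightarrow> complex) \<Rightarrow> (nat \<Rightarrow> complex) \<Rightarrow> complex mat" where
  "R_mat k d u A g h =
     (let V = V_rep k d u A;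
          E = gen_eigenspace_in (complexification d V) (A_tilde k d u A)
      in THE M. M \<in> carrier_mat d d \<and>
           (\<forall>m<card (peripheral k d u A).
              \<forall>w\<in>E (g m * complex_of_real (rho k d u A)). M *\<^sub>v w = h m \<cdot>\<^sub>v w) \<and>
           (\<forall>z. eigenvalue (A_tilde k d u A) z \<and> z \<notin> peripheral k d u A \<longrightarrow>
              (\<forall>w\<in>E z. M *\<^sub>v w = w)) \<and>
           (\<forall>w\<in>complexification d (orth_compl d V). M *\<^sub>v w = w))"

definition max_block :: "nat \<Rightarrow> nat \<Rightarrow> real vec \<Rightarrow> (nat \<Rightarrow> real mat) \<Rightarrow> nat" where
  "max_block k d u A =
     Max {b. \<exists>z\<in>peripheral k d u A. \<exists>bs. jordan_nf (A_tilde k d u A) bs \<and> (b, z) \<in> set bs}"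

definition c_coeff :: "nat \<Rightarrow> nat \<Rightarrow> real vec \<Rightarrow> (nat \<Rightarrow> real mat) \<Rightarrow> nat \<Rightarrow> real" where
  "c_coeff k d u A n =
     (let r = max_block k d u A
      in fact (r - 1) / (real n ^ (r - 1) * rho k d u A powi (int n - int r + 1)))"

text \<open>\<open>P = lim c\<^sub>n R\<^sup>n A\<^sup>n\<close> with \<open>R = R\<^sub>h\<close> for \<open>h = g\<^sup>-\<^sup>1\<close>, as an entrywise limit.\<close>

definition P_mat ::
  "nat \<Rightarrow> nat \<Rightarrow> real vec \<Rightarrow> (nat \<Rightarrow> real mat) \<Rightarrow> (nat \<Rightarrow> complex) \<Rightarrow> complex mat" where
  "P_mat k d u A g =
     (let R = R_mat k d u A g (\<lambda>m. inverse (g m))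
      in mat d d (\<lambda>(i, j). lim (\<lambda>n.
           (complex_of_real (c_coeff k d u A n) \<cdot>\<^sub>m (R ^\<^sub>m n * A_tilde k d u A ^\<^sub>m n)) $$ (i, j))))"

text \<open>The matrices \<open>R\<^sub>h\<close> and \<open>P\<close> live over the complex numbers, so positivity of the expression
  includes the assertion that it is real.\<close>

definition nondegenerate_representation ::
  "nat \<Rightarrow> nat \<Rightarrow> real vec \<Rightarrow> (nat \<Rightarrow> real mat) \<Rightarrow> real vec \<Rightarrow> (nat \<Rightarrow> complex) \<Rightarrow> bool" where
  "nondegenerate_representation k d u A v g \<longleftrightarrow>
     rho k d u A > 0 \<and>
     (\<forall>h\<in>phase_group g.
        let z = map_vec complex_of_real u \<bullet>
                  (map_mat complex_of_real (sum_mat k d A - A 0) *\<^sub>v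
                    (R_mat k d u A g h *\<^sub>v (P_mat k d u A g *\<^sub>v map_vec complex_of_real v)))
        in z \<in> \<real> \<and> Re z > 0)"

end

(* For nonnegative f the mass that mu_N gives to a k-adic interval of level l is a quotient of scalar
   products x . A^(N-l) v with x in V, and on V the matrix A may be replaced by its compression to V.
   In a Jordan basis R_h is diagonal, so c_n R^n A^n converges entrywise and c_n x . A^n v differs by
   o(1) from x . R_(g^n) P v, a continuous function of g^n. By nondegeneracy the normalising
   denominators stay away from 0 on G. Hence, for every continuous phi on the circle, the integral of
   phi with respect to mu_N is F_phi(g^N) + o(1) with F_phi continuous on G, as a uniform limit of
   Riemann sums over k-adic intervals. Finally, the powers of g return near every point of G, Helly's
   theorem yields mu_h with integrals F_phi(h), and continuous functions separate measures. *)

theory Submission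
  imports Defs "Jordan_Normal_Form.Jordan_Normal_Form_Uniqueness"
begin

subsection \<open>Recurrence in the phase group\<close>

text \<open>\<open>phase_group g\<close> is the closure of all powers of g, early ones included,
  whereas limits of \<open>mu_N\<close> only see late indices. Recurrence bridges this gap, and it
  is needed twice: it turns estimates valid for large N into uniform estimates on the whole group,
  and it makes every h the limiting phase along some sequence of indices. The limits are taken for
  integrals of test functions and not for masses of intervals, because a limit measure may charge
  the end points of k-adic intervals. The masses enter only as weights of Riemann sums, and for
  those the position of the end points is harmless. On the matrix side, R_h is prescribed on
  generalised eigenspaces inside V and on the complement of V, while a Jordan basis of the
  compression need not respect this splitting. Since the compression has range in V, only the
  eigenvalue 0 can cause a conflict, and there R_h is the identity on both parts. Ghost measures are
  defined by neighbourhoods, not by subsequences, so that each one is matched with a phase by a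
  finite covering of the compact group.\<close>

lemma phase_group_subset_sphere:
  assumes "\<And>m. cmod (g m) = 1" and "h \<in> phase_group g"
  shows "cmod (h m) = 1"
proof -
  have "closed {h :: nat \<Rightarrow> complex. cmod (h m) = 1}"
    by (intro closed_Collect_eq continuous_intros continuous_on_product_coordinates)
  moreover have "range (\<lambda>n m. g m ^ n) \<subseteq> {h. cmod (h m) = 1}"
    using assms(1) by (auto simp: norm_power)
  ultimately have "phase_group g \<subseteq> {h. cmod (h m) = 1}"
    unfolding phase_group_def by (rule closure_minimal[rotated])
  with assms(2) show ?thesis by auto
qed

lemma power_in_phase_group: "(\<lambda>m. g m ^ n) \<in> phase_group g"
  unfolding phase_group_def by (rule subsetD[OF closure_subset]) auto

text \<open>A closed subset of a product of circles is compact by Tychonoff. The product is infinite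
  because tuples are padded by 1 to functions on all naturals.\<close>

lemma compact_phase_group:
  assumes "\<And>m. cmod (g m) = 1"
  shows "compact (phase_group g)"
proof -
  let ?S = "PiE (UNIV :: nat set) (\<lambda>_. sphere (0::complex) 1)"
  have "compactin (product_topology (\<lambda>_::nat. euclidean) UNIV) ?S"
    unfolding compactin_PiE by simp
  then have S: "compact ?S"
    unfolding euclidean_product_topology by simp
  have "phase_group g \<subseteq> ?S"
    using phase_group_subset_sphere[OF assms] by (auto simp: dist_norm)
  then have "?S \<inter> phase_group g = phase_group g"
    by (rule Int_absorb1)
  with compact_Int_closed[OF S, of "phase_group g"] show ?thesis
    by (simp only: phase_group_def closed_closure)
qed

lemma tendsto_fun_iff:
  fixes f :: "'b \<Rightarrow> 'a::countable \<Rightarrow> 'c::topological_space"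
  shows "(f \<longlongrightarrow> l) F \<longleftrightarrow> (\<forall>i. ((\<lambda>x. f x i) \<longlongrightarrow> l i) F)"
proof -
  have "(f \<longlongrightarrow> l) F \<longleftrightarrow> limitin (product_topology (\<lambda>_. euclidean) UNIV) f l F"
    by (simp add: euclidean_product_topology)
  also have "\<dots> \<longleftrightarrow> (\<forall>i. ((\<lambda>x. f x i) \<longlongrightarrow> l i) F)"
    by (subst limitin_componentwise) auto
  finally show ?thesis .
qed

text \<open>A subsequence \<open>g ^ s j\<close> converges by compactness; then \<open>g ^ (s j' - s j)\<close> tends to the
  identity when \<open>j'\<close> runs ahead of \<open>j\<close>, so that every power of \<open>g\<close> is approached again.\<close>

lemma power_recurrent:
  fixes g :: "nat \<Rightarrow> complex"
  assumes g: "\<And>m. cmod (g m) = 1"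
  obtains q where "filterlim q at_top sequentially" "(\<lambda>j m. g m ^ q j) \<longlonglongrightarrow> (\<lambda>m. g m ^ p)"
proof -
  have "seq_compact (phase_group g)"
    using compact_phase_group[OF g] by (simp add: compact_eq_seq_compact_metric)
  moreover have "\<forall>n. (\<lambda>m. g m ^ n) \<in> phase_group g"
    by (rule allI, rule power_in_phase_group)
  ultimately obtain t s where s: "strict_mono s"
    and "((\<lambda>n m. g m ^ n) \<circ> s) \<longlonglongrightarrow> t"
    by (rule seq_compactE)
  then have t: "(\<lambda>j m. g m ^ s j) \<longlonglongrightarrow> t"
    by (simp only: comp_def)
  \<comment> \<open>The argument \<open>2 * j + s j\<close> forces \<open>s (2 * j + s j)\<close> to
    be at least \<open>s j + j\<close>: the subtraction is not truncated, and \<open>q j\<close>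
    tends to infinity.\<close>
  define q where "q j = p + s (2 * j + s j) - s j" for j
  have less: "j + s j \<le> s (2 * j + s j)" for j
    using seq_suble[OF s, of "2 * j + s j"] by linarith
  have "j \<le> q j" for j unfolding q_def using less[of j] by linarith
  then have 1: "filterlim q at_top sequentially"
    by (intro filterlim_at_top_mono[OF filterlim_ident]) auto
  have "(\<lambda>j. g m ^ q j) \<longlonglongrightarrow> g m ^ p" for m
  proof -
    have tm: "(\<lambda>j. g m ^ s j) \<longlonglongrightarrow> t m" using t by (simp add: tendsto_fun_iff)
    have "filterlim (\<lambda>j. 2 * j + s j) at_top sequentially"
      by (intro filterlim_at_top_mono[OF filterlim_ident]) auto
    from filterlim_compose[OF tm this]
    have "(\<lambda>j. g m ^ s (2 * j + s j) - g m ^ s j) \<longlonglongrightarrow> t m - t m"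
      by (intro tendsto_diff tm)
    then have "(\<lambda>j. cmod (g m ^ s (2 * j + s j) - g m ^ s j)) \<longlonglongrightarrow> 0"
      using tendsto_norm_zero by auto
    \<comment> \<open>With \<open>e\<close> the gap between the two exponents, both differences are
      a unit times \<open>g m ^ e - 1\<close>, so the unknown limit \<open>t\<close> drops
      out.\<close>
    moreover have "cmod (g m ^ s (2 * j + s j) - g m ^ s j) = cmod (g m ^ q j - g m ^ p)" for j
    proof -
      obtain e where "s (2 * j + s j) = s j + e"
        using less[of j] le_Suc_ex by (metis add_leD2)
      moreover from this have "q j = p + e" by (simp add: q_def)
      ultimately have "g m ^ s (2 * j + s j) - g m ^ s j = g m ^ s j * (g m ^ e - 1)"
        "g m ^ q j - g m ^ p = g m ^ p * (g m ^ e - 1)"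
        by (simp_all add: power_add algebra_simps)
      then show ?thesis by (simp add: norm_mult norm_power g)
    qed
    ultimately have "(\<lambda>j. cmod (g m ^ q j - g m ^ p)) \<longlonglongrightarrow> 0" by simp
    then have "(\<lambda>j. g m ^ q j - g m ^ p) \<longlonglongrightarrow> 0" by (rule tendsto_norm_zero_cancel)
    then show ?thesis by (simp add: LIM_zero_iff)
  qed
  then have 2: "(\<lambda>j m. g m ^ q j) \<longlonglongrightarrow> (\<lambda>m. g m ^ p)" by (simp add: tendsto_fun_iff)
  from 1 2 show thesis by (rule that)
qed

text \<open>Only divergence of \<open>q\<close> is asked for, not monotonicity, so an index can be
  chosen separately for each tolerance \<open>1 / Suc j\<close>.\<close>

lemma subsequence_tendsto_of_recurrence:
  fixes s :: "nat \<Rightarrow> 'a::metric_space"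
  assumes "\<And>M e. e > 0 \<Longrightarrow> \<exists>n\<ge>M. dist (s n) h < e"
  obtains q where "filterlim q at_top sequentially" "(\<lambda>j. s (q j)) \<longlonglongrightarrow> h"
proof -
  have "\<exists>q. \<forall>j. q j \<ge> j \<and> dist (s (q j)) h < 1 / Suc j"
    by (rule choice, rule allI) (use assms in simp)
  then obtain q where q: "\<And>j. q j \<ge> j" "\<And>j. dist (s (q j)) h < 1 / Suc j" by auto
  show thesis
  proof (rule that)
    show "filterlim q at_top sequentially"
      by (intro filterlim_at_top_mono[OF filterlim_ident]) (use q in auto)
    have "(\<lambda>j. dist (s (q j)) h) \<longlonglongrightarrow> 0"
      by (rule tendsto_sandwich[OF _ _ tendsto_const LIMSEQ_inverse_real_of_nat])
         (use q(2) in \<open>auto simp: inverse_eq_divide less_imp_le intro!: always_eventually\<close>)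
    then show "(\<lambda>j. s (q j)) \<longlonglongrightarrow> h" by (rule iffD2[OF tendsto_dist_iff])
  qed
qed

text \<open>The closure provides a power with some exponent \<open>p\<close> near \<open>h\<close>,
  possibly a small one; recurrence replaces \<open>p\<close> by arbitrarily large exponents.\<close>

lemma phase_group_limit_of_powers:
  fixes g :: "nat \<Rightarrow> complex"
  assumes g: "\<And>m. cmod (g m) = 1" and h: "h \<in> phase_group g"
  obtains q where "filterlim q at_top sequentially" "(\<lambda>j m. g m ^ q j) \<longlonglongrightarrow> h"
proof -
  have ex: "\<exists>n\<ge>M. dist (\<lambda>m. g m ^ n) h < e" if "e > 0" for M e
  proof -
    have "\<exists>y\<in>range (\<lambda>n m. g m ^ n). dist y h < e / 2"
      using h half_gt_zero[OF that] unfolding phase_group_def closure_approachable by blast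
    then obtain p where p: "dist (\<lambda>m. g m ^ p) h < e / 2" by blast
    obtain q where q: "filterlim q at_top sequentially" "(\<lambda>j m. g m ^ q j) \<longlonglongrightarrow> (\<lambda>m. g m ^ p)"
      by (rule power_recurrent[OF g])
    have "eventually (\<lambda>j. dist (\<lambda>m. g m ^ q j) (\<lambda>m. g m ^ p) < e / 2 \<and> q j \<ge> M) sequentially"
      using tendstoD[OF q(2), of "e / 2"] that q(1)
      by (auto simp: filterlim_at_top intro: eventually_conj)
    from eventually_happens'[OF sequentially_bot this]
    obtain j where "dist (\<lambda>m. g m ^ q j) (\<lambda>m. g m ^ p) < e / 2" "q j \<ge> M"
      by blast
    then have "dist (\<lambda>m. g m ^ q j) h < e"
      using p dist_triangle[of "\<lambda>m. g m ^ q j" h "\<lambda>m. g m ^ p"] by linarith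
    with \<open>q j \<ge> M\<close> show ?thesis by blast
  qed
  show thesis
    by (rule subsequence_tendsto_of_recurrence[of "\<lambda>n m. g m ^ n" h]) (fact ex, fact that)
qed

text \<open>An approximant is controlled only at late points of the orbit of g. Each
  \<open>h\<close> is a limit of such points, so by continuity the eventual bounds between two
  approximants hold at every \<open>h\<close>. Hence the approximants are uniformly Cauchy, and
  their uniform limit is the required function.\<close>

lemma asymptotic_function_on_phase_group:
  fixes x :: "nat \<Rightarrow> real"
  assumes g: "\<And>m. cmod (g m) = 1"
    and approx: "\<And>e. e > 0 \<Longrightarrow> \<exists>S. continuous_on (phase_group g) S \<and>
                   (\<forall>\<^sub>F N in sequentially. \<bar>x N - S (\<lambda>m. g m ^ N)\<bar> \<le> e)"
  shows "\<exists>F. continuous_on (phase_group g) F \<and> (\<lambda>N. x N - F (\<lambda>m. g m ^ N)) \<longlonglongrightarrow> 0"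
proof -
  let ?G = "phase_group g" and ?g = "\<lambda>N m. g m ^ N"
  have "\<exists>S. \<forall>n::nat. continuous_on ?G (S n) \<and>
          (\<forall>\<^sub>F N in sequentially. \<bar>x N - S n (?g N)\<bar> \<le> 1 / Suc n)"
    by (rule choice, rule allI, rule approx) simp
  then obtain S where S: "\<And>n::nat. continuous_on ?G (S n)"
    "\<And>n. \<forall>\<^sub>F N in sequentially. \<bar>x N - S n (?g N)\<bar> \<le> 1 / Suc n" by auto
  have SS: "\<bar>S n h - S m h\<bar> \<le> 1 / Suc n + 1 / Suc m" if h: "h \<in> ?G" for n m h
  proof -
    obtain q where q: "filterlim q at_top sequentially" "(\<lambda>j. ?g (q j)) \<longlonglongrightarrow> h"
      by (rule phase_group_limit_of_powers[OF g h])
    have lim: "(\<lambda>j. S i (?g (q j))) \<longlonglongrightarrow> S i h" for i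
      using S(1)[of i] q(2) h power_in_phase_group[of g]
      unfolding continuous_on_sequentially comp_def by simp
    have "(\<lambda>j. \<bar>S n (?g (q j)) - S m (?g (q j))\<bar>) \<longlonglongrightarrow> \<bar>S n h - S m h\<bar>"
      by (intro tendsto_intros lim)
    moreover have "\<forall>\<^sub>F N in sequentially. \<bar>S n (?g N) - S m (?g N)\<bar> \<le> 1 / Suc n + 1 / Suc m"
      using S(2)[of n] S(2)[of m] by eventually_elim linarith
    then have "\<forall>\<^sub>F j in sequentially. \<bar>S n (?g (q j)) - S m (?g (q j))\<bar> \<le> 1 / Suc n + 1 / Suc m"
      using q(1) by (rule eventually_compose_filterlim)
    ultimately show ?thesis by (rule tendsto_upperbound) auto
  qed
  have small: "\<exists>M. \<forall>n\<ge>M. 1 / real (Suc n) < e" if "e > 0" for e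
    using order_tendstoD(2)[OF LIMSEQ_inverse_real_of_nat that]
    by (simp add: eventually_sequentially inverse_eq_divide)
  have "uniformly_Cauchy_on ?G S"
  proof (rule uniformly_Cauchy_onI)
    fix e :: real assume "e > 0"
    then obtain M where M: "\<And>n. n \<ge> M \<Longrightarrow> 1 / real (Suc n) < e / 2"
      using small[of "e / 2"] by auto
    have "dist (S m h) (S n h) < e" if "h \<in> ?G" "m \<ge> M" "n \<ge> M" for h m n
      using SS[OF that(1), of m n] M[OF that(2)] M[OF that(3)] unfolding dist_real_def by linarith
    then show "\<exists>M. \<forall>x\<in>?G. \<forall>m\<ge>M. \<forall>n\<ge>M. dist (S m x) (S n x) < e" by blast
  qed
  then obtain F where F: "uniform_limit ?G S F sequentially"
    unfolding uniformly_convergent_eq_Cauchy[symmetric] uniformly_convergent_on_def ..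
  have contF: "continuous_on ?G F"
    by (rule uniform_limit_theorem[OF always_eventually F]) (simp_all add: S(1))
  have "(\<lambda>N. x N - F (?g N)) \<longlonglongrightarrow> 0"
  proof (rule LIMSEQ_I)
    fix e :: real assume e: "e > 0"
    obtain M where M: "\<And>n. n \<ge> M \<Longrightarrow> 1 / real (Suc n) < e / 2"
      using small[of "e / 2"] e by auto
    have "\<forall>\<^sub>F n in sequentially. \<forall>h\<in>?G. dist (S n h) (F h) < e / 2"
      by (rule uniform_limitD[OF F half_gt_zero[OF e]])
    then obtain M' where M': "\<forall>n\<ge>M'. \<forall>h\<in>?G. dist (S n h) (F h) < e / 2"
      unfolding eventually_sequentially ..
    let ?n = "max M M'"
    have "\<forall>\<^sub>F N in sequentially. norm (x N - F (?g N) - 0) < e"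
      using S(2)[of ?n]
    proof eventually_elim
      case (elim N)
      have "\<bar>S ?n (?g N) - F (?g N)\<bar> < e / 2"
        using M'[rule_format, OF max.cobounded2 power_in_phase_group] by (simp only: dist_real_def)
      moreover have "\<bar>x N - S ?n (?g N)\<bar> < e / 2"
        using elim M[OF max.cobounded1] by (rule order_le_less_trans)
      ultimately have "\<bar>x N - F (?g N)\<bar> < e" by linarith
      then show ?case by simp
    qed
    then show "\<exists>no. \<forall>N\<ge>no. norm (x N - F (?g N) - 0) < e"
      unfolding eventually_sequentially .
  qed
  with contF show ?thesis by (intro exI conjI)
qed

subsection \<open>Probability measures on the circle\<close>

lemma circle_cont_frac:
  assumes "\<phi> \<in> circle_cont"
  shows "\<phi> (frac x) = \<phi> x"
proof -
  interpret periodic_fun_simple' \<phi>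
    by unfold_locales (use assms in \<open>simp add: circle_cont_def\<close>)
  show ?thesis
    using minus_of_int[of x "\<lfloor>x\<rfloor>"] by (simp add: frac_def)
qed

lemma circle_cont_continuous: "\<phi> \<in> circle_cont \<Longrightarrow> continuous_on S \<phi>"
  unfolding circle_cont_def by (auto intro: continuous_on_subset)

lemma circle_cont_bounded:
  assumes "\<phi> \<in> circle_cont"
  obtains B where "\<And>x. \<bar>\<phi> x\<bar> \<le> B"
proof -
  have "bounded (\<phi> ` {0..1})"
    by (intro compact_imp_bounded compact_continuous_image circle_cont_continuous assms) auto
  then obtain B where B: "\<forall>x\<in>{0..1}. \<bar>\<phi> x\<bar> \<le> B"
    unfolding bounded_iff by auto
  have "\<bar>\<phi> x\<bar> \<le> B" for x
  proof -
    have "frac x \<in> {0..1}" using frac_lt_1[of x] by simp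
    from B[rule_format, OF this] show ?thesis by (simp only: circle_cont_frac[OF assms])
  qed
  then show thesis by (rule that)
qed

lemma circle_cont_measurable: "\<phi> \<in> circle_cont \<Longrightarrow> \<phi> \<in> borel_measurable borel"
  by (intro borel_measurable_continuous_onI circle_cont_continuous)

lemma circle_probD:
  assumes "\<mu> \<in> circle_prob"
  shows "prob_space \<mu>" "sets \<mu> = sets circle_borel" "space \<mu> = {0..<1}"
proof -
  show "prob_space \<mu>" and s: "sets \<mu> = sets circle_borel"
    using assms by (auto simp: circle_prob_def)
  show "space \<mu> = {0..<1}"
    using sets_eq_imp_space_eq[OF s] by (simp add: circle_borel_def space_restrict_space)
qed

lemma sets_circle_borel: "A \<in> sets circle_borel \<longleftrightarrow> A \<in> sets borel \<and> A \<subseteq> {0..<1}"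
  unfolding circle_borel_def by (subst sets_restrict_space_iff) auto

lemma borel_measurable_circle:
  assumes "\<mu> \<in> circle_prob" and "\<phi> \<in> measurable borel M"
  shows "\<phi> \<in> measurable \<mu> M"
proof -
  have "\<phi> \<in> measurable circle_borel M"
    unfolding circle_borel_def by (rule measurable_restrict_space1[OF assms(2)])
  then show ?thesis
    by (simp only: measurable_cong_sets[OF circle_probD(2)[OF assms(1)] refl])
qed

lemma real_distribution_circle_prob:
  assumes "\<mu> \<in> circle_prob"
  shows "real_distribution (distr \<mu> borel (\<lambda>x. x))"
proof -
  interpret prob_space \<mu> by (rule circle_probD(1)[OF assms])
  show ?thesis
    by (intro real_distribution_distr borel_measurable_circle[OF assms]) simp
qed

text \<open>Periodic extensions of closed arcs \<open>[0, b]\<close> are closed, hence their indicators are limits of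
  the periodic functions \<open>max 0 (1 - n dist(x, F))\<close>.\<close>

lemma circle_prob_eqI:
  assumes \<mu>: "\<mu> \<in> circle_prob" and \<nu>: "\<nu> \<in> circle_prob"
    and eq: "\<And>\<phi>. \<phi> \<in> circle_cont \<Longrightarrow> (\<integral>x. \<phi> x \<partial>\<mu>) = (\<integral>x. \<phi> x \<partial>\<nu>)"
  shows "\<mu> = \<nu>"
proof -
  have arc: "measure \<mu> {0..b} = measure \<nu> {0..b}" if b: "0 \<le> b" "b < 1" for b
  proof -
    \<comment> \<open>The arc has to start at 0: \<open>frac\<close> jumps down to 0 at the
      integers, and as these belong to \<open>F\<close>, the complement consists of the open gaps
      between \<open>n + b\<close> and \<open>n + 1\<close>.\<close>
    define F where "F = {x :: real. frac x \<le> b}"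
    have F0: "0 \<in> F" using b by (simp add: F_def)
    have "- F = (\<Union>n::int. {real_of_int n + b<..<real_of_int n + 1})"
    proof (intro equalityI subsetI)
      fix x assume "x \<in> - F"
      then have "x \<in> {real_of_int \<lfloor>x\<rfloor> + b<..<real_of_int \<lfloor>x\<rfloor> + 1}"
        using frac_lt_1[of x] by (auto simp: F_def frac_def)
      then show "x \<in> (\<Union>n::int. {real_of_int n + b<..<real_of_int n + 1})" by blast
    next
      fix x assume "x \<in> (\<Union>n::int. {real_of_int n + b<..<real_of_int n + 1})"
      then obtain n :: int where n: "real_of_int n + b < x" "x < real_of_int n + 1" by auto
      then have "\<lfloor>x\<rfloor> = n" using b by (intro floor_unique) auto
      then show "x \<in> - F" using n by (auto simp: F_def frac_def)
    qed
    moreover have "open (\<Union>n::int. {real_of_int n + b<..<real_of_int n + 1})"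
      by (intro open_UN ballI open_greaterThanLessThan)
    ultimately have closed: "closed F" by (simp only: closed_def)
    define \<psi> where "\<psi> n x = max 0 (1 - real n * infdist x F)" for n x
    have "infdist (x + 1) F = infdist x F" for x
    proof -
      have "dist (x + 1) ` F = dist x ` F"
      proof (intro equalityI subsetI)
        fix y assume "y \<in> dist (x + 1) ` F"
        then obtain a where "a \<in> F" "y = dist (x + 1) a" by blast
        then have "a - 1 \<in> F" "y = dist x (a - 1)"
          by (auto simp: F_def dist_real_def frac_def)
        then show "y \<in> dist x ` F" by blast
      next
        fix y assume "y \<in> dist x ` F"
        then obtain a where "a \<in> F" "y = dist x a" by blast
        then have "a + 1 \<in> F" "y = dist (x + 1) (a + 1)"
          by (auto simp: F_def dist_real_def frac_def)
        then show "y \<in> dist (x + 1) ` F" by blast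
      qed
      then show ?thesis using F0 by (simp add: infdist_def)
    qed
    then have \<psi>: "\<psi> n \<in> circle_cont" for n
      unfolding circle_cont_def \<psi>_def by (auto intro!: continuous_intros)
    have ptw: "(\<lambda>n. \<psi> n x) \<longlonglongrightarrow> indicator F x" for x
    proof (cases "x \<in> F")
      case True
      then show ?thesis by (simp add: \<psi>_def)
    next
      case False
      then have pos: "infdist x F > 0"
        using in_closed_iff_infdist_zero[OF closed] F0 infdist_nonneg[of x F]
        by (metis empty_iff order_le_less)
      obtain M :: nat where M: "1 / infdist x F < real M" using reals_Archimedean2 by blast
      have "\<psi> n x = 0" if "n \<ge> M" for n
      proof -
        have "1 / infdist x F < real n" using M that by linarith
        then have "1 < real n * infdist x F" using pos by (simp add: divide_less_eq)
        then show ?thesis by (simp add: \<psi>_def)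
      qed
      then have "\<forall>\<^sub>F n in sequentially. \<psi> n x = 0"
        unfolding eventually_sequentially by blast
      then show ?thesis using False by (simp add: tendsto_eventually)
    qed
    have lim: "(\<lambda>n. \<integral>x. \<psi> n x \<partial>\<kappa>) \<longlonglongrightarrow> measure \<kappa> {0..b}" if \<kappa>: "\<kappa> \<in> circle_prob" for \<kappa>
    proof -
      interpret prob_space \<kappa> by (rule circle_probD(1)[OF \<kappa>])
      have meas: "F \<in> sets borel" using closed by (rule borel_closed)
      have "(\<lambda>n. \<integral>x. \<psi> n x \<partial>\<kappa>) \<longlonglongrightarrow> (\<integral>x. indicator F x \<partial>\<kappa>)"
      proof (rule integral_dominated_convergence[where w = "\<lambda>_. 1"])
        show "indicator F \<in> borel_measurable \<kappa>"
          using meas by (intro borel_measurable_circle[OF \<kappa>] borel_measurable_indicator)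
        show "\<psi> n \<in> borel_measurable \<kappa>" for n
          by (intro borel_measurable_circle[OF \<kappa>] circle_cont_measurable \<psi>)
        show "AE x in \<kappa>. norm (\<psi> n x) \<le> 1" for n
          by (intro AE_I2) (auto simp: \<psi>_def infdist_nonneg)
      qed (auto intro: ptw)
      moreover have "F \<inter> space \<kappa> = {0..b}"
        unfolding circle_probD(3)[OF \<kappa>] F_def using b by (auto simp: frac_eq[THEN iffD2])
      ultimately show ?thesis by simp
    qed
    show ?thesis
      using LIMSEQ_unique[OF lim[OF \<mu>]] lim[OF \<nu>] eq[OF \<psi>] by auto
  qed
  \<comment> \<open>Pushed forward to the real line, the measures become laws determined by their
    distribution functions, and the arcs give these on [0,1).\<close>
  let ?D = "\<lambda>\<kappa>. distr \<kappa> borel (\<lambda>x::real. x)"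
  have emeas: "emeasure (?D \<kappa>) A = emeasure \<kappa> (A \<inter> {0..<1})"
    if "\<kappa> \<in> circle_prob" "A \<in> sets borel" for \<kappa> A
    using that by (subst emeasure_distr) (auto intro: borel_measurable_circle simp: circle_probD(3))
  have cdf: "cdf (?D \<mu>) b = cdf (?D \<nu>) b" for b
  proof -
    have "measure \<mu> ({..b} \<inter> {0..<1}) = measure \<nu> ({..b} \<inter> {0..<1})"
    proof -
      consider "b < 0" | "0 \<le> b" "b < 1" | "1 \<le> b" by linarith
      then show ?thesis
      proof cases
        case 1
        then have "{..b} \<inter> {0..<1} = {}" by auto
        then show ?thesis by simp
      next
        case 2
        then have "{..b} \<inter> {0..<1} = {0..b}" by auto
        with arc[OF 2] show ?thesis by simp
      next
        case 3
        then have "{..b} \<inter> {0..<1} = {0..<1}" by auto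
        moreover have "measure \<kappa> {0..<1} = 1" if "\<kappa> \<in> circle_prob" for \<kappa>
          using prob_space.prob_space[OF circle_probD(1)[OF that]] circle_probD(3)[OF that] by simp
        ultimately show ?thesis using \<mu> \<nu> by simp
      qed
    qed
    then show ?thesis
      by (simp add: cdf_def measure_def emeas[OF \<mu>] emeas[OF \<nu>])
  qed
  have D: "?D \<mu> = ?D \<nu>"
    by (intro cdf_unique real_distribution_circle_prob \<mu> \<nu> ext cdf)
  show ?thesis
  proof (rule measure_eqI)
    show "sets \<mu> = sets \<nu>" by (simp only: circle_probD(2)[OF \<mu>] circle_probD(2)[OF \<nu>])
    fix A assume "A \<in> sets \<mu>"
    then have A: "A \<in> sets borel" "A \<inter> {0..<1} = A"
      by (auto simp: circle_probD(2)[OF \<mu>] sets_circle_borel)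
    show "emeasure \<mu> A = emeasure \<nu> A"
      using emeas[OF \<mu> A(1)] emeas[OF \<nu> A(1)] D A(2) by simp
  qed
qed

text \<open>All laws live on a bounded interval, so tightness is free and Helly's theorem yields a
  limit law on the line. That law may charge the point 1, which lies outside [0,1); pushing it
  forward along \<open>frac\<close> moves this mass to 0 and leaves the integrals of periodic
  functions unchanged.\<close>

lemma circle_prob_limit_exists:
  assumes \<nu>: "\<And>j. \<nu> j \<in> circle_prob"
    and lim: "\<And>\<phi>. \<phi> \<in> circle_cont \<Longrightarrow> (\<lambda>j. \<integral>x. \<phi> x \<partial>\<nu> j) \<longlonglongrightarrow> L \<phi>"
  shows "\<exists>\<mu>\<in>circle_prob. \<forall>\<phi>\<in>circle_cont. (\<integral>x. \<phi> x \<partial>\<mu>) = L \<phi>"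
proof -
  define D where "D j = distr (\<nu> j) borel (\<lambda>x::real. x)" for j
  have rd: "real_distribution (D j)" for j
    unfolding D_def by (intro real_distribution_circle_prob \<nu>)
  \<comment> \<open>Tightness is stated with intervals open on the left, hence the left end -1 to
    include the point 0.\<close>
  have "measure (D j) {-1<..1} = 1" for j
  proof -
    have "measure (D j) {-1<..1} = measure (\<nu> j) ({-1<..1} \<inter> space (\<nu> j))"
      unfolding D_def by (subst measure_distr) (auto intro: borel_measurable_circle \<nu>)
    also have "{-1<..1} \<inter> space (\<nu> j) = space (\<nu> j)" by (auto simp: circle_probD(3)[OF \<nu>])
    finally show ?thesis by (simp add: prob_space.prob_space[OF circle_probD(1)[OF \<nu>]])
  qed
  then have "tight D"
    unfolding tight_def using rd by (intro conjI allI impI exI[of _ "-1"] exI[of _ "1 :: real"]) simp_all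
  from tight_imp_convergent_subsubsequence[OF this, of id]
  obtain r M where r: "strict_mono (r :: nat \<Rightarrow> nat)" and M: "real_distribution M"
    and wc: "weak_conv_m (\<lambda>j. D (r j)) M" by (auto simp: strict_mono_def comp_def)
  interpret M: real_distribution M by (rule M)
  have int: "(\<integral>x. \<phi> x \<partial>M) = L \<phi>" if \<phi>: "\<phi> \<in> circle_cont" for \<phi>
  proof -
    obtain B where B: "\<And>x. \<bar>\<phi> x\<bar> \<le> B" using circle_cont_bounded[OF \<phi>] by auto
    have "(\<lambda>j. \<integral>x. \<phi> x \<partial>D (r j)) \<longlonglongrightarrow> (\<integral>x. \<phi> x \<partial>M)"
    proof (rule weak_conv_imp_integral_bdd_continuous_conv[OF rd M wc])
      show "isCont \<phi> x" for x
        using circle_cont_continuous[OF \<phi>, of UNIV] by (simp add: continuous_on_eq_continuous_at)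
      show "norm (\<phi> x) \<le> B" for x using B by simp
    qed
    moreover have "(\<integral>x. \<phi> x \<partial>D j) = (\<integral>x. \<phi> x \<partial>\<nu> j)" for j
      unfolding D_def
      by (subst integral_distr) (auto intro: borel_measurable_circle \<nu> circle_cont_measurable \<phi>)
    moreover have "(\<lambda>j. \<integral>x. \<phi> x \<partial>\<nu> (r j)) \<longlonglongrightarrow> L \<phi>"
      using LIMSEQ_subseq_LIMSEQ[OF lim[OF \<phi>] r] by (simp add: comp_def)
    ultimately show ?thesis by (auto intro: LIMSEQ_unique)
  qed
  have "(\<lambda>x::real. x - real_of_int \<lfloor>x\<rfloor>) \<in> borel_measurable borel" by measurable
  then have "(frac :: real \<Rightarrow> real) \<in> borel_measurable borel" by (simp add: frac_def[abs_def])
  then have frac: "frac \<in> measurable M circle_borel"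
    unfolding circle_borel_def
    by (intro measurable_restrict_space2) (auto simp: frac_lt_1)
  define \<mu> where "\<mu> = distr M circle_borel frac"
  have "prob_space \<mu>" unfolding \<mu>_def by (rule M.prob_space_distr[OF frac])
  then have "\<mu> \<in> circle_prob" by (simp add: circle_prob_def \<mu>_def)
  moreover have "(\<integral>x. \<phi> x \<partial>\<mu>) = L \<phi>" if \<phi>: "\<phi> \<in> circle_cont" for \<phi>
  proof -
    have "\<phi> \<in> borel_measurable circle_borel"
      unfolding circle_borel_def
      by (intro measurable_restrict_space1 circle_cont_measurable \<phi>)
    then have "(\<integral>x. \<phi> x \<partial>\<mu>) = (\<integral>x. \<phi> (frac x) \<partial>M)"
      unfolding \<mu>_def by (rule integral_distr[OF frac])
    then show ?thesis by (simp only: circle_cont_frac[OF \<phi>] int[OF \<phi>])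
  qed
  ultimately show ?thesis by blast
qed

section \<open>The weak topology expressed by integrals of test functions\<close>

lemma topspace_weak_topology: "topspace weak_topology = circle_prob"
  unfolding weak_topology_def topspace_pullback_topology by auto

lemma continuous_map_weak_topology:
  assumes "\<And>x. x \<in> topspace X \<Longrightarrow> \<Psi> x \<in> circle_prob"
    and "\<And>\<phi>. \<phi> \<in> circle_cont \<Longrightarrow> continuous_map X euclideanreal (\<lambda>x. \<integral>y. \<phi> y \<partial>\<Psi> x)"
  shows "continuous_map X weak_topology \<Psi>"
  unfolding weak_topology_def
proof (rule continuous_map_pullback')
  show "continuous_map X (product_topology (\<lambda>_. euclideanreal) circle_cont)
          ((\<lambda>\<mu>. \<lambda>\<phi>\<in>circle_cont. \<integral>x. \<phi> x \<partial>\<mu>) \<circ> \<Psi>)"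
    unfolding continuous_map_componentwise
    using assms(2) by (auto simp: comp_def)
qed (use assms(1) in auto)

lemma openin_weak_topology_integral:
  assumes "\<phi> \<in> circle_cont" and "open U"
  shows "openin weak_topology {\<mu> \<in> circle_prob. (\<integral>x. \<phi> x \<partial>\<mu>) \<in> U}"
proof -
  have "openin (product_topology (\<lambda>_. euclideanreal) circle_cont)
          {\<sigma> \<in> topspace (product_topology (\<lambda>_. euclideanreal) circle_cont). \<sigma> \<phi> \<in> U}"
    by (rule openin_continuous_map_preimage[OF continuous_map_product_projection[OF assms(1)]])
       (use assms(2) in auto)
  moreover have "{\<mu> \<in> circle_prob. (\<integral>x. \<phi> x \<partial>\<mu>) \<in> U} =
      (\<lambda>\<mu>. \<lambda>\<phi>\<in>circle_cont. \<integral>x. \<phi> x \<partial>\<mu>) -`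
        {\<sigma> \<in> topspace (product_topology (\<lambda>_. euclideanreal) circle_cont). \<sigma> \<phi> \<in> U} \<inter> circle_prob"
    using assms(1) by auto
  ultimately show ?thesis
    unfolding weak_topology_def openin_pullback_topology by blast
qed

text \<open>Eventual membership in \<open>circle_prob\<close> has to be listed separately: a measure
  outside it lies in no open set, whatever its integrals, and \<open>mu_N\<close> is the null
  measure where the block sum vanishes.\<close>

lemma limitin_weak_topology_iff:
  "limitin weak_topology s \<mu> F \<longleftrightarrow>
     \<mu> \<in> circle_prob \<and> (\<forall>\<^sub>F j in F. s j \<in> circle_prob) \<and>
     (\<forall>\<phi>\<in>circle_cont. ((\<lambda>j. \<integral>x. \<phi> x \<partial>s j) \<longlongrightarrow> (\<integral>x. \<phi> x \<partial>\<mu>)) F)"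
  (is "?L \<longleftrightarrow> ?R")
proof
  assume L: ?L
  have "\<forall>\<^sub>F j in F. s j \<in> circle_prob"
    using L openin_topspace[of weak_topology] unfolding limitin_def topspace_weak_topology by blast
  moreover have "((\<lambda>j. \<integral>x. \<phi> x \<partial>s j) \<longlongrightarrow> (\<integral>x. \<phi> x \<partial>\<mu>)) F" if \<phi>: "\<phi> \<in> circle_cont" for \<phi>
  proof (rule topological_tendstoI)
    fix U assume U: "open U" "(\<integral>x. \<phi> x \<partial>\<mu>) \<in> U"
    with L openin_weak_topology_integral[OF \<phi> U(1)]
    have "\<forall>\<^sub>F j in F. s j \<in> {\<mu> \<in> circle_prob. (\<integral>x. \<phi> x \<partial>\<mu>) \<in> U}"
      unfolding limitin_def topspace_weak_topology by blast
    then show "\<forall>\<^sub>F j in F. (\<integral>x. \<phi> x \<partial>s j) \<in> U" by eventually_elim simp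
  qed
  ultimately show ?R using L by (auto simp: limitin_def topspace_weak_topology)
next
  let ?I = "\<lambda>\<mu>. \<lambda>\<phi>\<in>circle_cont. \<integral>x. \<phi> x \<partial>\<mu>"
  assume R: ?R
  then have lim: "limitin (product_topology (\<lambda>_. euclideanreal) circle_cont) (\<lambda>j. ?I (s j)) (?I \<mu>) F"
    by (subst limitin_componentwise) auto
  show ?L unfolding limitin_def topspace_weak_topology
  proof (intro conjI allI impI)
    show "\<mu> \<in> circle_prob" using R by blast
    fix U assume U: "openin weak_topology U \<and> \<mu> \<in> U"
    then obtain W where W: "openin (product_topology (\<lambda>_. euclideanreal) circle_cont) W"
      "U = ?I -` W \<inter> circle_prob"
      unfolding weak_topology_def openin_pullback_topology by blast
    have "\<forall>\<^sub>F j in F. ?I (s j) \<in> W"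
      using lim W U unfolding limitin_def by blast
    moreover have "\<forall>\<^sub>F j in F. s j \<in> circle_prob" using R by blast
    ultimately show "\<forall>\<^sub>F j in F. s j \<in> U" by eventually_elim (simp add: W(2))
  qed
qed

subsection \<open>Sequences of measures governed by a phase\<close>

lemma frequently_compose_filterlim:
  assumes "\<exists>\<^sub>F j in F. P (q j)" and "filterlim q G F"
  shows "\<exists>\<^sub>F x in G. P x"
  unfolding frequently_def
proof (rule notI)
  assume "\<forall>\<^sub>F x in G. \<not> P x"
  from eventually_compose_filterlim[OF this assms(2)] assms(1)
  show False by (simp add: frequently_def)
qed

text \<open>Phases live in a metric space, so for them, unlike for the measures, accumulation points
  may be handled through subsequences.\<close>

lemma accumulation_point_top_of_set_iff:
  fixes s :: "nat \<Rightarrow> 'a::metric_space"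
  assumes s: "\<And>n. s n \<in> S"
  shows "accumulation_point (top_of_set S) s h \<longleftrightarrow>
    h \<in> S \<and> (\<exists>q. filterlim q at_top sequentially \<and> (\<lambda>j. s (q j)) \<longlonglongrightarrow> h)"
proof (intro iffI conjI)
  assume acc: "accumulation_point (top_of_set S) s h"
  then show h: "h \<in> S" by (simp add: accumulation_point_def)
  have "\<exists>n\<ge>M. dist (s n) h < e" if "e > 0" for M e
  proof -
    have "openin (top_of_set S) (S \<inter> ball h e)" by (intro openin_open_Int open_ball)
    moreover have "h \<in> S \<inter> ball h e" using h that by simp
    ultimately have "\<exists>\<^sub>F n in sequentially. s n \<in> S \<inter> ball h e"
      using acc unfolding accumulation_point_def by blast
    then show ?thesis by (auto simp: frequently_sequentially dist_commute)
  qed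
  from subsequence_tendsto_of_recurrence[OF this]
  show "\<exists>q. filterlim q at_top sequentially \<and> (\<lambda>j. s (q j)) \<longlonglongrightarrow> h" by metis
next
  assume R: "h \<in> S \<and> (\<exists>q. filterlim q at_top sequentially \<and> (\<lambda>j. s (q j)) \<longlonglongrightarrow> h)"
  then obtain q where q: "filterlim q at_top sequentially" "(\<lambda>j. s (q j)) \<longlonglongrightarrow> h" by blast
  show "accumulation_point (top_of_set S) s h"
    unfolding accumulation_point_def
  proof (intro conjI allI impI)
    show "h \<in> topspace (top_of_set S)" using R by simp
    fix U assume "openin (top_of_set S) U \<and> h \<in> U"
    then obtain T where T: "open T" "U = S \<inter> T" "h \<in> T" by (auto simp: openin_open)
    have "\<forall>\<^sub>F j in sequentially. s (q j) \<in> U"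
      using topological_tendstoD[OF q(2) T(1,3)] by eventually_elim (simp add: T(2) s)
    then have "\<exists>\<^sub>F j in sequentially. s (q j) \<in> U"
      by (rule eventually_frequently[OF sequentially_bot])
    then show "\<exists>\<^sub>F n in sequentially. s n \<in> U"
      using q(1) by (rule frequently_compose_filterlim)
  qed
qed

text \<open>The topological half of the theorem, with the regular sequence abstracted to one
  property: each test integral follows a continuous function of the phase. Nothing is assumed on how
  \<open>F\<close> depends on \<phi>; that the values at a fixed \<open>h\<close> are the integrals
  of one measure follows from a limit of actual measures \<open>mu N\<close> along powers of g
  tending to \<open>h\<close>.\<close>

lemma ghost_measures_of_asymptotic_phase:
  fixes g :: "nat \<Rightarrow> complex" and mu :: "nat \<Rightarrow> real measure"
  assumes g: "\<And>m. cmod (g m) = 1"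
    and prob: "\<forall>\<^sub>F N in sequentially. mu N \<in> circle_prob"
    and asym: "\<And>\<phi>. \<phi> \<in> circle_cont \<Longrightarrow> \<exists>F. continuous_on (phase_group g) F \<and>
                 (\<lambda>N. (\<integral>x. \<phi> x \<partial>mu N) - F (\<lambda>m. g m ^ N)) \<longlonglongrightarrow> 0"
  shows "\<exists>\<Psi>. continuous_map (top_of_set (phase_group g)) weak_topology \<Psi> \<and>
           {\<mu>. accumulation_point weak_topology mu \<mu>} = \<Psi> ` phase_group g \<and>
           (\<forall>(n :: nat \<Rightarrow> nat) \<mu>.
              filterlim n at_top sequentially \<longrightarrow> \<mu> \<in> circle_prob \<longrightarrow>
              (limitin weak_topology (\<lambda>j. mu (n j)) \<mu> sequentially \<longleftrightarrow>
               (\<forall>h. accumulation_point (top_of_set (phase_group g)) (\<lambda>j m. g m ^ n j) h \<longrightarrow>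
                    \<mu> = \<Psi> h)))"
proof -
  let ?G = "phase_group g" and ?g = "\<lambda>N m. g m ^ N"
  let ?I = "\<lambda>\<phi> \<mu>. \<integral>x. \<phi> x \<partial>\<mu>"
  have "\<exists>F. \<forall>\<phi>\<in>circle_cont. continuous_on ?G (F \<phi>) \<and> (\<lambda>N. ?I \<phi> (mu N) - F \<phi> (?g N)) \<longlonglongrightarrow> 0"
    by (rule bchoice) (use asym in blast)
  then obtain F where contF: "\<And>\<phi>. \<phi> \<in> circle_cont \<Longrightarrow> continuous_on ?G (F \<phi>)"
    and F0: "\<And>\<phi>. \<phi> \<in> circle_cont \<Longrightarrow> (\<lambda>N. ?I \<phi> (mu N) - F \<phi> (?g N)) \<longlonglongrightarrow> 0"
    by auto
  have along: "(\<lambda>j. F \<phi> (?g (q j))) \<longlonglongrightarrow> F \<phi> h" "(\<lambda>j. ?I \<phi> (mu (q j))) \<longlonglongrightarrow> F \<phi> h"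
    if q: "filterlim q at_top sequentially" "(\<lambda>j. ?g (q j)) \<longlonglongrightarrow> h" and h: "h \<in> ?G"
      and \<phi>: "\<phi> \<in> circle_cont" for q h \<phi>
  proof -
    show 1: "(\<lambda>j. F \<phi> (?g (q j))) \<longlonglongrightarrow> F \<phi> h"
      using contF[OF \<phi>] q(2) h power_in_phase_group[of g]
      unfolding continuous_on_sequentially comp_def by simp
    show "(\<lambda>j. ?I \<phi> (mu (q j))) \<longlonglongrightarrow> F \<phi> h"
      using tendsto_add[OF filterlim_compose[OF F0[OF \<phi>] q(1)] 1] by simp
  qed
  have "\<exists>\<mu>\<in>circle_prob. \<forall>\<phi>\<in>circle_cont. ?I \<phi> \<mu> = F \<phi> h" if h: "h \<in> ?G" for h
  proof -
    obtain q where q: "filterlim q at_top sequentially" "(\<lambda>j. ?g (q j)) \<longlonglongrightarrow> h"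
      by (rule phase_group_limit_of_powers[OF g h])
    \<comment> \<open>\<open>mu\<close> is a probability measure only eventually, so an initial
      segment of length \<open>J\<close> is cut off before a limit measure is extracted.\<close>
    from eventually_compose_filterlim[OF prob q(1)]
    obtain J where J: "\<And>j. j \<ge> J \<Longrightarrow> mu (q j) \<in> circle_prob"
      unfolding eventually_sequentially by blast
    show ?thesis
    proof (rule circle_prob_limit_exists[of "\<lambda>j. mu (q (j + J))"])
      show "mu (q (j + J)) \<in> circle_prob" for j by (rule J) simp
      show "(\<lambda>j. ?I \<phi> (mu (q (j + J)))) \<longlonglongrightarrow> F \<phi> h" if "\<phi> \<in> circle_cont" for \<phi>
        using along(2)[OF q h that] by (rule LIMSEQ_ignore_initial_segment)
    qed
  qed
  then have "\<exists>\<Psi>. \<forall>h\<in>?G. \<Psi> h \<in> circle_prob \<and> (\<forall>\<phi>\<in>circle_cont. ?I \<phi> (\<Psi> h) = F \<phi> h)"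
    by (intro bchoice) blast
  then obtain \<Psi> where \<Psi>: "\<And>h. h \<in> ?G \<Longrightarrow> \<Psi> h \<in> circle_prob"
    and I\<Psi>: "\<And>h \<phi>. h \<in> ?G \<Longrightarrow> \<phi> \<in> circle_cont \<Longrightarrow> ?I \<phi> (\<Psi> h) = F \<phi> h"
    by auto
  have \<Psi>_eqI: "\<mu> = \<Psi> h"
    if "\<mu> \<in> circle_prob" "h \<in> ?G" "\<And>\<phi>. \<phi> \<in> circle_cont \<Longrightarrow> ?I \<phi> \<mu> = F \<phi> h" for \<mu> h
    using that by (intro circle_prob_eqI \<Psi>) (simp_all add: I\<Psi>)
  have "continuous_map (top_of_set ?G) weak_topology \<Psi>"
  proof (rule continuous_map_weak_topology)
    show "\<Psi> h \<in> circle_prob" if "h \<in> topspace (top_of_set ?G)" for h using that \<Psi> by simp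
    show "continuous_map (top_of_set ?G) euclideanreal (\<lambda>h. ?I \<phi> (\<Psi> h))"
      if \<phi>: "\<phi> \<in> circle_cont" for \<phi>
      using contF[OF \<phi>] I\<Psi>[OF _ \<phi>] by (simp cong: continuous_on_cong)
  qed
  moreover have "{\<mu>. accumulation_point weak_topology mu \<mu>} = \<Psi> ` ?G"
  proof (intro equalityI subsetI)
    fix \<mu> assume "\<mu> \<in> {\<mu>. accumulation_point weak_topology mu \<mu>}"
    then have \<mu>: "\<mu> \<in> circle_prob"
      and freq: "\<And>U. openin weak_topology U \<Longrightarrow> \<mu> \<in> U \<Longrightarrow> \<exists>\<^sub>F N in sequentially. mu N \<in> U"
      by (auto simp: accumulation_point_def topspace_weak_topology)
    \<comment> \<open>Suppose every phase had a test function telling \<mu> apart from it. By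
      compactness finitely many of these functions serve all phases, and the weak neighbourhood of
      \<mu> that they cut out would be missed by \<open>mu N\<close> for all large N.\<close>
    have "\<exists>h\<in>?G. \<forall>\<phi>\<in>circle_cont. ?I \<phi> \<mu> = F \<phi> h"
    proof (rule ccontr)
      assume "\<not> ?thesis"
      then have "\<exists>\<phi>. \<forall>h\<in>?G. \<phi> h \<in> circle_cont \<and> ?I (\<phi> h) \<mu> \<noteq> F (\<phi> h) h"
        by (intro bchoice) blast
      then obtain \<phi> where \<phi>: "\<And>h. h \<in> ?G \<Longrightarrow> \<phi> h \<in> circle_cont"
        and ne: "\<And>h. h \<in> ?G \<Longrightarrow> ?I (\<phi> h) \<mu> \<noteq> F (\<phi> h) h" by auto
      \<comment> \<open>Half the gap. On \<open>T h\<close> the value of \<open>F (\<phi> h)\<close>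
        stays farther than \<open>e h\<close> from the integral of \<mu>; the contradiction comes
        from spending \<open>e h / 2\<close> on the neighbourhood \<open>U\<close> and
        \<open>e h / 2\<close> on the asymptotic error.\<close>
      define e where "e h = dist (F (\<phi> h) h) (?I (\<phi> h) \<mu>) / 2" for h
      have e: "e h > 0" if "h \<in> ?G" for h using ne[OF that] by (simp add: e_def)
      have "\<exists>T. \<forall>h\<in>?G. open (T h) \<and> T h \<inter> ?G = F (\<phi> h) -` (- cball (?I (\<phi> h) \<mu>) (e h)) \<inter> ?G"
      proof (intro bchoice ballI)
        fix h assume h: "h \<in> ?G"
        have "open (- cball (?I (\<phi> h) \<mu>) (e h))" by (intro open_Compl closed_cball)
        then show "\<exists>T. open T \<and> T \<inter> ?G = F (\<phi> h) -` (- cball (?I (\<phi> h) \<mu>) (e h)) \<inter> ?G"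
          using contF[OF \<phi>[OF h]] unfolding continuous_on_open_invariant by blast
      qed
      then obtain T where T: "\<And>h. h \<in> ?G \<Longrightarrow> open (T h)"
        "\<And>h. h \<in> ?G \<Longrightarrow> T h \<inter> ?G = F (\<phi> h) -` (- cball (?I (\<phi> h) \<mu>) (e h)) \<inter> ?G" by auto
      have "h \<in> T h" if "h \<in> ?G" for h
      proof -
        have "h \<in> F (\<phi> h) -` (- cball (?I (\<phi> h) \<mu>) (e h)) \<inter> ?G"
          using that e[OF that] by (simp add: e_def dist_commute)
        then show ?thesis using T(2)[OF that] by blast
      qed
      then have cov: "?G \<subseteq> (\<Union>h\<in>?G. T h)" by blast
      obtain C where C: "C \<subseteq> ?G" "finite C" "?G \<subseteq> (\<Union>h\<in>C. T h)"
        by (rule compactE_image[OF compact_phase_group[OF g] T(1) cov])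
      then have "C \<noteq> {}" using power_in_phase_group[of g 0] by blast
      define U where "U = (\<Inter>h\<in>C. {\<nu>\<in>circle_prob. ?I (\<phi> h) \<nu> \<in> ball (?I (\<phi> h) \<mu>) (e h / 2)})"
      have "openin weak_topology U"
        unfolding U_def
      proof (rule openin_Inter)
        fix X assume "X \<in> (\<lambda>h. {\<nu>\<in>circle_prob. ?I (\<phi> h) \<nu> \<in> ball (?I (\<phi> h) \<mu>) (e h / 2)}) ` C"
        then obtain h where h: "h \<in> C"
          "X = {\<nu>\<in>circle_prob. ?I (\<phi> h) \<nu> \<in> ball (?I (\<phi> h) \<mu>) (e h / 2)}" by blast
        then have "\<phi> h \<in> circle_cont" using C(1) \<phi> by blast
        then show "openin weak_topology X"
          unfolding h(2) by (rule openin_weak_topology_integral[OF _ open_ball])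
      qed (use C \<open>C \<noteq> {}\<close> in auto)
      moreover have "\<mu> \<in> U" using C(1) e \<mu> by (auto simp: U_def subset_iff)
      ultimately have freqU: "\<exists>\<^sub>F N in sequentially. mu N \<in> U" by (rule freq)
      have "\<forall>\<^sub>F N in sequentially. \<forall>h\<in>C. dist (?I (\<phi> h) (mu N)) (F (\<phi> h) (?g N)) < e h / 2"
      proof (rule eventually_ball_finite[OF C(2)], rule ballI)
        fix h assume "h \<in> C"
        then have h: "h \<in> ?G" using C by blast
        show "\<forall>\<^sub>F N in sequentially. dist (?I (\<phi> h) (mu N)) (F (\<phi> h) (?g N)) < e h / 2"
          using tendstoD[OF F0[OF \<phi>[OF h]] half_gt_zero[OF e[OF h]]]
          by (simp add: dist_real_def)
      qed
      from frequently_eventually_conj[OF freqU this]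
      have "\<exists>N. (\<forall>h\<in>C. dist (?I (\<phi> h) (mu N)) (F (\<phi> h) (?g N)) < e h / 2) \<and> mu N \<in> U"
        by (rule frequently_ex)
      then obtain N where N: "mu N \<in> U"
        "\<And>h. h \<in> C \<Longrightarrow> dist (?I (\<phi> h) (mu N)) (F (\<phi> h) (?g N)) < e h / 2" by blast
      obtain h where h: "h \<in> C" "?g N \<in> T h"
        using C(3) power_in_phase_group[of g N] by blast
      have "h \<in> ?G" using h(1) C(1) by blast
      have "?g N \<in> F (\<phi> h) -` (- cball (?I (\<phi> h) \<mu>) (e h)) \<inter> ?G"
        unfolding T(2)[OF \<open>h \<in> ?G\<close>, symmetric] using h(2) power_in_phase_group[of g N] by (rule IntI)
      then have "e h < dist (?I (\<phi> h) \<mu>) (F (\<phi> h) (?g N))" by simp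
      moreover have "dist (?I (\<phi> h) \<mu>) (?I (\<phi> h) (mu N)) < e h / 2"
        using N(1) h(1) by (auto simp: U_def)
      ultimately show False
        using N(2)[OF h(1)] dist_triangle[of "?I (\<phi> h) \<mu>" "F (\<phi> h) (?g N)" "?I (\<phi> h) (mu N)"]
        by linarith
    qed
    then show "\<mu> \<in> \<Psi> ` ?G" using \<Psi>_eqI[OF \<mu>] by blast
  next
    fix \<mu> assume "\<mu> \<in> \<Psi> ` ?G"
    then obtain h where h: "h \<in> ?G" "\<mu> = \<Psi> h" by blast
    obtain q where q: "filterlim q at_top sequentially" "(\<lambda>j. ?g (q j)) \<longlonglongrightarrow> h"
      by (rule phase_group_limit_of_powers[OF g h(1)])
    have lim: "limitin weak_topology (\<lambda>j. mu (q j)) \<mu> sequentially"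
      unfolding limitin_weak_topology_iff
      using \<Psi>[OF h(1)] eventually_compose_filterlim[OF prob q(1)] along(2)[OF q h(1)] I\<Psi>[OF h(1)]
      by (simp add: h(2))
    have "\<exists>\<^sub>F N in sequentially. mu N \<in> U" if "openin weak_topology U" "\<mu> \<in> U" for U
    proof -
      have "\<forall>\<^sub>F j in sequentially. mu (q j) \<in> U"
        using lim that unfolding limitin_def by blast
      then have "\<exists>\<^sub>F j in sequentially. mu (q j) \<in> U"
        by (rule eventually_frequently[OF sequentially_bot])
      then show ?thesis
        using q(1) by (rule frequently_compose_filterlim)
    qed
    then show "\<mu> \<in> {\<mu>. accumulation_point weak_topology mu \<mu>}"
      using \<Psi> h by (auto simp: accumulation_point_def topspace_weak_topology)
  qed
  moreover have "limitin weak_topology (\<lambda>j. mu (n j)) \<mu> sequentially \<longleftrightarrow>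
      (\<forall>h. accumulation_point (top_of_set ?G) (\<lambda>j. ?g (n j)) h \<longrightarrow> \<mu> = \<Psi> h)" (is "?L \<longleftrightarrow> ?R")
    if n: "filterlim n at_top sequentially" and \<mu>: "\<mu> \<in> circle_prob" for n \<mu>
  proof -
    have acc: "accumulation_point (top_of_set ?G) (\<lambda>j. ?g (n j)) h \<longleftrightarrow>
      h \<in> ?G \<and> (\<exists>q. filterlim q at_top sequentially \<and> (\<lambda>j. ?g (n (q j))) \<longlonglongrightarrow> h)" for h
      by (rule accumulation_point_top_of_set_iff) (rule power_in_phase_group)
    show ?thesis
    proof
      assume ?L
      then have lim: "(\<lambda>j. ?I \<phi> (mu (n j))) \<longlonglongrightarrow> ?I \<phi> \<mu>" if "\<phi> \<in> circle_cont" for \<phi>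
        using that by (simp add: limitin_weak_topology_iff)
      show ?R
      proof (intro allI impI)
        fix h assume "accumulation_point (top_of_set ?G) (\<lambda>j. ?g (n j)) h"
        then obtain q where h: "h \<in> ?G" and q: "filterlim q at_top sequentially"
          "(\<lambda>j. ?g (n (q j))) \<longlonglongrightarrow> h" by (auto simp: acc)
        show "\<mu> = \<Psi> h"
        proof (rule \<Psi>_eqI[OF \<mu> h])
          fix \<phi> assume \<phi>: "\<phi> \<in> circle_cont"
          have "(\<lambda>j. ?I \<phi> (mu (n (q j)))) \<longlonglongrightarrow> F \<phi> h"
            by (rule along(2)[OF filterlim_compose[OF n q(1)] q(2) h \<phi>])
          moreover have "(\<lambda>j. ?I \<phi> (mu (n (q j)))) \<longlonglongrightarrow> ?I \<phi> \<mu>"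
            by (rule filterlim_compose[OF lim[OF \<phi>] q(1)])
          ultimately show "?I \<phi> \<mu> = F \<phi> h" by (rule LIMSEQ_unique[symmetric])
        qed
      qed
    next
      assume R: ?R
      have "(\<lambda>j. ?I \<phi> (mu (n j))) \<longlonglongrightarrow> ?I \<phi> \<mu>" if \<phi>: "\<phi> \<in> circle_cont" for \<phi>
      \<comment> \<open>A subsequence staying away from the integral of \<mu> has, by compactness, a
        further subsequence whose phases converge to some \<open>h\<close>. The hypothesis
        identifies \<mu> with the measure of \<open>h\<close>, and along that subsequence the
        integrals do converge to its integral.\<close>
      proof (rule tendstoI, rule ccontr)
        fix e :: real
        assume e: "e > 0" and "\<not> (\<forall>\<^sub>F j in sequentially. dist (?I \<phi> (mu (n j))) (?I \<phi> \<mu>) < e)"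
        then have "infinite {j. \<not> dist (?I \<phi> (mu (n j))) (?I \<phi> \<mu>) < e}"
          by (simp add: cofinite_eq_sequentially[symmetric] eventually_cofinite)
        from infinite_enumerate[OF this] obtain r where r: "strict_mono (r :: nat \<Rightarrow> nat)"
          and bad: "\<And>j. \<not> dist (?I \<phi> (mu (n (r j)))) (?I \<phi> \<mu>) < e" by auto
        have "seq_compact ?G"
          using compact_phase_group[OF g] by (simp only: compact_eq_seq_compact_metric)
        moreover have "\<forall>j. ?g (n (r j)) \<in> ?G"
          by (rule allI, rule power_in_phase_group)
        ultimately obtain h s where h: "h \<in> ?G" and s: "strict_mono s"
          and "((\<lambda>j. ?g (n (r j))) \<circ> s) \<longlonglongrightarrow> h"
          by (rule seq_compactE)
        then have lim: "(\<lambda>j. ?g (n (r (s j)))) \<longlonglongrightarrow> h" by (simp only: comp_def)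
        have rs: "filterlim (\<lambda>j. r (s j)) at_top sequentially"
          using filterlim_compose[OF filterlim_subseq[OF r] filterlim_subseq[OF s]] .
        have "accumulation_point (top_of_set ?G) (\<lambda>j. ?g (n j)) h"
          unfolding acc using h rs lim by (intro conjI exI[of _ "\<lambda>j. r (s j)"])
        with R have "\<mu> = \<Psi> h" by blast
        then have "(\<lambda>j. ?I \<phi> (mu (n (r (s j))))) \<longlonglongrightarrow> ?I \<phi> \<mu>"
          using along(2)[OF filterlim_compose[OF n rs] lim h \<phi>] I\<Psi>[OF h \<phi>] by simp
        from tendstoD[OF this e] have "\<forall>\<^sub>F j in sequentially. False"
          by eventually_elim (use bad in blast)
        then show False by simp
      qed
      then show ?L
        unfolding limitin_weak_topology_iff
        using \<mu> eventually_compose_filterlim[OF prob n] by blast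
    qed
  qed
  ultimately show ?thesis by blast
qed

subsection \<open>Orthogonal projections\<close>

lemma mat_eqI_mult_vec:
  fixes A B :: "'a::semiring_1 mat"
  assumes A: "A \<in> carrier_mat n d" and B: "B \<in> carrier_mat n d"
    and eq: "\<And>x. x \<in> carrier_vec d \<Longrightarrow> A *\<^sub>v x = B *\<^sub>v x"
  shows "A = B"
proof (rule eq_matI)
  fix i j assume "i < dim_row B" "j < dim_col B"
  then have ij: "i < n" "j < d" using B by auto
  have "M $$ (i, j) = (M *\<^sub>v unit_vec d j) $ i" if "M \<in> carrier_mat n d" for M :: "'a mat"
    using that ij by simp
  from this[OF A] this[OF B] show "A $$ (i, j) = B $$ (i, j)" by (simp add: eq)
qed (use A B in auto)

lemma scalar_prod_self_eq_0:
  fixes x :: "real vec"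
  assumes "x \<in> carrier_vec d" and "x \<bullet> x = 0"
  shows "x = 0\<^sub>v d"
proof (rule eq_vecI)
  fix i assume "i < dim_vec (0\<^sub>v d)"
  then have i: "i < d" by simp
  have "(\<Sum>j\<in>{0..<d}. x $ j * x $ j) = 0" using assms by (simp add: scalar_prod_def)
  then have "x $ i * x $ i = 0" using i by (subst (asm) sum_nonneg_eq_0_iff) auto
  then show "x $ i = 0\<^sub>v d $ i" using i by simp
qed (use assms in auto)

lemma vec_eq_if_minus_eq_0:
  fixes x y :: "'a::ab_group_add vec"
  assumes "x \<in> carrier_vec d" "y \<in> carrier_vec d" "x - y = 0\<^sub>v d"
  shows "x = y"
proof (rule eq_vecI)
  fix i assume "i < dim_vec y"
  then have "i < d" using assms(2) by simp
  then have "x $ i - y $ i = (x - y) $ i" using assms(1,2) by simp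
  also have "\<dots> = 0" unfolding assms(3) using \<open>i < d\<close> by simp
  finally show "x $ i = y $ i" by simp
qed (use assms in auto)

definition vec_subspace :: "nat \<Rightarrow> real vec set \<Rightarrow> bool" where
  "vec_subspace d V \<longleftrightarrow> V \<subseteq> carrier_vec d \<and> 0\<^sub>v d \<in> V \<and>
     (\<forall>x\<in>V. \<forall>y\<in>V. x + y \<in> V) \<and> (\<forall>c. \<forall>x\<in>V. c \<cdot>\<^sub>v x \<in> V)"

lemma vec_subspaceD:
  assumes "vec_subspace d V"
  shows "x \<in> V \<Longrightarrow> x \<in> carrier_vec d" "0\<^sub>v d \<in> V" "x \<in> V \<Longrightarrow> y \<in> V \<Longrightarrow> x + y \<in> V"
    "x \<in> V \<Longrightarrow> c \<cdot>\<^sub>v x \<in> V" "x \<in> V \<Longrightarrow> y \<in> V \<Longrightarrow> x - y \<in> V"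
proof -
  show 1: "x \<in> V \<Longrightarrow> x \<in> carrier_vec d" "0\<^sub>v d \<in> V" "x \<in> V \<Longrightarrow> y \<in> V \<Longrightarrow> x + y \<in> V"
    "x \<in> V \<Longrightarrow> c \<cdot>\<^sub>v x \<in> V" for x y c
    using assms by (auto simp: vec_subspace_def)
  assume x: "x \<in> V" and y: "y \<in> V"
  have "x - y = x + (-1) \<cdot>\<^sub>v y" using 1(1)[OF x] 1(1)[OF y] by auto
  then show "x - y \<in> V" using 1(3)[OF x 1(4)[OF y]] by simp
qed

text \<open>The matrix on the left is \<open>M + c y y^T\<close>.\<close>

lemma rank_one_update_mult_vec:
  fixes y z :: "real vec"
  assumes M: "M \<in> carrier_mat d d" and y: "y \<in> carrier_vec d" and z: "z \<in> carrier_vec d"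
  shows "mat d d (\<lambda>(i, j). M $$ (i, j) + c * (y $ i * y $ j)) *\<^sub>v z = M *\<^sub>v z + (c * (y \<bullet> z)) \<cdot>\<^sub>v y"
proof (rule eq_vecI)
  fix i assume "i < dim_vec (M *\<^sub>v z + (c * (y \<bullet> z)) \<cdot>\<^sub>v y)"
  then have i: "i < d" using M y by simp
  show "(mat d d (\<lambda>(i, j). M $$ (i, j) + c * (y $ i * y $ j)) *\<^sub>v z) $ i =
      (M *\<^sub>v z + (c * (y \<bullet> z)) \<cdot>\<^sub>v y) $ i"
    using i M y z by (simp add: scalar_prod_def sum.distrib algebra_simps sum_distrib_left sum_distrib_right)
qed (use M y in auto)

text \<open>Among the symmetric idempotents with range in \<open>V\<close> one of maximal trace fixes \<open>V\<close> pointwise: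
  otherwise \<open>y = x - M x\<close> would allow adding the rank one projection onto \<open>y\<close>, of trace \<open>1\<close>.\<close>

lemma orth_proj_exists:
  assumes V: "vec_subspace d V"
  obtains M where "M \<in> carrier_mat d d" "\<And>x. x \<in> carrier_vec d \<Longrightarrow> M *\<^sub>v x \<in> V"
    "\<And>x. x \<in> carrier_vec d \<Longrightarrow> x - M *\<^sub>v x \<in> orth_compl d V"
proof -
  note VD = vec_subspaceD[OF V]
  \<comment> \<open>Demanding an integral trace lets the maximum be taken over natural numbers; it
    exists because the trace is at most \<open>d\<close>.\<close>
  define good where "good n M \<longleftrightarrow> M \<in> carrier_mat d d \<and> (\<forall>x\<in>carrier_vec d. M *\<^sub>v x \<in> V) \<and>
      (\<forall>x\<in>carrier_vec d. M *\<^sub>v (M *\<^sub>v x) = M *\<^sub>v x) \<and>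
      (\<forall>x\<in>carrier_vec d. \<forall>y\<in>carrier_vec d. x \<bullet> (M *\<^sub>v y) = (M *\<^sub>v x) \<bullet> y) \<and>
      (\<Sum>i<d. M $$ (i, i)) = real n" for n M
  have bound: "n \<le> d" if "good n M" for n M
  proof -
    from that have M: "M \<in> carrier_mat d d" and idem: "\<And>x. x\<in>carrier_vec d \<Longrightarrow> M *\<^sub>v (M *\<^sub>v x) = M *\<^sub>v x"
      and sym: "\<And>x y. x\<in>carrier_vec d \<Longrightarrow> y\<in>carrier_vec d \<Longrightarrow> x \<bullet> (M *\<^sub>v y) = (M *\<^sub>v x) \<bullet> y"
      and tr: "(\<Sum>i<d. M $$ (i, i)) = real n" by (auto simp: good_def)
    \<comment> \<open>For a symmetric idempotent the diagonal entry is the squared length of the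
      i-th column, hence at least its own square.\<close>
    have "M $$ (i, i) \<le> 1" if i: "i < d" for i
    proof -
      let ?e = "unit_vec d i :: real vec" and ?y = "M *\<^sub>v unit_vec d i"
      have y: "?y \<in> carrier_vec d" using M by simp
      have yi: "?y $ i = M $$ (i, i)" using M i by simp
      have "?y \<bullet> ?y = ?e \<bullet> (M *\<^sub>v ?y)" using sym[of ?e ?y] y by simp
      also have "\<dots> = M $$ (i, i)" using idem[of ?e] y i yi by simp
      finally have "(\<Sum>j\<in>{0..<d}. ?y $ j * ?y $ j) = M $$ (i, i)" using y unfolding scalar_prod_def by (simp only: carrier_vecD)
      moreover have "?y $ i * ?y $ i \<le> (\<Sum>j\<in>{0..<d}. ?y $ j * ?y $ j)"
        by (rule member_le_sum) (use i in auto)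
      ultimately have le: "M $$ (i, i) * M $$ (i, i) \<le> M $$ (i, i)" by (simp only: yi)
      show ?thesis
      proof (rule ccontr)
        assume "\<not> ?thesis"
        then have "1 * M $$ (i, i) < M $$ (i, i) * M $$ (i, i)"
          by (intro mult_strict_right_mono) auto
        with le show False by simp
      qed
    qed
    then have "(\<Sum>i<d. M $$ (i, i)) \<le> (\<Sum>i<d. 1)" by (intro sum_mono) auto
    then show ?thesis using tr by simp
  qed
  have "0\<^sub>m d d *\<^sub>v x = 0\<^sub>v d" if "x \<in> carrier_vec d" for x :: "real vec"
    using that by (intro eq_vecI) auto
  then have "good 0 (0\<^sub>m d d)" unfolding good_def using VD(2) by auto
  then have ex: "\<exists>M. good 0 M" by blast
  define n where "n = (GREATEST n. \<exists>M. good n M)"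
  have bound': "m \<le> d" if "\<exists>M. good m M" for m using that bound by blast
  have max: "m \<le> n" if "\<exists>M. good m M" for m
    unfolding n_def by (rule Greatest_le_nat[where P = "\<lambda>n. \<exists>M. good n M", OF that bound'])
  have "\<exists>M. good n M"
    unfolding n_def by (rule GreatestI_nat[where P = "\<lambda>n. \<exists>M. good n M", OF ex bound'])
  then obtain M where good: "good n M" by blast
  from good have M: "M \<in> carrier_mat d d" and ran: "\<And>x. x\<in>carrier_vec d \<Longrightarrow> M *\<^sub>v x \<in> V"
    and idem: "\<And>x. x\<in>carrier_vec d \<Longrightarrow> M *\<^sub>v (M *\<^sub>v x) = M *\<^sub>v x"
    and sym: "\<And>x y. x\<in>carrier_vec d \<Longrightarrow> y\<in>carrier_vec d \<Longrightarrow> x \<bullet> (M *\<^sub>v y) = (M *\<^sub>v x) \<bullet> y"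
    and tr: "(\<Sum>i<d. M $$ (i, i)) = real n" by (auto simp: good_def)
  have Mc: "M *\<^sub>v x \<in> carrier_vec d" for x using M by (auto intro: carrier_vecI)
  have fix_V: "M *\<^sub>v x = x" if x: "x \<in> V" for x
  proof (rule ccontr)
    assume ne: "M *\<^sub>v x \<noteq> x"
    have xc: "x \<in> carrier_vec d" using VD(1)[OF x] .
    define y where "y = x - M *\<^sub>v x"
    have yV: "y \<in> V" unfolding y_def by (rule VD(5)[OF x ran[OF xc]])
    have y: "y \<in> carrier_vec d" using VD(1)[OF yV] .
    have My: "M *\<^sub>v y = 0\<^sub>v d"
      unfolding y_def using idem[OF xc] Mc[of x] mult_minus_distrib_mat_vec[OF M xc Mc[of x]] by simp
    have "y \<noteq> 0\<^sub>v d"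
    proof
      assume "y = 0\<^sub>v d"
      then have "x = M *\<^sub>v x" using vec_eq_if_minus_eq_0[OF xc Mc[of x]] by (simp add: y_def)
      with ne[symmetric] show False by contradiction
    qed
    then have yy: "y \<bullet> y \<noteq> 0" using scalar_prod_self_eq_0[OF y] by blast
    define c where "c = 1 / (y \<bullet> y)"
    define M' where "M' = mat d d (\<lambda>(i, j). M $$ (i, j) + c * (y $ i * y $ j))"
    have M': "M' *\<^sub>v z = M *\<^sub>v z + (c * (y \<bullet> z)) \<cdot>\<^sub>v y" if "z \<in> carrier_vec d" for z
      unfolding M'_def by (rule rank_one_update_mult_vec[OF M y that])
    have yM: "y \<bullet> (M *\<^sub>v z) = 0" if "z \<in> carrier_vec d" for z
      using sym[OF y that] My that by simp
    have "good (Suc n) M'"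
      unfolding good_def
    proof (intro conjI ballI)
      show "M' \<in> carrier_mat d d" by (simp add: M'_def)
      show "M' *\<^sub>v z \<in> V" if z: "z \<in> carrier_vec d" for z
        unfolding M'[OF z] by (intro VD(3) VD(4) ran z yV)
      show "M' *\<^sub>v (M' *\<^sub>v z) = M' *\<^sub>v z" if z: "z \<in> carrier_vec d" for z
      proof -
        have car: "M *\<^sub>v z + (c * (y \<bullet> z)) \<cdot>\<^sub>v y \<in> carrier_vec d" using Mc y by simp
        have 1: "M *\<^sub>v (M *\<^sub>v z + (c * (y \<bullet> z)) \<cdot>\<^sub>v y) = M *\<^sub>v z"
        proof -
          have "(c * (y \<bullet> z)) \<cdot>\<^sub>v 0\<^sub>v d = (0\<^sub>v d :: real vec)" by (intro eq_vecI) auto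
          then show ?thesis
            using M y Mc[of z] z My idem[OF z] by (simp add: mult_add_distrib_mat_vec mult_mat_vec)
        qed
        have 2: "y \<bullet> (M *\<^sub>v z + (c * (y \<bullet> z)) \<cdot>\<^sub>v y) = y \<bullet> z"
          using y Mc[of z] yM[OF z] yy by (subst scalar_prod_add_distrib[of _ d]) (auto simp: c_def)
        show ?thesis unfolding M'[OF z] M'[OF car] 1 2 ..
      qed
      show "x \<bullet> (M' *\<^sub>v z) = (M' *\<^sub>v x) \<bullet> z" if x: "x \<in> carrier_vec d" and z: "z \<in> carrier_vec d" for x z
        unfolding M'[OF x] M'[OF z] using x z y Mc[of x] Mc[of z] sym[OF x z] comm_scalar_prod[OF x y]
        by (simp add: scalar_prod_add_distrib[of _ d] add_scalar_prod_distrib[of _ d])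
      have "(\<Sum>i<d. M' $$ (i, i)) = (\<Sum>i<d. M $$ (i, i)) + c * (y \<bullet> y)"
        unfolding M'_def using y
        by (simp add: sum.distrib sum_distrib_left scalar_prod_def lessThan_atLeast0)
      then show "(\<Sum>i<d. M' $$ (i, i)) = real (Suc n)" using tr yy by (simp add: c_def)
    qed
    then have "Suc n \<le> n" by (intro max exI)
    then show False by simp
  qed
  show thesis
  proof (rule that[OF M ran])
    fix x :: "real vec" assume x: "x \<in> carrier_vec d"
    have "(x - M *\<^sub>v x) \<bullet> y = 0" if y: "y \<in> V" for y
      using sym[OF x VD(1)[OF y]] VD(1)[OF y] x Mc[of x]
      by (simp add: fix_V[OF y] minus_scalar_prod_distrib[of _ d])
    then show "x - M *\<^sub>v x \<in> orth_compl d V" using x Mc[of x] by (auto simp: orth_compl_def)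
  qed
qed

lemma orth_compl_Int:
  assumes "x \<in> V" "x \<in> orth_compl d V"
  shows "x = 0\<^sub>v d"
  using assms by (intro scalar_prod_self_eq_0) (auto simp: orth_compl_def)

text \<open>Here the description by \<open>THE\<close> is discharged: the values of two candidates
  at \<open>x\<close> differ by a vector that lies in \<open>V\<close> and is orthogonal to
  \<open>V\<close>.\<close>

lemma
  assumes V: "vec_subspace d V"
  shows orth_proj_carrier: "orth_proj d V \<in> carrier_mat d d"
    and orth_proj_in: "\<And>x. x \<in> carrier_vec d \<Longrightarrow> orth_proj d V *\<^sub>v x \<in> V"
    and orth_proj_diff: "\<And>x. x \<in> carrier_vec d \<Longrightarrow> x - orth_proj d V *\<^sub>v x \<in> orth_compl d V"
proof -
  note VD = vec_subspaceD[OF V]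
  let ?P = "\<lambda>M. M \<in> carrier_mat d d \<and>
     (\<forall>x\<in>carrier_vec d. M *\<^sub>v x \<in> V \<and> x - M *\<^sub>v x \<in> orth_compl d V)"
  have "\<exists>M. ?P M"
    by (rule orth_proj_exists[OF V]) blast
  then obtain M where M: "?P M" by blast
  have "M' = M" if M': "?P M'" for M'
  proof (rule mat_eqI_mult_vec)
    show "M' \<in> carrier_mat d d" "M \<in> carrier_mat d d" using M M' by auto
    fix x :: "real vec" assume x: "x \<in> carrier_vec d"
    let ?z = "M' *\<^sub>v x - M *\<^sub>v x"
    have c: "M' *\<^sub>v x \<in> carrier_vec d" "M *\<^sub>v x \<in> carrier_vec d"
      using M M' x VD(1) by auto
    have "?z \<in> V" using M M' x by (intro VD(5)) auto
    moreover have "?z \<in> orth_compl d V"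
      unfolding orth_compl_def
    proof (intro CollectI conjI ballI)
      show "?z \<in> carrier_vec d" using c by simp
      fix y assume y: "y \<in> V"
      have "(x - M *\<^sub>v x) \<bullet> y = 0" "(x - M' *\<^sub>v x) \<bullet> y = 0"
        using M M' x y unfolding orth_compl_def by auto
      then show "?z \<bullet> y = 0"
        using c x VD(1)[OF y] by (simp add: minus_scalar_prod_distrib[of _ d])
    qed
    ultimately have z0: "?z = 0\<^sub>v d" by (rule orth_compl_Int)
    show "M' *\<^sub>v x = M *\<^sub>v x" by (rule vec_eq_if_minus_eq_0[OF c z0])
  qed
  with M have "?P (orth_proj d V)" unfolding orth_proj_def by (rule theI)
  then show "orth_proj d V \<in> carrier_mat d d"
    and "\<And>x. x \<in> carrier_vec d \<Longrightarrow> orth_proj d V *\<^sub>v x \<in> V"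
    and "\<And>x. x \<in> carrier_vec d \<Longrightarrow> x - orth_proj d V *\<^sub>v x \<in> orth_compl d V" by auto
qed

lemma orth_proj_scalar_prod:
  assumes V: "vec_subspace d V" and x: "x \<in> V" and y: "y \<in> carrier_vec d"
  shows "x \<bullet> (orth_proj d V *\<^sub>v y) = x \<bullet> y"
proof -
  let ?Py = "orth_proj d V *\<^sub>v y"
  have c: "x \<in> carrier_vec d" "?Py \<in> carrier_vec d"
    using vec_subspaceD(1)[OF V] x orth_proj_in[OF V y] by auto
  have "(y - ?Py) \<bullet> x = 0" using orth_proj_diff[OF V y] x by (simp add: orth_compl_def)
  then have "y \<bullet> x = ?Py \<bullet> x" using c y by (simp add: minus_scalar_prod_distrib[of _ d])
  then show ?thesis
    using comm_scalar_prod[OF c(1) y] comm_scalar_prod[OF c] by simp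
qed

lemma orth_proj_eq_0:
  assumes V: "vec_subspace d V" and y: "y \<in> carrier_vec d" and 0: "\<And>x. x \<in> V \<Longrightarrow> x \<bullet> y = 0"
  shows "orth_proj d V *\<^sub>v y = 0\<^sub>v d"
proof (rule scalar_prod_self_eq_0)
  show "orth_proj d V *\<^sub>v y \<in> carrier_vec d"
    using vec_subspaceD(1)[OF V] orth_proj_in[OF V y] by auto
  show "(orth_proj d V *\<^sub>v y) \<bullet> (orth_proj d V *\<^sub>v y) = 0"
    using orth_proj_scalar_prod[OF V orth_proj_in[OF V y] y] 0[OF orth_proj_in[OF V y]] by simp
qed

lemma orth_proj_idem:
  assumes V: "vec_subspace d V" and x: "x \<in> V"
  shows "orth_proj d V *\<^sub>v x = x"
proof -
  note VD = vec_subspaceD[OF V]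
  have xc: "x \<in> carrier_vec d" using VD(1)[OF x] .
  have c: "orth_proj d V *\<^sub>v x \<in> carrier_vec d" using VD(1)[OF orth_proj_in[OF V xc]] .
  have z: "x - orth_proj d V *\<^sub>v x = 0\<^sub>v d"
    by (rule orth_compl_Int[OF VD(5)[OF x orth_proj_in[OF V xc]] orth_proj_diff[OF V xc]])
  show ?thesis by (rule vec_eq_if_minus_eq_0[OF xc c z, symmetric])
qed

subsection \<open>Linear representations and digit sums\<close>

lemma
  assumes G: "G \<subseteq> carrier_vec d"
  defines "W \<equiv> LinearCombinations.module.span class_ring (module_vec TYPE(real) d) G"
  shows vec_subspace_span: "vec_subspace d W"
    and span_superset: "G \<subseteq> W"
    and span_minimal: "\<And>U. vec_subspace d U \<Longrightarrow> G \<subseteq> U \<Longrightarrow> W \<subseteq> U"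
proof -
  interpret vec_space "TYPE(real)" d .
  have W: "W = span G" unfolding W_def ..
  have sub: "submodule class_ring (span G) V" using G by (intro span_is_submodule) simp
  show "vec_subspace d W"
    using submodule.subset[OF sub] submodule.m_closed[OF sub] submodule.zero_closed[OF sub]
      submodule.smult_closed[OF sub]
    unfolding W vec_subspace_def by (auto simp: class_ring_simps)
  show "G \<subseteq> W" unfolding W by (rule in_own_span) (use G in simp)
  fix U assume U: "vec_subspace d U" "G \<subseteq> U"
  have "submodule class_ring U V"
    by (rule submodule.intro) (use vec_subspaceD[OF U(1)] in \<open>auto intro: module_axioms simp: class_ring_simps\<close>)
  then show "W \<subseteq> U" unfolding W by (rule span_is_subset[OF U(2)])
qed

lemma word_mat_carrier:
  assumes "\<And>i. i \<in> set w \<Longrightarrow> A i \<in> carrier_mat d d"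
  shows "word_mat d A w \<in> carrier_mat d d"
  using assms
proof (induction w)
  case (Cons i w)
  have "A i * word_mat d A w \<in> carrier_mat d d"
    using Cons by (intro mult_carrier_mat[of _ d d]) auto
  then show ?case by (simp add: word_mat_def)
qed (simp add: word_mat_def)

lemma word_mat_append1:
  assumes "\<And>i. i \<in> set w \<Longrightarrow> A i \<in> carrier_mat d d" and j: "A j \<in> carrier_mat d d"
  shows "word_mat d A (w @ [j]) = word_mat d A w * A j"
  using assms(1)
proof (induction w)
  case Nil
  then show ?case using j by (simp add: word_mat_def)
next
  case (Cons i w)
  have "word_mat d A w \<in> carrier_mat d d" by (rule word_mat_carrier) (use Cons.prems in auto)
  then have "A i * (word_mat d A w * A j) = A i * word_mat d A w * A j"
    using Cons.prems[of i] j by (intro assoc_mult_mat[symmetric]) auto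
  then show ?case using Cons by (simp add: word_mat_def)
qed

lemma base_expansion_digits: "k \<ge> 2 \<Longrightarrow> set (base_expansion k n) \<subseteq> {..<k}"
proof (induction n rule: less_induct)
  case (less n)
  show ?case
  proof (cases "n = 0")
    case True
    then show ?thesis by (subst base_expansion.simps) simp
  next
    case False
    have "n div k < n" using False less.prems by (intro div_less_dividend) auto
    from less.IH[OF this less.prems] show ?thesis
      using False less.prems by (subst base_expansion.simps) auto
  qed
qed

text \<open>The last hypothesis excludes the number 0, whose word is empty and not a single digit
  0.\<close>

lemma base_expansion_snoc:
  assumes "k \<ge> 2" "j < k" "n > 0 \<or> j > 0"
  shows "base_expansion k (k * n + j) = base_expansion k n @ [j]"
  using assms by (subst base_expansion.simps) auto

lemma map_vec_Re_mult:
  assumes "M \<in> carrier_mat n d" "w \<in> carrier_vec d"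
  shows "map_vec Re (map_mat complex_of_real M *\<^sub>v w) = M *\<^sub>v map_vec Re w"
    and "map_vec Im (map_mat complex_of_real M *\<^sub>v w) = M *\<^sub>v map_vec Im w"
  using assms by (auto intro!: eq_vecI simp: scalar_prod_def)

text \<open>\<open>pow_mat\<close> appends the new factor on the right; induction on vectors needs
  it on the left.\<close>

lemma pow_mat_Suc_vec:
  fixes M :: "'a::comm_semiring_1 mat"
  assumes M: "M \<in> carrier_mat d d" and y: "y \<in> carrier_vec d"
  shows "M ^\<^sub>m Suc n *\<^sub>v y = M *\<^sub>v (M ^\<^sub>m n *\<^sub>v y)"
proof -
  have "M ^\<^sub>m Suc n = M * M ^\<^sub>m n"
  proof (induction n)
    case 0
    then show ?case using M by simp
  next
    case (Suc n)
    have "M ^\<^sub>m Suc (Suc n) = (M * M ^\<^sub>m n) * M" by (simp only: pow_mat.simps(2)[of M "Suc n"] Suc)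
    also have "\<dots> = M * (M ^\<^sub>m n * M)" by (rule assoc_mult_mat[OF M pow_carrier_mat[OF M] M])
    finally show ?case by (simp only: pow_mat.simps(2))
  qed
  then show ?thesis using assoc_mult_mat_vec[OF M pow_carrier_mat[OF M] y] by (simp only:)
qed

lemma sum_blocks:
  fixes h :: "nat \<Rightarrow> 'a::comm_monoid_add"
  assumes "a \<le> b"
  shows "(\<Sum>m\<in>{a * k..<b * k}. h m) = (\<Sum>m\<in>{a..<b}. \<Sum>j<k. h (k * m + j))"
  using assms
proof (induction b rule: dec_induct)
  case (step b)
  have "(\<Sum>m\<in>{b * k..<Suc b * k}. h m) = (\<Sum>j<k. h (k * b + j))"
    by (rule sum.reindex_bij_witness[of _ "\<lambda>j. k * b + j" "\<lambda>m. m - k * b"]) (auto simp: mult.commute)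
  moreover have "(\<Sum>m\<in>{a * k..<Suc b * k}. h m) =
      (\<Sum>m\<in>{a * k..<b * k}. h m) + (\<Sum>m\<in>{b * k..<Suc b * k}. h m)"
    using step by (intro sum.atLeastLessThan_concat[symmetric]) auto
  ultimately show ?case using step by simp
qed simp

section \<open>Digit words, the space V and the compression of A to V\<close>

locale lin_rep =
  fixes k d :: nat and u :: "real vec" and A :: "nat \<Rightarrow> real mat" and v :: "real vec"
    and f :: "nat \<Rightarrow> real"
  assumes k: "k \<ge> 2" and rep: "linear_representation k d u A v f"
begin

abbreviation "V \<equiv> V_rep k d u A"
abbreviation "Pr \<equiv> orth_proj d V"
abbreviation "S \<equiv> sum_mat k d A"
abbreviation "N \<equiv> A_tilde k d u A"
abbreviation "word n \<equiv> word_mat d A (base_expansion k n)"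
text \<open>The row vector of \<open>u\<close> times the word matrix, kept as a column. The index 0
  gives \<open>u\<close> itself and is not listed among the generators of \<open>V\<close>.\<close>

definition "row_vec n = transpose_mat (word n) *\<^sub>v u"

lemma u: "u \<in> carrier_vec d" and v: "v \<in> carrier_vec d"
  and A: "j < k \<Longrightarrow> A j \<in> carrier_mat d d"
  and f: "f n = u \<bullet> (word n *\<^sub>v v)"
  using rep by (auto simp: linear_representation_def)

lemma S: "S \<in> carrier_mat d d"
  by (simp add: sum_mat_def)

lemma word: "word n \<in> carrier_mat d d"
  by (rule word_mat_carrier) (use A base_expansion_digits[OF k] in blast)

lemma word_step:
  assumes "n > 0 \<or> j > 0" "j < k"
  shows "word (k * n + j) = word n * A j"
  unfolding base_expansion_snoc[OF k assms(2,1)]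
  by (rule word_mat_append1) (use A base_expansion_digits[OF k] assms in blast)+

lemma row_vec_carrier: "row_vec n \<in> carrier_vec d"
  using word[of n] u by (simp add: row_vec_def)

lemma row_vec_scalar_prod: "y \<in> carrier_vec d \<Longrightarrow> row_vec n \<bullet> y = u \<bullet> (word n *\<^sub>v y)"
  unfolding row_vec_def by (rule transpose_vec_mult_scalar[OF word _ u])

lemma row_vec_step:
  assumes "n > 0 \<or> j > 0" "j < k"
  shows "row_vec (k * n + j) = transpose_mat (A j) *\<^sub>v row_vec n"
proof -
  have "transpose_mat (word n * A j) *\<^sub>v u = (transpose_mat (A j) * transpose_mat (word n)) *\<^sub>v u"
    using transpose_mult[OF word A[OF assms(2)]] by simp
  then show ?thesis
    unfolding row_vec_def word_step[OF assms]
    using word[of n] A[OF assms(2)] u by simp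
qed

lemma V_eq: "V = LinearCombinations.module.span class_ring (module_vec TYPE(real) d)
    {row_vec n | n. n \<ge> 1}"
  by (simp add: V_rep_def row_vec_def)

lemma subspace_V: "vec_subspace d V"
  unfolding V_eq by (rule vec_subspace_span) (use row_vec_carrier in blast)

lemma row_vec_in_V: "n \<ge> 1 \<Longrightarrow> row_vec n \<in> V"
  unfolding V_eq by (rule subsetD[OF span_superset]) (use row_vec_carrier in blast)+

text \<open>Appending the digit \<open>j\<close> to the word of \<open>n\<close> gives the word of
  \<open>k * n + j\<close>, so the transpose of \<open>A j\<close> maps generators to
  generators.\<close>

lemma V_invariant:
  assumes x: "x \<in> V" and j: "j < k"
  shows "transpose_mat (A j) *\<^sub>v x \<in> V"
proof -
  let ?U = "{x \<in> carrier_vec d. transpose_mat (A j) *\<^sub>v x \<in> V}"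
  note VD = vec_subspaceD[OF subspace_V]
  have T: "transpose_mat (A j) \<in> carrier_mat d d" using A[OF j] by simp
  have "vec_subspace d ?U"
    unfolding vec_subspace_def
  proof (intro conjI ballI allI)
    have "transpose_mat (A j) *\<^sub>v 0\<^sub>v d = (0\<^sub>v d :: real vec)" using T by (intro eq_vecI) auto
    then show "0\<^sub>v d \<in> ?U" using VD(2) by simp
    show "x + y \<in> ?U" if "x \<in> ?U" "y \<in> ?U" for x y
      using that VD(3) by (auto simp: mult_add_distrib_mat_vec[OF T])
    show "c \<cdot>\<^sub>v x \<in> ?U" if "x \<in> ?U" for c x
      using that VD(4) by (auto simp: mult_mat_vec[OF T])
  qed auto
  moreover have "{row_vec n | n. n \<ge> 1} \<subseteq> ?U"
  proof
    fix y assume "y \<in> {row_vec n | n. n \<ge> 1}"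
    then obtain n where n: "n \<ge> 1" "y = row_vec n" by blast
    have "row_vec (k * n + j) \<in> V" by (rule row_vec_in_V) (use n k in \<open>simp add: Suc_le_eq\<close>)
    then show "y \<in> ?U"
      using row_vec_step[of n j] n j row_vec_carrier by simp
  qed
  ultimately have "V \<subseteq> ?U"
    unfolding V_eq by (intro span_minimal) (use row_vec_carrier in blast)+
  then show ?thesis using x by blast
qed

lemma scalar_prod_S:
  assumes x: "x \<in> carrier_vec d" and y: "y \<in> carrier_vec d"
  shows "x \<bullet> (S *\<^sub>v y) = (\<Sum>l<k. x \<bullet> (A l *\<^sub>v y))"
proof -
  have Al: "(A l *\<^sub>v y) $ i = (\<Sum>j<d. A l $$ (i, j) * y $ j)" if "l < k" "i < d" for l i
    using A[OF that(1)] that(2) y by (simp add: scalar_prod_def lessThan_atLeast0)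
  have "(S *\<^sub>v y) $ i = (\<Sum>l<k. (A l *\<^sub>v y) $ i)" if i: "i < d" for i
  proof -
    have "(S *\<^sub>v y) $ i = (\<Sum>j<d. (\<Sum>l<k. A l $$ (i, j)) * y $ j)"
      using i y by (simp add: sum_mat_def scalar_prod_def lessThan_atLeast0)
    also have "\<dots> = (\<Sum>l<k. \<Sum>j<d. A l $$ (i, j) * y $ j)"
      by (simp add: sum_distrib_right) (rule sum.swap)
    also have "\<dots> = (\<Sum>l<k. (A l *\<^sub>v y) $ i)"
      by (intro sum.cong refl) (simp add: Al i)
    finally show ?thesis .
  qed
  then have "x \<bullet> (S *\<^sub>v y) = (\<Sum>i<d. \<Sum>l<k. x $ i * (A l *\<^sub>v y) $ i)"
    using S by (simp add: scalar_prod_def lessThan_atLeast0 sum_distrib_left)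
  also have "\<dots> = (\<Sum>l<k. \<Sum>i<d. x $ i * (A l *\<^sub>v y) $ i)" by (rule sum.swap)
  also have "\<dots> = (\<Sum>l<k. x \<bullet> (A l *\<^sub>v y))"
  proof (intro sum.cong refl)
    fix l assume "l \<in> {..<k}"
    then have "dim_vec (A l *\<^sub>v y) = d" using A[of l] by simp
    then show "(\<Sum>i<d. x $ i * (A l *\<^sub>v y) $ i) = x \<bullet> (A l *\<^sub>v y)"
      by (simp only: scalar_prod_def lessThan_atLeast0)
  qed
  finally show ?thesis .
qed

lemma Pr: "Pr \<in> carrier_mat d d"
  by (rule orth_proj_carrier[OF subspace_V])

text \<open>As \<open>V\<close> is invariant under the transposed digit matrices, its orthogonal
  complement is invariant under the digit matrices and under their sum.\<close>

lemma scalar_prod_S_orth: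
  assumes x: "x \<in> V" and y: "y \<in> orth_compl d V"
  shows "x \<bullet> (S *\<^sub>v y) = 0"
proof -
  have xc: "x \<in> carrier_vec d" and yc: "y \<in> carrier_vec d"
    using vec_subspaceD(1)[OF subspace_V x] y by (auto simp: orth_compl_def)
  have "x \<bullet> (A l *\<^sub>v y) = 0" if l: "l < k" for l
  proof -
    have "x \<bullet> (A l *\<^sub>v y) = (transpose_mat (A l) *\<^sub>v x) \<bullet> y"
      by (rule transpose_vec_mult_scalar[OF A[OF l] yc xc, symmetric])
    also have "\<dots> = y \<bullet> (transpose_mat (A l) *\<^sub>v x)"
      by (rule comm_scalar_prod[of _ d]) (use A[OF l] xc yc in auto)
    also have "\<dots> = 0" using y V_invariant[OF x l] by (simp add: orth_compl_def)
    finally show ?thesis .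
  qed
  then show ?thesis by (simp add: scalar_prod_S[OF xc yc])
qed

text \<open>\<open>S\<close> keeps the component of \<open>y\<close> orthogonal to \<open>V\<close>
  inside the complement, where \<open>Pr\<close> kills it.\<close>

lemma Pr_S_Pr:
  assumes y: "y \<in> carrier_vec d"
  shows "Pr *\<^sub>v (S *\<^sub>v (Pr *\<^sub>v y)) = Pr *\<^sub>v (S *\<^sub>v y)"
proof -
  have Py: "Pr *\<^sub>v y \<in> carrier_vec d" using Pr y by simp
  have "Pr *\<^sub>v (S *\<^sub>v (y - Pr *\<^sub>v y)) = 0\<^sub>v d"
    by (rule orth_proj_eq_0[OF subspace_V])
       (use S y Py scalar_prod_S_orth orth_proj_diff[OF subspace_V y] in auto)
  then have eq: "Pr *\<^sub>v (S *\<^sub>v y) - Pr *\<^sub>v (S *\<^sub>v (Pr *\<^sub>v y)) = 0\<^sub>v d"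
    using S y Py Pr by (simp add: mult_minus_distrib_mat_vec)
  have c: "Pr *\<^sub>v (S *\<^sub>v z) \<in> carrier_vec d" if "z \<in> carrier_vec d" for z
    using S Pr that by simp
  show ?thesis
    by (rule vec_eq_if_minus_eq_0[OF c[OF y] c[OF Py] eq, symmetric])
qed

lemma Pr_S_Pr_mult:
  "y \<in> carrier_vec d \<Longrightarrow> (Pr * S * Pr) *\<^sub>v y = Pr *\<^sub>v (S *\<^sub>v (Pr *\<^sub>v y))"
  using assoc_mult_mat_vec[OF mult_carrier_mat[OF Pr S] Pr, of y]
    assoc_mult_mat_vec[OF Pr S mult_mat_vec_carrier[OF Pr], of y]
  by (simp only:)

text \<open>Tested against \<open>V\<close>, the compression loses nothing: by
  \<open>Pr_S_Pr\<close> the inner projections in a power can be removed one at a time, and the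
  outermost one is invisible to \<open>x\<close>.\<close>

lemma scalar_prod_pow_Pr_S_Pr:
  assumes x: "x \<in> V" and y: "y \<in> carrier_vec d"
  shows "x \<bullet> ((Pr * S * Pr) ^\<^sub>m n *\<^sub>v y) = x \<bullet> (S ^\<^sub>m n *\<^sub>v y)"
proof -
  let ?B = "Pr * S * Pr"
  have B: "?B \<in> carrier_mat d d" using Pr S by simp
  have Bz: "?B *\<^sub>v z = Pr *\<^sub>v (S *\<^sub>v z)" if z: "z \<in> carrier_vec d" for z
    using Pr_S_Pr_mult[OF z] Pr_S_Pr[OF z] by (simp only:)
  have Bn: "?B ^\<^sub>m n *\<^sub>v y \<in> carrier_vec d" and Sn: "S ^\<^sub>m n *\<^sub>v y \<in> carrier_vec d" for n
    using B S y by (auto intro!: mult_mat_vec_carrier pow_carrier_mat)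
  have "Pr *\<^sub>v (?B ^\<^sub>m n *\<^sub>v y) = Pr *\<^sub>v (S ^\<^sub>m n *\<^sub>v y)"
  proof (induction n)
    case 0
    have "?B ^\<^sub>m 0 *\<^sub>v y = y" using y carrier_matD(1)[OF B] by (simp only: pow_mat.simps(1) one_mult_mat_vec)
    moreover have "S ^\<^sub>m 0 *\<^sub>v y = y" using y carrier_matD(1)[OF S] by (simp only: pow_mat.simps(1) one_mult_mat_vec)
    ultimately show ?case by (simp only:)
  next
    case (Suc n)
    let ?z = "Pr *\<^sub>v (S *\<^sub>v (S ^\<^sub>m n *\<^sub>v y))"
    have "?B *\<^sub>v (?B ^\<^sub>m n *\<^sub>v y) = Pr *\<^sub>v (S *\<^sub>v (Pr *\<^sub>v (?B ^\<^sub>m n *\<^sub>v y)))"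
      using Bz[OF Bn] Pr_S_Pr[OF Bn] by simp
    also have "\<dots> = ?z" unfolding Suc.IH by (rule Pr_S_Pr[OF Sn])
    finally have "Pr *\<^sub>v (?B ^\<^sub>m Suc n *\<^sub>v y) = Pr *\<^sub>v ?z"
      by (simp only: pow_mat_Suc_vec[OF B y])
    also have "\<dots> = ?z"
      by (rule orth_proj_idem[OF subspace_V orth_proj_in[OF subspace_V]])
         (use S Sn in auto)
    also have "\<dots> = Pr *\<^sub>v (S ^\<^sub>m Suc n *\<^sub>v y)"
      by (simp only: pow_mat_Suc_vec[OF S y])
    finally show ?case .
  qed
  then have "x \<bullet> (Pr *\<^sub>v (?B ^\<^sub>m n *\<^sub>v y)) = x \<bullet> (Pr *\<^sub>v (S ^\<^sub>m n *\<^sub>v y))" by (simp only:)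
  then show ?thesis
    by (simp only: orth_proj_scalar_prod[OF subspace_V x Bn] orth_proj_scalar_prod[OF subspace_V x Sn])
qed

lemma N_eq: "N = map_mat complex_of_real (Pr * S * Pr)"
  by (simp add: A_tilde_def Let_def)

lemma N: "N \<in> carrier_mat d d"
  unfolding N_eq using Pr S by simp

lemma scalar_prod_pow_A_tilde:
  assumes x: "x \<in> V" and y: "y \<in> carrier_vec d"
  shows "map_vec complex_of_real x \<bullet> (N ^\<^sub>m n *\<^sub>v map_vec complex_of_real y) =
    complex_of_real (x \<bullet> (S ^\<^sub>m n *\<^sub>v y))"
proof -
  let ?B = "Pr * S * Pr"
  have B: "?B \<in> carrier_mat d d" using Pr S by simp
  have xc: "x \<in> carrier_vec d" using vec_subspaceD(1)[OF subspace_V x] .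
  have "N ^\<^sub>m n *\<^sub>v map_vec complex_of_real y = map_vec complex_of_real (?B ^\<^sub>m n *\<^sub>v y)"
    by (simp only: N_eq of_real_hom.mat_hom_pow[OF B, of n, symmetric]
      of_real_hom.mult_mat_vec_hom[OF pow_carrier_mat[OF B, of n] y])
  moreover have "map_vec complex_of_real x \<bullet> map_vec complex_of_real z = complex_of_real (x \<bullet> z)"
    if "z \<in> carrier_vec d" for z
    using that xc by (simp add: scalar_prod_def)
  moreover have "?B ^\<^sub>m n *\<^sub>v y \<in> carrier_vec d"
    using B y by (auto intro!: mult_mat_vec_carrier pow_carrier_mat)
  ultimately show ?thesis by (simp add: scalar_prod_pow_Pr_S_Pr[OF x y])
qed

lemma N_kills_orth_compl:
  assumes w: "w \<in> complexification d (orth_compl d V)"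
  shows "N *\<^sub>v w = 0\<^sub>v d"
proof -
  let ?B = "Pr * S * Pr"
  have B: "?B \<in> carrier_mat d d" using Pr S by simp
  have wc: "w \<in> carrier_vec d" using w by (simp add: complexification_def)
  have *: "?B *\<^sub>v y = 0\<^sub>v d" if y: "y \<in> orth_compl d V" for y
  proof -
    have yc: "y \<in> carrier_vec d" using y by (simp add: orth_compl_def)
    have "Pr *\<^sub>v y = 0\<^sub>v d"
    proof (rule orth_proj_eq_0[OF subspace_V yc])
      fix x assume x: "x \<in> V"
      show "x \<bullet> y = 0"
        using y x comm_scalar_prod[OF yc vec_subspaceD(1)[OF subspace_V x]] by (simp add: orth_compl_def)
    qed
    moreover have "M *\<^sub>v 0\<^sub>v d = (0\<^sub>v d :: real vec)" if "M \<in> carrier_mat d d" for M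
      using that by (intro eq_vecI) auto
    ultimately show ?thesis using Pr S by (simp only: Pr_S_Pr_mult[OF yc])
  qed
  have "map_vec Re (N *\<^sub>v w) = 0\<^sub>v d" "map_vec Im (N *\<^sub>v w) = 0\<^sub>v d"
    using w unfolding N_eq map_vec_Re_mult[OF B wc] complexification_def by (auto intro: *)
  moreover have "Re ((N *\<^sub>v w) $ i) = map_vec Re (N *\<^sub>v w) $ i"
    "Im ((N *\<^sub>v w) $ i) = map_vec Im (N *\<^sub>v w) $ i" if "i < d" for i
    using that N by simp_all
  ultimately have "Re ((N *\<^sub>v w) $ i) = 0" "Im ((N *\<^sub>v w) $ i) = 0" if "i < d" for i
    using that by (simp_all only: index_zero_vec)
  then show ?thesis using N by (intro eq_vecI) (auto simp: complex_eq_iff)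
qed

lemma N_range:
  assumes w: "w \<in> carrier_vec d"
  shows "N *\<^sub>v w \<in> complexification d V"
proof -
  let ?B = "Pr * S * Pr"
  have B: "?B \<in> carrier_mat d d" using Pr S by simp
  have *: "?B *\<^sub>v y \<in> V" if y: "y \<in> carrier_vec d" for y
  proof -
    have "S *\<^sub>v (Pr *\<^sub>v y) \<in> carrier_vec d" using Pr S y by simp
    from orth_proj_in[OF subspace_V this] show ?thesis by (simp only: Pr_S_Pr_mult[OF y])
  qed
  have "map_vec Re (N *\<^sub>v w) \<in> V" "map_vec Im (N *\<^sub>v w) \<in> V"
    unfolding N_eq map_vec_Re_mult[OF B w] using w by (auto intro!: *)
  then show ?thesis using N w by (simp add: complexification_def)
qed

text \<open>The numbers in this range are those whose word is the word of \<open>n\<close> followed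
  by \<open>l\<close> arbitrary digits; \<open>n >= 1\<close> ensures that zeros among these digits
  are kept. Summing over the digits turns each into a factor \<open>S\<close>. The induction removes
  the last digit, so \<open>y\<close> is arbitrary and absorbs one factor at each step.\<close>

lemma sum_digit_block:
  assumes n: "n \<ge> 1" and y: "y \<in> carrier_vec d"
  shows "(\<Sum>m\<in>{n * k ^ l..<(n + 1) * k ^ l}. u \<bullet> (word m *\<^sub>v y)) = row_vec n \<bullet> (S ^\<^sub>m l *\<^sub>v y)"
  using y
proof (induction l arbitrary: y)
  case 0
  then show ?case using S row_vec_scalar_prod by simp
next
  case (Suc l)
  have Sy: "S *\<^sub>v y \<in> carrier_vec d" using S Suc.prems by simp
  have step: "(\<Sum>j<k. u \<bullet> (word (k * m + j) *\<^sub>v y)) = u \<bullet> (word m *\<^sub>v (S *\<^sub>v y))"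
    if m: "m > 0" for m
  proof -
    have "u \<bullet> (word (k * m + j) *\<^sub>v y) = row_vec m \<bullet> (A j *\<^sub>v y)" if j: "j < k" for j
    proof -
      have Ay: "A j *\<^sub>v y \<in> carrier_vec d" using A[OF j] Suc.prems by simp
      have "word (k * m + j) *\<^sub>v y = word m *\<^sub>v (A j *\<^sub>v y)"
        using word_step[of m j] m j word[of m] A[OF j] Suc.prems by simp
      then show ?thesis by (simp only: row_vec_scalar_prod[OF Ay])
    qed
    then have "(\<Sum>j<k. u \<bullet> (word (k * m + j) *\<^sub>v y)) = row_vec m \<bullet> (S *\<^sub>v y)"
      by (simp add: scalar_prod_S[OF row_vec_carrier Suc.prems])
    then show ?thesis by (simp only: row_vec_scalar_prod[OF Sy])
  qed
  have "(\<Sum>m\<in>{n * k ^ Suc l..<(n + 1) * k ^ Suc l}. u \<bullet> (word m *\<^sub>v y)) =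
      (\<Sum>m\<in>{n * k ^ l..<(n + 1) * k ^ l}. \<Sum>j<k. u \<bullet> (word (k * m + j) *\<^sub>v y))"
    using sum_blocks[of "n * k ^ l" "(n + 1) * k ^ l" "\<lambda>m. u \<bullet> (word m *\<^sub>v y)" k]
    by (simp add: mult_ac)
  also have "\<dots> = (\<Sum>m\<in>{n * k ^ l..<(n + 1) * k ^ l}. u \<bullet> (word m *\<^sub>v (S *\<^sub>v y)))"
  proof (intro sum.cong refl step)
    fix m assume "m \<in> {n * k ^ l..<(n + 1) * k ^ l}"
    moreover have "n * k ^ l > 0" using n k by simp
    ultimately show "m > 0" unfolding atLeastLessThan_iff by linarith
  qed
  also have "\<dots> = row_vec n \<bullet> (S ^\<^sub>m l *\<^sub>v (S *\<^sub>v y))" by (rule Suc.IH[OF Sy])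
  also have "S ^\<^sub>m l *\<^sub>v (S *\<^sub>v y) = S ^\<^sub>m Suc l *\<^sub>v y"
    using assoc_mult_mat_vec[OF pow_carrier_mat[OF S, of l] S Suc.prems] by (simp only: pow_mat.simps(2))
  finally show ?case .
qed

end

subsection \<open>Powers of Jordan matrices\<close>

lemma char_matrix_jordan_matrix:
  fixes z :: "'a::field"
  shows "char_matrix (jordan_matrix n_as) z = jordan_matrix (map (\<lambda>(n, a). (n, a - z)) n_as)"
proof (induction n_as)
  case Nil
  then show ?case by (intro eq_matI) (auto simp: char_matrix_def jordan_matrix_def)
next
  case (Cons na n_as)
  obtain n a where na: "na = (n, a)" by force
  let ?m = "sum_list (map fst n_as)"
  have m: "sum_list (map fst (map (\<lambda>(n, a). (n, a - z)) n_as)) = ?m"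
    by (induction n_as) auto
  have m': "(\<Sum>(n, a)\<leftarrow>n_as. n) = ?m"
    by (induction n_as) auto
  have entry: "char_matrix J z $$ (i, j) = J $$ (i, j) - (if i = j then z else 0)"
    if "i < n" "j < n" "J \<in> carrier_mat n n" for i j n and J :: "'a mat"
    using that by (simp add: char_matrix_def)
  have IH: "jordan_matrix (map (\<lambda>(n, a). (n, a - z)) n_as) $$ (i, j) =
      jordan_matrix n_as $$ (i, j) - (if i = j then z else 0)" if "i < ?m" "j < ?m" for i j
    unfolding Cons.IH[symmetric] using that by (intro entry) auto
  show ?case
  proof (rule eq_matI)
    let ?R = "jordan_matrix (map (\<lambda>(n, a). (n, a - z)) (na # n_as))"
    show "dim_row (char_matrix (jordan_matrix (na # n_as)) z) = dim_row ?R"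
      "dim_col (char_matrix (jordan_matrix (na # n_as)) z) = dim_col ?R"
      by (simp_all add: char_matrix_def na m m')
    fix i j assume "i < dim_row ?R" "j < dim_col ?R"
    then have ij: "i < n + ?m" "j < n + ?m" by (simp_all add: na m m')
    have "char_matrix (jordan_matrix (na # n_as)) z $$ (i, j) =
        jordan_matrix (na # n_as) $$ (i, j) - (if i = j then z else 0)"
      using jordan_matrix_carrier[of "na # n_as"] by (intro entry[OF ij]) (simp add: na)
    also have "\<dots> = ?R $$ (i, j)"
      using ij by (auto simp: na jordan_matrix_Cons m m' IH)
    finally show "char_matrix (jordan_matrix (na # n_as)) z $$ (i, j) = ?R $$ (i, j)" .
  qed
qed

lemma four_block_diag_entry:
  assumes "B \<in> carrier_mat n n" "C \<in> carrier_mat m m" "i < n + m" "j < n + m"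
  shows "four_block_mat B (0\<^sub>m n m) (0\<^sub>m m n) C $$ (i, j) =
    (if i < n then if j < n then B $$ (i, j) else 0 else if j < n then 0 else C $$ (i - n, j - n))"
  using assms by auto

text \<open>The shift by \<open>z\<close> is included because the generalised eigenspaces are kernels of powers of
  \<^term>\<open>char_matrix J z\<close>.\<close>

lemma jordan_matrix_shift_pow_entry:
  fixes n_as :: "(nat \<times> 'a::field) list"
  defines "J \<equiv> jordan_matrix n_as"
  assumes ij: "i < sum_list (map fst n_as)" "j < sum_list (map fst n_as)"
  shows "(\<forall>z m. (char_matrix J z ^\<^sub>m m) $$ (i, j) = 0) \<or>
    (i \<le> j \<and> J $$ (j, j) = J $$ (i, i) \<and> (\<exists>b. (b, J $$ (i, i)) \<in> set n_as \<and> j - i < b) \<and>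
     (\<forall>z m. (char_matrix J z ^\<^sub>m m) $$ (i, j) = of_nat (m choose (j - i)) * (J $$ (i, i) - z) ^ (m + i - j)))"
  using ij unfolding J_def char_matrix_jordan_matrix jordan_matrix_pow
proof (induction n_as arbitrary: i j)
  case Nil
  then show ?case by simp
next
  case (Cons na n_as)
  obtain n a where na: "na = (n, a)" by force
  let ?m = "sum_list (map fst n_as)"
  define K where "K z m = diag_block_mat (map (\<lambda>(n, a). jordan_block n a ^\<^sub>m m)
      (map (\<lambda>(n, a). (n, a - z)) n_as))" for z m
  have K: "K z m \<in> carrier_mat ?m ?m" for z m
    unfolding K_def by (rule carrier_matI; induction n_as) (auto simp: Let_def)
  have K_Cons: "diag_block_mat (map (\<lambda>(n, a). jordan_block n a ^\<^sub>m m)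
      (map (\<lambda>(n, a). (n, a - z)) (na # n_as))) =
    four_block_mat (jordan_block n (a - z) ^\<^sub>m m) (0\<^sub>m n ?m) (0\<^sub>m ?m n) (K z m)" for z m
    using carrier_matD[OF K[of z m]] unfolding K_def na by (simp add: Let_def)
  have J: "jordan_matrix (na # n_as) $$ (i, j) = (if i < n then if j < n then jordan_block n a $$ (i, j) else 0
      else if j < n then 0 else jordan_matrix n_as $$ (i - n, j - n))"
    if "i < n + ?m" "j < n + ?m" for i j
    unfolding na jordan_matrix_Cons
    by (rule four_block_diag_entry[OF jordan_block_carrier jordan_matrix_carrier that])
  have ij: "i < n + ?m" "j < n + ?m" using Cons.prems unfolding na by simp_all
  note E = trans[OF arg_cong[OF K_Cons, of "\<lambda>M. M $$ (i, j)"] four_block_diag_entry[OF jordan_block_pow_carrier K ij]]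
  consider "i < n" "j < n" | "i < n" "\<not> j < n" | "\<not> i < n" "j < n" | "\<not> i < n" "\<not> j < n"
    by argo
  then show ?case
  proof cases
    case 1
    have pow: "(jordan_block n (a - z) ^\<^sub>m m) $$ (i, j) =
        (if i \<le> j then of_nat (m choose (j - i)) * (a - z) ^ (m + i - j) else 0)" for z m
      unfolding jordan_block_pow using 1 by simp
    show ?thesis
    proof (cases "i \<le> j")
      case True
      have "j - i < n" using 1 by simp
      moreover have "jordan_matrix (na # n_as) $$ (i, i) = a" "jordan_matrix (na # n_as) $$ (j, j) = a"
        unfolding J[OF ij(1) ij(1)] J[OF ij(2) ij(2)] using 1 by simp_all
      moreover have "(n, a) \<in> set (na # n_as)" by (simp add: na)
      ultimately show ?thesis
        using 1 True by (intro disjI2 conjI allI exI[of _ n]) (simp_all only: E pow if_True)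
    next
      case False
      then show ?thesis using 1 by (intro disjI1 allI) (simp only: E pow if_True if_False)
    qed
  next
    case 4
    then have "i - n < ?m" "j - n < ?m" using ij by auto
    from Cons.IH[OF this, folded K_def] show ?thesis
    proof (elim disjE)
      assume "\<forall>z m. K z m $$ (i - n, j - n) = 0"
      then show ?thesis using 4 by (intro disjI1 allI) (simp only: E if_False)
    next
      assume *: "i - n \<le> j - n \<and> jordan_matrix n_as $$ (j - n, j - n) = jordan_matrix n_as $$ (i - n, i - n) \<and>
        (\<exists>b. (b, jordan_matrix n_as $$ (i - n, i - n)) \<in> set n_as \<and> j - n - (i - n) < b) \<and>
        (\<forall>z m. K z m $$ (i - n, j - n) = of_nat (m choose (j - n - (i - n))) *
            (jordan_matrix n_as $$ (i - n, i - n) - z) ^ (m + (i - n) - (j - n)))"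
      then have "i \<le> j" using 4 by auto
      then have eqs: "j - n - (i - n) = j - i" "m + (i - n) - (j - n) = m + i - j" for m
        using 4 by auto
      note Jii = J[OF ij(1) ij(1), unfolded if_not_P[OF 4(1)]]
      note Jjj = J[OF ij(2) ij(2), unfolded if_not_P[OF 4(2)]]
      from * obtain b where "(b, jordan_matrix n_as $$ (i - n, i - n)) \<in> set (na # n_as)" "j - i < b"
        unfolding eqs by auto
      then show ?thesis
        using * \<open>i \<le> j\<close> 4 unfolding Jii Jjj eqs
        by (intro disjI2 conjI allI exI[of _ b]) (simp_all only: E if_False)
    qed
  next
    case 2
    then show ?thesis by (intro disjI1 allI) (simp only: E if_True if_False)
  next
    case 3
    then show ?thesis by (intro disjI1 allI) (simp only: E if_True if_False)
  qed
qed

lemma complex_jordan_nf_exists: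
  fixes M :: "complex mat"
  assumes M: "M \<in> carrier_mat d d"
  shows "\<exists>n_as. jordan_nf M n_as"
proof -
  from char_poly_factorized[OF M] obtain as where "char_poly M = (\<Prod>a\<leftarrow>as. [:- a, 1:])" by auto
  from jordan_nf_exists[OF M this] show ?thesis .
qed

section \<open>Scalar limits governing the entries of Jordan powers\<close>

lemma LIMSEQ_choose_over_power:
  assumes "q \<le> p"
  shows "convergent (\<lambda>n. real (n choose q) / real n ^ p)"
  using assms
proof (induction q arbitrary: p)
  case 0
  have "convergent (\<lambda>n. (1 / real n) ^ p)"
    by (rule convergentI[OF tendsto_power[OF lim_1_over_n]])
  then show ?case by (simp add: power_one_over)
next
  case (Suc q)
  \<comment> \<open>The step is the recursion by which the binomial coefficient at
    \<open>Suc q\<close> is the one at \<open>q\<close> times \<open>(n - q) / Suc q\<close>; one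
    factor \<open>n\<close> of the denominator is spent on \<open>n - q\<close>.\<close>
  then obtain p' where p: "p = Suc p'" "q \<le> p'" by (cases p) auto
  from Suc.IH[OF p(2)] obtain L where L: "(\<lambda>n. real (n choose q) / real n ^ p') \<longlonglongrightarrow> L"
    by (auto simp: convergent_def)
  have "(\<lambda>n. 1 - real q * (1 / real n)) \<longlonglongrightarrow> 1 - real q * 0"
    by (intro tendsto_intros lim_1_over_n)
  from tendsto_mult[OF L this]
  have "(\<lambda>n. (real (n choose q) / real n ^ p' * (1 - real q * (1 / real n))) / real (Suc q)) \<longlonglongrightarrow> L * 1 / real (Suc q)"
    by (intro tendsto_divide tendsto_const) auto
  moreover have "\<forall>\<^sub>F n in sequentially. (real (n choose q) / real n ^ p' * (1 - real q * (1 / real n))) / real (Suc q)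
      = real (n choose Suc q) / real n ^ p"
    using eventually_ge_at_top[of "Suc q"]
  proof eventually_elim
    case (elim n)
    obtain n' where n': "n = Suc n'" using elim by (cases n) auto
    have "Suc q * (n choose Suc q) = (n choose q) * (n - q)"
      using binomial_absorb_comp[of n q] Suc_times_binomial[of q n'] unfolding n' by (simp add: mult.commute)
    then have "real (Suc q * (n choose Suc q)) = real ((n choose q) * (n - q))" by (simp only:)
    then have "real (Suc q) * real (n choose Suc q) = real (n choose q) * (real n - real q)"
      using elim by (simp only: of_nat_mult of_nat_diff[OF Suc_leD[OF elim]])
    then have eq: "real (n choose Suc q) = real (n choose q) * (real n - real q) / real (Suc q)"
      by (simp add: field_simps del: of_nat_Suc)
    have n: "1 - real q * (1 / real n) = (real n - real q) / real n"
      using elim by (simp add: field_simps)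
    show ?case unfolding eq n p(1) by (simp add: mult_ac del: of_nat_Suc)
  qed
  ultimately show ?case by (auto simp: convergent_def dest: Lim_transform_eventually)
qed

text \<open>With \<open>y\<close> the root of \<open>x\<close> of order \<open>Suc q\<close>, the
  null sequence \<open>n * y ^ n\<close> raised to the power \<open>Suc q\<close> dominates the
  claim.\<close>

lemma LIMSEQ_power_times_geometric:
  fixes x :: real
  assumes "0 \<le> x" "x < 1"
  shows "(\<lambda>n. real n ^ q * x ^ n) \<longlonglongrightarrow> 0"
proof -
  define y where "y = root (Suc q) x"
  have y: "0 \<le> y" "y < 1" "y ^ Suc q = x"
    using assms real_root_pow_pos2[of "Suc q" x] by (simp_all add: y_def)
  have "(\<lambda>n. real n * y ^ n) \<longlonglongrightarrow> 0"
    using y by (intro powser_times_n_limit_0) auto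
  then have "(\<lambda>n. (real n * y ^ n) ^ Suc q) \<longlonglongrightarrow> 0 ^ Suc q" by (rule tendsto_power)
  moreover have eq: "(real n * y ^ n) ^ Suc q = real n ^ Suc q * x ^ n" for n
    by (simp only: power_mult_distrib power_mult[symmetric] mult.commute[of n] y(3)[symmetric])
  moreover have "(0 :: real) ^ Suc q = 0" by simp
  ultimately have lim: "(\<lambda>n. real n ^ Suc q * x ^ n) \<longlonglongrightarrow> 0" by (simp only:)
  show ?thesis
  proof (rule tendsto_sandwich[OF _ _ tendsto_const lim])
    show "\<forall>\<^sub>F n in sequentially. 0 \<le> real n ^ q * x ^ n" using assms by simp
    show "\<forall>\<^sub>F n in sequentially. real n ^ q * x ^ n \<le> real n ^ Suc q * x ^ n"
      using eventually_ge_at_top[of 1]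
    proof eventually_elim
      case (elim n)
      then have "real n ^ q * 1 \<le> real n ^ q * real n" by (intro mult_left_mono) auto
      then have "real n ^ q \<le> real n ^ Suc q" by (simp add: mult.commute)
      then show ?case using assms by (intro mult_right_mono) auto
    qed
  qed
qed

subsection \<open>The rotations of the generalised eigenspaces\<close>

lemma mat_vec_entry:
  assumes "M \<in> carrier_mat n d" "y \<in> carrier_vec d" "i < n"
  shows "(M *\<^sub>v y) $ i = (\<Sum>j<d. M $$ (i, j) * y $ j)"
  using assms by (simp add: scalar_prod_def lessThan_atLeast0)

lemma mat_unit_vec_entry:
  fixes M :: "'a::semiring_1 mat"
  shows "M \<in> carrier_mat n d \<Longrightarrow> i < n \<Longrightarrow> j < d \<Longrightarrow> (M *\<^sub>v unit_vec d j) $ i = M $$ (i, j)"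
  by simp

lemma char_matrix_mult_vec:
  assumes "M \<in> carrier_mat d d" "w \<in> carrier_vec d"
  shows "char_matrix M z *\<^sub>v w = M *\<^sub>v w - z \<cdot>\<^sub>v w"
proof (rule eq_vecI)
  fix i assume "i < dim_vec (M *\<^sub>v w - z \<cdot>\<^sub>v w)"
  then have i: "i < d" using assms by simp
  have "(char_matrix M z *\<^sub>v w) $ i = (\<Sum>j<d. M $$ (i, j) * w $ j - (if i = j then z * w $ j else 0))"
    unfolding mat_vec_entry[OF char_matrix_closed[OF assms(1)] assms(2) i]
    by (intro sum.cong refl) (use assms(1) i in \<open>auto simp: char_matrix_def algebra_simps\<close>)
  also have "\<dots> = (M *\<^sub>v w) $ i - z * w $ i"
    using i by (simp only: sum_subtractf mat_vec_entry[OF assms i]) simp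
  finally show "(char_matrix M z *\<^sub>v w) $ i = (M *\<^sub>v w - z \<cdot>\<^sub>v w) $ i"
    using assms i by simp
qed (use assms in \<open>auto simp: char_matrix_def\<close>)

lemma mult_zero_vec:
  fixes M :: "'a::semiring_1 mat"
  shows "M \<in> carrier_mat n d \<Longrightarrow> M *\<^sub>v 0\<^sub>v d = 0\<^sub>v n"
  by (intro eq_vecI) auto

lemma complexification_minus:
  assumes V: "vec_subspace d V" and x: "x \<in> complexification d V" and y: "y \<in> complexification d V"
  shows "x - y \<in> complexification d V"
proof -
  have c: "x \<in> carrier_vec d" "y \<in> carrier_vec d" using x y by (auto simp: complexification_def)
  have "map_vec Re (x - y) = map_vec Re x - map_vec Re y" "map_vec Im (x - y) = map_vec Im x - map_vec Im y"
    using c by (auto intro!: eq_vecI)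
  then show ?thesis
    using c x y vec_subspaceD(5)[OF V] by (simp add: complexification_def)
qed

lemma complexification_smult:
  assumes V: "vec_subspace d V" and x: "x \<in> complexification d V"
  shows "c \<cdot>\<^sub>v x \<in> complexification d V"
proof -
  have xc: "x \<in> carrier_vec d" using x by (auto simp: complexification_def)
  have "map_vec Re (c \<cdot>\<^sub>v x) = Re c \<cdot>\<^sub>v map_vec Re x - Im c \<cdot>\<^sub>v map_vec Im x"
    "map_vec Im (c \<cdot>\<^sub>v x) = Re c \<cdot>\<^sub>v map_vec Im x + Im c \<cdot>\<^sub>v map_vec Re x"
    using xc by (auto intro!: eq_vecI)
  then show ?thesis
    using xc x vec_subspaceD(3,4,5)[OF V] by (simp add: complexification_def)
qed

locale phase_rep = lin_rep +
  fixes g :: "nat \<Rightarrow> complex"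
  assumes phase: "phase_tuple k d u A g"
    and nondeg: "nondegenerate_representation k d u A v g"
begin

abbreviation "\<rho> \<equiv> rho k d u A"
abbreviation "E \<equiv> peripheral k d u A"
abbreviation "r \<equiv> max_block k d u A"
abbreviation "c n \<equiv> c_coeff k d u A n"

lemma rho_pos: "\<rho> > 0"
  using nondeg by (simp add: nondegenerate_representation_def)

text \<open>In dimension 0 the scalar product in the nondegeneracy condition is an empty sum and
  cannot be positive. A positive dimension is what makes the spectral radius an attained
  maximum.\<close>

lemma d_pos: "d > 0"
proof (rule ccontr)
  assume "\<not> d > 0"
  then have "d = 0" by simp
  then have "A 0 \<in> carrier_mat 0 0" using A[of 0] k by simp
  have "(\<lambda>m. g m ^ 0) \<in> phase_group g"
    unfolding phase_group_def by (rule subsetD[OF closure_subset]) blast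
  with nondeg show False
    using \<open>A 0 \<in> carrier_mat 0 0\<close>
    unfolding nondegenerate_representation_def Let_def
    by (auto simp: scalar_prod_def)
qed

lemma eigenvalue_norm_le: "eigenvalue N z \<Longrightarrow> cmod z \<le> \<rho>"
  using spectral_radius_mem_max(2)[OF N d_pos, of "cmod z"] by (simp add: rho_def spectrum_def)

lemma eigenvalue_norm_less: "eigenvalue N z \<Longrightarrow> z \<notin> E \<Longrightarrow> cmod z < \<rho>"
  using eigenvalue_norm_le[of z] by (auto simp: peripheral_def)

lemma zero_not_peripheral: "0 \<notin> E"
  using rho_pos by (simp add: peripheral_def)

lemma g_bij: "bij_betw (\<lambda>m. g m * complex_of_real \<rho>) {..<card E} E"
  using phase by (simp add: phase_tuple_def)

lemma cmod_g: "cmod (g m) = 1"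
proof (cases "m < card E")
  case True
  then have "g m * complex_of_real \<rho> \<in> E" using g_bij by (auto simp: bij_betw_def)
  then have "cmod (g m) * \<rho> = \<rho>" using rho_pos by (simp add: peripheral_def norm_mult)
  then show ?thesis using rho_pos by simp
qed (use phase in \<open>simp add: phase_tuple_def\<close>)

text \<open>Tuples are indexed by the chosen enumeration of peripheral eigenvalues, Jordan blocks by
  the eigenvalue itself. This translates between them: \<open>\<chi> h z\<close> is the scalar by
  which R_h acts on the generalised eigenspace for \<open>z\<close>.\<close>

definition \<chi> :: "(nat \<Rightarrow> complex) \<Rightarrow> complex \<Rightarrow> complex" where
  "\<chi> h z = (if z \<in> E then h (the_inv_into {..<card E} (\<lambda>m. g m * complex_of_real \<rho>) z) else 1)"

lemma chi_peripheral:
  assumes "m < card E"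
  shows "\<chi> h (g m * complex_of_real \<rho>) = h m"
proof -
  have "g m * complex_of_real \<rho> \<in> E" using g_bij assms by (auto simp: bij_betw_def)
  moreover have "the_inv_into {..<card E} (\<lambda>m. g m * complex_of_real \<rho>) (g m * complex_of_real \<rho>) = m"
    using g_bij assms by (intro the_inv_into_f_f) (auto simp: bij_betw_def)
  ultimately show ?thesis by (simp add: \<chi>_def)
qed

lemma chi_not_peripheral: "z \<notin> E \<Longrightarrow> \<chi> h z = 1"
  by (simp add: \<chi>_def)

lemma peripheralE:
  assumes "z \<in> E"
  obtains m where "m < card E" "z = g m * complex_of_real \<rho>"
  using assms g_bij by (auto simp: bij_betw_def)

lemma chi_power: "\<chi> (\<lambda>m. h m ^ n) z = \<chi> h z ^ n"
  by (simp add: \<chi>_def)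

lemma chi_inverse: "\<chi> (\<lambda>m. inverse (h m)) z = inverse (\<chi> h z)"
  by (simp add: \<chi>_def)

lemma cmod_chi_g: "cmod (\<chi> g z) = 1"
  by (simp add: \<chi>_def cmod_g)

lemma continuous_on_chi: "continuous_on UNIV (\<lambda>h. \<chi> h z)"
  by (cases "z \<in> E") (simp_all add: \<chi>_def continuous_on_product_coordinates)

text \<open>For nonzero \<open>z\<close> a vector can be recovered from its images: \<open>w\<close>
  is \<open>1 / z\<close> times \<open>N w - (N - z) w\<close>. The first term lies in the range of
  \<open>N\<close>, hence in V, and the second by induction.\<close>

lemma generalised_eigenvector_in_V:
  assumes z: "z \<noteq> 0" and w: "w \<in> carrier_vec d" "char_matrix N z ^\<^sub>m m *\<^sub>v w = 0\<^sub>v d"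
  shows "w \<in> complexification d V"
  using w
proof (induction m arbitrary: w)
  case 0
  then have "w = 0\<^sub>v d"
    using carrier_matD(1)[OF char_matrix_closed[OF N, of z]] by simp
  then show ?case using N_range[of "0\<^sub>v d"] by (simp add: mult_zero_vec[OF N])
next
  case (Suc m)
  let ?w' = "char_matrix N z *\<^sub>v w"
  have C: "char_matrix N z \<in> carrier_mat d d" using char_matrix_closed[OF N] .
  have "char_matrix N z ^\<^sub>m m *\<^sub>v ?w' = 0\<^sub>v d"
    using Suc.prems assoc_mult_mat_vec[OF pow_carrier_mat[OF C, of m] C Suc.prems(1)] by simp
  then have w': "?w' \<in> complexification d V"
    using Suc.prems(1) C by (intro Suc.IH) auto
  have "w = (1 / z) \<cdot>\<^sub>v (N *\<^sub>v w - ?w')"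
    unfolding char_matrix_mult_vec[OF N Suc.prems(1)]
    using Suc.prems(1) N z by (intro eq_vecI) auto
  then show ?case
    using complexification_smult[OF subspace_V complexification_minus[OF subspace_V N_range[OF Suc.prems(1)] w']]
    by metis
qed

end

text \<open>The columns of \<open>T\<close> are a Jordan basis of the whole complex space, not of V
  alone. It is an auxiliary choice, and the results finally drawn from this locale do not mention
  it.\<close>

locale jordan_rep = phase_rep +
  fixes bs :: "(nat \<times> complex) list" and T Q :: "complex mat"
  assumes nf: "jordan_nf N bs" and wit: "similar_mat_wit N (jordan_matrix bs) T Q"
begin

abbreviation "J \<equiv> jordan_matrix bs"
abbreviation "eig i \<equiv> J $$ (i, i)"

lemma T: "T \<in> carrier_mat d d" and Q: "Q \<in> carrier_mat d d" and J: "J \<in> carrier_mat d d"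
  and TQ: "T * Q = 1\<^sub>m d" and QT: "Q * T = 1\<^sub>m d"
  by (rule similar_mat_witD[OF carrier_matD(1)[OF N, symmetric] wit])+

lemma dim_bs: "sum_list (map fst bs) = d"
  using carrier_matD(1)[OF J] by simp

lemma QT_vec: "y \<in> carrier_vec d \<Longrightarrow> Q *\<^sub>v (T *\<^sub>v y) = y"
  using assoc_mult_mat_vec[OF Q T, of y] by (simp add: QT)

lemma TQ_vec: "y \<in> carrier_vec d \<Longrightarrow> T *\<^sub>v (Q *\<^sub>v y) = y"
  using assoc_mult_mat_vec[OF T Q, of y] by (simp add: TQ)

lemma conj_vec:
  assumes "M \<in> carrier_mat d d" "y \<in> carrier_vec d"
  shows "(T * M * Q) *\<^sub>v y = T *\<^sub>v (M *\<^sub>v (Q *\<^sub>v y))"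
  using assoc_mult_mat_vec[OF mult_carrier_mat[OF T assms(1)] Q assms(2)]
    assoc_mult_mat_vec[OF T assms(1) mult_mat_vec_carrier[OF Q assms(2)]]
  by (simp only:)

lemma shift_pow: "char_matrix N z ^\<^sub>m m = T * char_matrix J z ^\<^sub>m m * Q"
  by (rule similar_mat_wit_pow_id[OF similar_mat_wit_char_matrix[OF wit]])

lemma J_carrier: "char_matrix J z ^\<^sub>m m \<in> carrier_mat d d"
  by (intro pow_carrier_mat char_matrix_closed J)

lemma J_entry:
  assumes "i < d" "j < d"
  shows "(\<forall>z m. (char_matrix J z ^\<^sub>m m) $$ (i, j) = 0) \<or>
    (i \<le> j \<and> eig j = eig i \<and> (\<exists>b. (b, eig i) \<in> set bs \<and> j - i < b) \<and>
     (\<forall>z m. (char_matrix J z ^\<^sub>m m) $$ (i, j) = of_nat (m choose (j - i)) * (eig i - z) ^ (m + i - j)))"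
  using jordan_matrix_shift_pow_entry[of i bs j] assms by (simp only: dim_bs)

lemma J_diag:
  assumes i: "i < d"
  shows "(char_matrix J z ^\<^sub>m m) $$ (i, i) = (eig i - z) ^ m" and "\<exists>b. (b, eig i) \<in> set bs \<and> b > 0"
proof -
  \<comment> \<open>The power 0 has diagonal entry 1, which rules out the first alternative of
    \<open>J_entry\<close> on the diagonal.\<close>
  have "(char_matrix J z ^\<^sub>m 0) $$ (i, i) = 1"
    using i carrier_matD(1)[OF char_matrix_closed[OF J, of z]] by (simp only: pow_mat.simps(1) index_one_mat) simp
  then have *: "(\<exists>b. (b, eig i) \<in> set bs \<and> i - i < b) \<and>
     (\<forall>z m. (char_matrix J z ^\<^sub>m m) $$ (i, i) = of_nat (m choose (i - i)) * (eig i - z) ^ (m + i - i))"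
    using J_entry[OF i i] by (metis zero_neq_one)
  then show "(char_matrix J z ^\<^sub>m m) $$ (i, i) = (eig i - z) ^ m" by simp
  from * show "\<exists>b. (b, eig i) \<in> set bs \<and> b > 0" by auto
qed

lemma eigenvalue_iff: "eigenvalue N z \<longleftrightarrow> (\<exists>b. (b, z) \<in> set bs)"
proof -
  have pos: "b > 0" if "(b, a) \<in> set bs" for a b
  proof (rule ccontr)
    assume "\<not> b > 0"
    then have "0 \<in> fst ` set bs" using that by (auto intro: rev_image_eqI)
    then show False using nf by (simp add: jordan_nf_def)
  qed
  have "eigenvalue N z \<longleftrightarrow> poly (char_poly N) z = 0"
    by (rule eigenvalue_root_char_poly[OF N])
  also have "\<dots> \<longleftrightarrow> (\<exists>p\<in>set bs. poly (case p of (n, a) \<Rightarrow> [:- a, 1:] ^ n) z = 0)"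
    unfolding jordan_nf_char_poly[OF nf] by (induction bs) auto
  also have "\<dots> \<longleftrightarrow> (\<exists>b. (b, z) \<in> set bs)"
  proof (intro iffI; elim bexE exE)
    fix p assume p: "p \<in> set bs" "poly (case p of (n, a) \<Rightarrow> [:- a, 1:] ^ n) z = 0"
    obtain n a where na: "p = (n, a)" by (cases p)
    then have "z = a" using p(2) pos[of n a] p(1) by (simp add: poly_power)
    then show "\<exists>b. (b, z) \<in> set bs" using p(1) na by blast
  next
    fix b assume b: "(b, z) \<in> set bs"
    then have "poly (case (b, z) of (n, a) \<Rightarrow> [:- a, 1:] ^ n) z = 0"
      using pos[OF b] by (simp add: poly_power)
    with b show "\<exists>p\<in>set bs. poly (case p of (n, a) \<Rightarrow> [:- a, 1:] ^ n) z = 0" by blast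
  qed
  finally show ?thesis .
qed

lemma eigenvalue_eig: "i < d \<Longrightarrow> eigenvalue N (eig i)"
  using J_diag(2) eigenvalue_iff by blast

definition diag_chi :: "(nat \<Rightarrow> complex) \<Rightarrow> complex mat" where
  "diag_chi h = mat d d (\<lambda>(i, j). if i = j then \<chi> h (eig i) else 0)"

text \<open>An explicit candidate for R_h in the Jordan basis, to be matched with the description of
  \<open>R_mat\<close> by \<open>THE\<close>.\<close>

definition R_chi :: "(nat \<Rightarrow> complex) \<Rightarrow> complex mat" where
  "R_chi h = T * diag_chi h * Q"

lemma diag_chi: "diag_chi h \<in> carrier_mat d d" by (simp add: diag_chi_def)

lemma R_chi: "R_chi h \<in> carrier_mat d d"
  unfolding R_chi_def using T Q diag_chi[of h] by simp

lemma diag_chi_vec: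
  assumes "y \<in> carrier_vec d" "i < d"
  shows "(diag_chi h *\<^sub>v y) $ i = \<chi> h (eig i) * y $ i"
proof -
  have "(diag_chi h *\<^sub>v y) $ i = (\<Sum>j<d. if i = j then \<chi> h (eig i) * y $ j else 0)"
    unfolding mat_vec_entry[OF diag_chi assms]
    by (intro sum.cong refl) (use assms(2) in \<open>auto simp: diag_chi_def\<close>)
  also have "\<dots> = \<chi> h (eig i) * y $ i" using assms(2) by simp
  finally show ?thesis .
qed

text \<open>In Jordan coordinates a vector killed by a power of \<open>J - z\<close> is supported
  where the diagonal of \<open>J\<close> equals \<open>z\<close>. Otherwise consider the last
  offending coordinate \<open>a\<close>: by triangularity only the diagonal term
  \<open>(eig a - z) ^ m\<close> acts there, and it does not vanish. On this support the diagonal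
  matrix is the scalar \<open>\<chi> h z\<close>.\<close>

lemma R_chi_generalised_eigenvector:
  assumes w: "w \<in> carrier_vec d" and 0: "char_matrix N z ^\<^sub>m m *\<^sub>v w = 0\<^sub>v d"
  shows "R_chi h *\<^sub>v w = \<chi> h z \<cdot>\<^sub>v w"
proof -
  let ?K = "char_matrix J z ^\<^sub>m m"
  define y where "y = Q *\<^sub>v w"
  have y: "y \<in> carrier_vec d" using Q w by (simp add: y_def)
  have Ky: "?K *\<^sub>v y = 0\<^sub>v d"
  proof -
    have "Q *\<^sub>v (T *\<^sub>v (?K *\<^sub>v y)) = Q *\<^sub>v (0\<^sub>v d)"
      using 0 unfolding shift_pow conj_vec[OF J_carrier w] y_def by (simp only:)
    then show ?thesis
      using QT_vec[OF mult_mat_vec_carrier[OF J_carrier y]] by (simp only: mult_zero_vec[OF Q])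
  qed
  have supp: "eig i = z" if "i < d" "y $ i \<noteq> 0" for i
  proof (rule ccontr)
    define B where "B = {i. i < d \<and> y $ i \<noteq> 0 \<and> eig i \<noteq> z}"
    assume "eig i \<noteq> z"
    then have B: "finite B" "B \<noteq> {}" using that by (auto simp: B_def)
    define a where "a = Max B"
    have a: "a < d" "y $ a \<noteq> 0" "eig a \<noteq> z" using Max_in[OF B] by (auto simp: a_def B_def)
    have above: "j \<notin> B" if "j > a" for j using Max_ge[OF B(1), of j] that by (auto simp: a_def)
    have "?K $$ (a, j) * y $ j = 0" if j: "j < d" "j \<noteq> a" for j
    proof (rule ccontr)
      assume "\<not> ?thesis"
      then have "?K $$ (a, j) \<noteq> 0" "y $ j \<noteq> 0" by auto
      then have "a \<le> j" "eig j = eig a" using J_entry[OF a(1) j(1)] by blast+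
      then have "j \<in> B" "j > a" using j a \<open>y $ j \<noteq> 0\<close> by (auto simp: B_def)
      then show False using above by blast
    qed
    then have "(\<Sum>j<d. ?K $$ (a, j) * y $ j) = (\<Sum>j<d. if j = a then ?K $$ (a, a) * y $ a else 0)"
      by (intro sum.cong refl) auto
    also have "\<dots> = ?K $$ (a, a) * y $ a" using a(1) by simp
    finally have "?K $$ (a, a) * y $ a = (?K *\<^sub>v y) $ a"
      by (simp only: mat_vec_entry[OF J_carrier y a(1)])
    then show False using a unfolding J_diag(1)[OF a(1)] Ky by simp
  qed
  have "diag_chi h *\<^sub>v y = \<chi> h z \<cdot>\<^sub>v y"
  proof (rule eq_vecI)
    fix i assume "i < dim_vec (\<chi> h z \<cdot>\<^sub>v y)"
    then have i: "i < d" using y by simp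
    show "(diag_chi h *\<^sub>v y) $ i = (\<chi> h z \<cdot>\<^sub>v y) $ i"
      unfolding diag_chi_vec[OF y i] using supp[OF i] y i by (cases "y $ i = 0") auto
  qed (use y diag_chi[of h] in auto)
  then have "R_chi h *\<^sub>v w = T *\<^sub>v (\<chi> h z \<cdot>\<^sub>v y)"
    unfolding R_chi_def conj_vec[OF diag_chi w] y_def by (simp only:)
  also have "\<dots> = \<chi> h z \<cdot>\<^sub>v (T *\<^sub>v y)" by (rule mult_mat_vec[OF T y])
  finally show ?thesis by (simp only: y_def TQ_vec[OF w])
qed

lemma col_T: "i < d \<Longrightarrow> col T i \<in> carrier_vec d"
  using T by auto

text \<open>The exponent \<open>d\<close> serves all blocks at once: a possibly nonzero entry
  carries the factor 0 to the power \<open>d + j - i\<close>, and this exponent is positive because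
  \<open>i < d\<close>.\<close>

lemma col_T_generalised_eigenvector:
  assumes i: "i < d"
  shows "char_matrix N (eig i) ^\<^sub>m d *\<^sub>v col T i = 0\<^sub>v d"
proof -
  let ?K = "char_matrix J (eig i) ^\<^sub>m d"
  have col: "col T i = T *\<^sub>v unit_vec d i"
    using T i by (intro eq_vecI) auto
  have "?K *\<^sub>v unit_vec d i = 0\<^sub>v d"
  proof (rule eq_vecI)
    fix j assume "j < dim_vec (0\<^sub>v d :: complex vec)"
    then have j: "j < d" by simp
    have "(?K *\<^sub>v unit_vec d i) $ j = ?K $$ (j, i)"
      by (rule mat_unit_vec_entry[OF J_carrier j i])
    also have "\<dots> = 0"
      using J_entry[OF j i]
    proof (elim disjE conjE)
      assume "j \<le> i" and ij: "eig i = eig j" and e: "\<forall>z m. (char_matrix J z ^\<^sub>m m) $$ (j, i) =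
          of_nat (m choose (i - j)) * (eig j - z) ^ (m + j - i)"
      have "d + j - i > 0" using i by simp
      then have "(eig j - eig i) ^ (d + j - i) = 0"
        by (simp only: ij diff_self zero_power)
      then show ?thesis by (simp only: e[rule_format, of "eig i" d] mult_zero_right)
    qed blast
    finally show "(?K *\<^sub>v unit_vec d i) $ j = 0\<^sub>v d $ j" using j by simp
  qed (use carrier_matD(1)[OF J_carrier[of "eig i" d]] in \<open>simp only: dim_mult_mat_vec index_zero_vec(2)\<close>)
  moreover have "unit_vec d i = Q *\<^sub>v col T i" unfolding col by (simp add: QT_vec)
  ultimately show ?thesis
    unfolding shift_pow conj_vec[OF J_carrier col_T[OF i]] by (simp add: mult_zero_vec[OF T])
qed

lemma R_chi_unique:
  assumes M: "M \<in> carrier_mat d d"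
    and eq: "\<And>i. i < d \<Longrightarrow> M *\<^sub>v col T i = \<chi> h (eig i) \<cdot>\<^sub>v col T i"
  shows "M = R_chi h"
proof (rule mat_eqI_mult_vec[OF M R_chi])
  fix x :: "complex vec" assume x: "x \<in> carrier_vec d"
  have "M * T = R_chi h * T"
  proof (rule eq_matI)
    fix a i assume "a < dim_row (R_chi h * T)" "i < dim_col (R_chi h * T)"
    then have ai: "a < d" "i < d" using R_chi[of h] T by auto
    have "M *\<^sub>v col T i = R_chi h *\<^sub>v col T i"
      using eq[OF ai(2)] R_chi_generalised_eigenvector[OF col_T[OF ai(2)] col_T_generalised_eigenvector[OF ai(2)], of h]
      by simp
    moreover have "(X * T) $$ (a, i) = (X *\<^sub>v col T i) $ a" if "X \<in> carrier_mat d d" for X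
      using that ai T by simp
    ultimately show "(M * T) $$ (a, i) = (R_chi h * T) $$ (a, i)" using M R_chi[of h] by metis
  qed (use M R_chi[of h] T in auto)
  then have "(M * T) *\<^sub>v (Q *\<^sub>v x) = (R_chi h * T) *\<^sub>v (Q *\<^sub>v x)" by simp
  then show "M *\<^sub>v x = R_chi h *\<^sub>v x"
    using assoc_mult_mat_vec[OF M T mult_mat_vec_carrier[OF Q x]]
      assoc_mult_mat_vec[OF R_chi T mult_mat_vec_carrier[OF Q x], of h]
    by (simp only: TQ_vec[OF x])
qed

text \<open>The columns of \<open>T\<close> are generalised eigenvectors. Those for nonzero eigenvalues lie in the
  complexified \<open>V\<close> and are prescribed by the definition of \<open>R\<^sub>h\<close>; those for the eigenvalue \<open>0\<close> need not,
  but split into a generalised eigenvector inside \<open>V\<close> and a vector orthogonal to \<open>V\<close>.\<close>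

lemma R_mat_eq: "R_mat k d u A g h = R_chi h"
proof -
  let ?E = "gen_eigenspace_in (complexification d V) N"
  let ?C = "\<lambda>M. M \<in> carrier_mat d d \<and>
           (\<forall>m<card E. \<forall>w\<in>?E (g m * complex_of_real \<rho>). M *\<^sub>v w = h m \<cdot>\<^sub>v w) \<and>
           (\<forall>z. eigenvalue N z \<and> z \<notin> E \<longrightarrow> (\<forall>w\<in>?E z. M *\<^sub>v w = w)) \<and>
           (\<forall>w\<in>complexification d (orth_compl d V). M *\<^sub>v w = w)"
  have kernel: "w \<in> mat_kernel (char_matrix N z ^\<^sub>m n) \<longleftrightarrow>
      w \<in> carrier_vec d \<and> char_matrix N z ^\<^sub>m n *\<^sub>v w = 0\<^sub>v d" for w z n
    unfolding mat_kernel[OF pow_carrier_mat[OF char_matrix_closed[OF N], of z n]] by simp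
  have gen: "w \<in> carrier_vec d \<and> (\<exists>n. char_matrix N z ^\<^sub>m n *\<^sub>v w = 0\<^sub>v d)" if "w \<in> ?E z" for w z
    using that kernel unfolding gen_eigenspace_in_def by blast
  have char0: "char_matrix N 0 = N"
    using N by (intro eq_matI) (auto simp: char_matrix_def)
  have "?C (R_chi h)"
  proof (intro conjI allI impI ballI)
    show "R_chi h \<in> carrier_mat d d" by (rule R_chi)
    show "R_chi h *\<^sub>v w = h m \<cdot>\<^sub>v w" if "m < card E" "w \<in> ?E (g m * complex_of_real \<rho>)" for m w
      using gen[OF that(2)] R_chi_generalised_eigenvector[of w _ _ h] chi_peripheral[OF that(1)] by metis
    show "R_chi h *\<^sub>v w = w" if z: "eigenvalue N z \<and> z \<notin> E" and w: "w \<in> ?E z" for z w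
      using gen[OF w] R_chi_generalised_eigenvector[of w _ _ h] chi_not_peripheral[of z h] z
      by (metis one_smult_vec)
    show "R_chi h *\<^sub>v w = w" if w: "w \<in> complexification d (orth_compl d V)" for w
    proof -
      have wc: "w \<in> carrier_vec d" using w by (simp add: complexification_def)
      have "char_matrix N 0 ^\<^sub>m 1 *\<^sub>v w = 0\<^sub>v d"
        using N_kills_orth_compl[OF w] N by (simp add: char0)
      from R_chi_generalised_eigenvector[OF wc this, of h] show ?thesis
        by (simp add: chi_not_peripheral[OF zero_not_peripheral])
    qed
  qed
  moreover have "M = R_chi h" if M: "?C M" for M
  proof (rule R_chi_unique)
    show Mc: "M \<in> carrier_mat d d" using M by blast
    fix i assume i: "i < d"
    define w where "w = col T i"
    have w: "w \<in> carrier_vec d" unfolding w_def by (rule col_T[OF i])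
    have w0: "char_matrix N (eig i) ^\<^sub>m d *\<^sub>v w = 0\<^sub>v d" unfolding w_def by (rule col_T_generalised_eigenvector[OF i])
    have "M *\<^sub>v w = \<chi> h (eig i) \<cdot>\<^sub>v w"
    proof (cases "eig i = 0")
      case False
      have "w \<in> ?E (eig i)"
        unfolding gen_eigenspace_in_def
        using generalised_eigenvector_in_V[OF False w w0] kernel w w0 by blast
      show ?thesis
      proof (cases "eig i \<in> E")
        case True
        then obtain m where m: "m < card E" "eig i = g m * complex_of_real \<rho>" by (rule peripheralE)
        then show ?thesis using M \<open>w \<in> ?E (eig i)\<close> chi_peripheral[OF m(1)] by simp
      next
        case False
        then show ?thesis using M \<open>w \<in> ?E (eig i)\<close> eigenvalue_eig[OF i] chi_not_peripheral[OF False] by simp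
      qed
    next
      case True
      let ?P = "map_mat complex_of_real Pr"
      have P: "?P \<in> carrier_mat d d" using Pr by simp
      define x where "x = ?P *\<^sub>v w"
      have x: "x \<in> carrier_vec d" using P w by (simp add: x_def)
      have Re: "map_vec Re x = Pr *\<^sub>v map_vec Re w" and Im: "map_vec Im x = Pr *\<^sub>v map_vec Im w"
        unfolding x_def by (rule map_vec_Re_mult[OF Pr w])+
      have xV: "x \<in> complexification d V"
        unfolding complexification_def Re Im using x w by (simp add: Re Im orth_proj_in[OF subspace_V])
      have "map_vec Re (w - x) = map_vec Re w - Pr *\<^sub>v map_vec Re w"
        "map_vec Im (w - x) = map_vec Im w - Pr *\<^sub>v map_vec Im w"
        unfolding Re[symmetric] Im[symmetric] using w x by (auto intro!: eq_vecI)
      then have y: "w - x \<in> complexification d (orth_compl d V)"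
        unfolding complexification_def using w x orth_proj_diff[OF subspace_V] by simp
      \<comment> \<open>\<open>N\<close> kills the orthogonal part \<open>w - x\<close>, so a
        positive power of \<open>N\<close> takes the same value on \<open>x\<close> as on
        \<open>w\<close>, and \<open>x\<close> is a generalised eigenvector inside V.\<close>
      obtain d' where d': "d = Suc d'" using d_pos by (cases d) auto
      have Nd: "N ^\<^sub>m d \<in> carrier_mat d d" by (rule pow_carrier_mat[OF N])
      have "N ^\<^sub>m d *\<^sub>v (w - x) = N ^\<^sub>m d' *\<^sub>v (N *\<^sub>v (w - x))"
        using assoc_mult_mat_vec[OF pow_carrier_mat[OF N, of d'] N, of "w - x"] w x by (simp add: d')
      also have "\<dots> = 0\<^sub>v d"
        unfolding N_kills_orth_compl[OF y] by (rule mult_zero_vec[OF pow_carrier_mat[OF N]])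
      finally have "N ^\<^sub>m d *\<^sub>v w - N ^\<^sub>m d *\<^sub>v x = 0\<^sub>v d"
        using mult_minus_distrib_mat_vec[OF Nd w x] by simp
      then have "N ^\<^sub>m d *\<^sub>v x = 0\<^sub>v d"
        using w0 unfolding True char0
        using vec_eq_if_minus_eq_0[OF _ mult_mat_vec_carrier[OF Nd x], of "0\<^sub>v d"] by simp
      then have "x \<in> ?E 0"
        unfolding gen_eigenspace_in_def using xV x kernel[of x 0 d] unfolding char0 by blast
      then have Mx: "M *\<^sub>v x = x"
        using M eigenvalue_eig[OF i] zero_not_peripheral unfolding True by blast
      have My: "M *\<^sub>v (w - x) = w - x" using M y by blast
      have "M *\<^sub>v w - x = w - x" using mult_minus_distrib_mat_vec[OF Mc w x] Mx My by simp
      then have "(M *\<^sub>v w) $ j - x $ j = w $ j - x $ j" if "j < d" for j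
        using that x w Mc by (metis carrier_vecD index_minus_vec(1))
      then have "M *\<^sub>v w = w" using w Mc by (intro eq_vecI) auto
      then show ?thesis unfolding True chi_not_peripheral[OF zero_not_peripheral] by simp
    qed
    then show "M *\<^sub>v col T i = \<chi> h (eig i) \<cdot>\<^sub>v col T i" by (simp only: w_def)
  qed
  ultimately show ?thesis unfolding R_mat_def Let_def by (intro the_equality) blast+
qed

end

lemma (in phase_rep) jordan_rep_exists:
  obtains bs T Q where "jordan_rep k d u A v f g bs T Q"
proof -
  obtain bs where bs: "jordan_nf N bs" using complex_jordan_nf_exists[OF N] by blast
  then obtain T Q where "similar_mat_wit N (jordan_matrix bs) T Q"
    unfolding jordan_nf_def similar_mat_def by blast
  with bs have "jordan_rep k d u A v f g bs T Q" by unfold_locales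
  then show thesis by (rule that)
qed

subsection \<open>Asymptotics of the matrix powers\<close>

context jordan_rep
begin

lemma diag_chi_pow: "diag_chi h ^\<^sub>m n = diag_chi (\<lambda>m. h m ^ n)"
proof (induction n)
  case 0
  then show ?case by (intro eq_matI) (auto simp: diag_chi_def \<chi>_def)
next
  case (Suc n)
  have "diag_chi (\<lambda>m. h m ^ n) * diag_chi h = diag_chi (\<lambda>m. h m ^ Suc n)"
  proof (rule mat_eqI_mult_vec)
    show "diag_chi (\<lambda>m. h m ^ n) * diag_chi h \<in> carrier_mat d d"
      by (rule mult_carrier_mat[OF diag_chi diag_chi])
    show "diag_chi (\<lambda>m. h m ^ Suc n) \<in> carrier_mat d d" by (rule diag_chi)
    fix y :: "complex vec" assume y: "y \<in> carrier_vec d"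
    have hy: "diag_chi h *\<^sub>v y \<in> carrier_vec d" for h by (rule mult_mat_vec_carrier[OF diag_chi y])
    show "(diag_chi (\<lambda>m. h m ^ n) * diag_chi h) *\<^sub>v y = diag_chi (\<lambda>m. h m ^ Suc n) *\<^sub>v y"
      unfolding assoc_mult_mat_vec[OF diag_chi diag_chi y]
    proof (rule eq_vecI)
      fix i assume "i < dim_vec (diag_chi (\<lambda>m. h m ^ Suc n) *\<^sub>v y)"
      then have i: "i < d" by (simp only: carrier_vecD[OF hy])
      show "(diag_chi (\<lambda>m. h m ^ n) *\<^sub>v (diag_chi h *\<^sub>v y)) $ i = (diag_chi (\<lambda>m. h m ^ Suc n) *\<^sub>v y) $ i"
        unfolding diag_chi_vec[OF hy i] diag_chi_vec[OF y i] chi_power by simp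
    qed (simp only: carrier_vecD[OF mult_mat_vec_carrier[OF diag_chi hy]] carrier_vecD[OF hy])
  qed
  then show ?case by (simp only: pow_mat.simps(2) Suc.IH)
qed

lemma R_chi_pow: "R_chi h ^\<^sub>m n = R_chi (\<lambda>m. h m ^ n)"
proof -
  have "similar_mat_wit (R_chi h) (diag_chi h) T Q"
    unfolding R_chi_def
    by (rule similar_mat_witI[OF TQ QT refl _ diag_chi T Q]) (fact R_chi[unfolded R_chi_def])
  from similar_mat_wit_pow_id[OF this] show ?thesis
    unfolding R_chi_def diag_chi_pow .
qed

lemma R_chi_inverse:
  assumes y: "y \<in> carrier_vec d" and h: "\<And>m. h m \<noteq> 0"
  shows "R_chi h *\<^sub>v (R_chi (\<lambda>m. inverse (h m)) *\<^sub>v y) = y"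
proof -
  have Qy: "Q *\<^sub>v y \<in> carrier_vec d" by (rule mult_mat_vec_carrier[OF Q y])
  have Dy: "diag_chi h *\<^sub>v (Q *\<^sub>v y) \<in> carrier_vec d" for h
    by (rule mult_mat_vec_carrier[OF diag_chi Qy])
  have "diag_chi h *\<^sub>v (diag_chi (\<lambda>m. inverse (h m)) *\<^sub>v (Q *\<^sub>v y)) = Q *\<^sub>v y"
  proof (rule eq_vecI)
    fix i assume "i < dim_vec (Q *\<^sub>v y)"
    then have i: "i < d" using Qy by (simp only: carrier_vecD)
    have "\<chi> h (eig i) \<noteq> 0" using h by (simp add: \<chi>_def)
    then show "(diag_chi h *\<^sub>v (diag_chi (\<lambda>m. inverse (h m)) *\<^sub>v (Q *\<^sub>v y))) $ i = (Q *\<^sub>v y) $ i"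
      unfolding diag_chi_vec[OF Dy i] diag_chi_vec[OF Qy i] chi_inverse by simp
  next
    show "dim_vec (diag_chi h *\<^sub>v (diag_chi (\<lambda>m. inverse (h m)) *\<^sub>v (Q *\<^sub>v y))) = dim_vec (Q *\<^sub>v y)"
      unfolding carrier_vecD[OF mult_mat_vec_carrier[OF diag_chi Dy]] carrier_vecD[OF Qy] ..
  qed
  moreover have "R_chi (\<lambda>m. inverse (h m)) *\<^sub>v y = T *\<^sub>v (diag_chi (\<lambda>m. inverse (h m)) *\<^sub>v (Q *\<^sub>v y))"
    unfolding R_chi_def by (rule conj_vec[OF diag_chi y])
  ultimately show ?thesis
    unfolding R_chi_def[of h]
      conj_vec[OF diag_chi mult_mat_vec_carrier[OF R_chi[of "\<lambda>m. inverse (h m)"] y]]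
    by (simp only: QT_vec[OF Dy] TQ_vec[OF y])
qed

text \<open>In these coordinates \<open>h\<close> enters only through the scalars
  \<open>\<chi> h (eig i)\<close>. Continuity in \<open>h\<close> and the harmlessness of unit
  factors can be read off term by term.\<close>

lemma scalar_prod_R_chi:
  assumes x: "x \<in> carrier_vec d" and y: "y \<in> carrier_vec d"
  shows "x \<bullet> (R_chi h *\<^sub>v y) = (\<Sum>i<d. \<chi> h (eig i) * ((transpose_mat T *\<^sub>v x) $ i * (Q *\<^sub>v y) $ i))"
proof -
  have Qy: "Q *\<^sub>v y \<in> carrier_vec d" by (rule mult_mat_vec_carrier[OF Q y])
  have Dy: "diag_chi h *\<^sub>v (Q *\<^sub>v y) \<in> carrier_vec d" by (rule mult_mat_vec_carrier[OF diag_chi Qy])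
  have "x \<bullet> (R_chi h *\<^sub>v y) = x \<bullet> (T *\<^sub>v (diag_chi h *\<^sub>v (Q *\<^sub>v y)))"
    unfolding R_chi_def conj_vec[OF diag_chi y] ..
  also have "\<dots> = (transpose_mat T *\<^sub>v x) \<bullet> (diag_chi h *\<^sub>v (Q *\<^sub>v y))"
    by (rule transpose_vec_mult_scalar[OF T Dy x, symmetric])
  also have "\<dots> = (\<Sum>i<d. (transpose_mat T *\<^sub>v x) $ i * (diag_chi h *\<^sub>v (Q *\<^sub>v y)) $ i)"
    unfolding scalar_prod_def carrier_vecD[OF Dy] lessThan_atLeast0 ..
  also have "\<dots> = (\<Sum>i<d. \<chi> h (eig i) * ((transpose_mat T *\<^sub>v x) $ i * (Q *\<^sub>v y) $ i))"
    by (intro sum.cong refl) (simp add: diag_chi_vec[OF Qy] del: index_mult_mat_vec)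
  finally show ?thesis .
qed

text \<open>\<open>Max\<close> is informative only on a finite set: block sizes are bounded by the
  algebraic multiplicity and so by \<open>d\<close>.\<close>

lemma max_block_ge:
  assumes "(b, z) \<in> set bs" "z \<in> E"
  shows "b \<le> r"
proof -
  let ?S = "{b. \<exists>z\<in>E. \<exists>bs. jordan_nf N bs \<and> (b, z) \<in> set bs}"
  have "?S \<subseteq> {..d}"
  proof
    fix b assume "b \<in> ?S"
    then obtain z bs where "jordan_nf N bs" "(b, z) \<in> set bs" by blast
    then have "b \<le> Polynomial.order z (char_poly N)" by (rule jordan_nf_block_size_order_bound)
    also have "\<dots> \<le> degree (char_poly N)"
      using degree_monic_char_poly[OF N] d_pos by (intro order_degree) auto
    also have "\<dots> = d" using degree_monic_char_poly[OF N] by simp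
    finally show "b \<in> {..d}" by simp
  qed
  then have "finite ?S" by (rule finite_subset) simp
  then show ?thesis unfolding max_block_def by (rule Max_ge) (use assms nf in blast)
qed

end

context phase_rep
begin

text \<open>The spectral radius is attained, and the eigenvalue attaining it owns a nonempty block.
  Thus \<open>r - 1\<close> is never truncated and agrees with the integer exponents in
  \<open>c_coeff\<close>.\<close>

lemma max_block_pos: "r \<ge> 1"
proof -
  obtain bs T Q where "jordan_rep k d u A v f g bs T Q" by (rule jordan_rep_exists)
  then interpret jordan_rep k d u A v f g bs T Q .
  obtain z where z: "eigenvalue N z" "cmod z = \<rho>"
    using spectral_radius_mem_max(1)[OF N d_pos] unfolding rho_def spectrum_def by auto
  then obtain b where b: "(b, z) \<in> set bs" using eigenvalue_iff by blast
  have "b \<noteq> 0"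
  proof
    assume "b = 0"
    then have "0 \<in> fst ` set bs" using b by (auto intro: rev_image_eqI)
    then show False using nf by (simp add: jordan_nf_def)
  qed
  moreover have "b \<le> r" using z by (intro max_block_ge[OF b]) (simp add: peripheral_def)
  ultimately show ?thesis by linarith
qed

lemma c_eq: "c n = fact (r - 1) * \<rho> ^ (r - 1) / (real n ^ (r - 1) * \<rho> ^ n)"
proof -
  have "int n - int r + 1 = int n - int (r - 1)" using max_block_pos by simp
  then have "\<rho> powi (int n - int r + 1) = \<rho> powi (int n - int (r - 1))" by (simp only:)
  also have "\<dots> = \<rho> powi int n / \<rho> powi int (r - 1)"
    by (rule power_int_diff) (use rho_pos in simp)
  finally have "\<rho> powi (int n - int r + 1) = \<rho> ^ n / \<rho> ^ (r - 1)"
    by (simp only: power_int_of_nat)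
  then show ?thesis unfolding c_coeff_def Let_def using rho_pos by simp
qed

lemma c_pos: "n \<ge> 1 \<Longrightarrow> c n > 0"
  unfolding c_eq using rho_pos by simp

end

context jordan_rep
begin

abbreviation "g_inv \<equiv> \<lambda>m. inverse (g m)"

text \<open>The inverse phase turns \<open>z ^ n\<close> into \<open>\<rho> ^ n\<close>, which
  \<open>c n\<close> cancels. What remains is a constant times a binomial coefficient of degree
  \<open>q\<close> in \<open>n\<close> over \<open>real n ^ (r - 1)\<close>, with \<open>q\<close>
  at most \<open>r - 1\<close>.\<close>

lemma peripheral_coefficient_converges:
  assumes z: "z \<in> E" and q: "q < r"
  shows "convergent (\<lambda>n. of_real (c n) * (\<chi> g_inv z ^ n * (of_nat (n choose q) * z ^ (n - q))))"
proof -
  obtain m where m: "m < card E" "z = g m * complex_of_real \<rho>" using peripheralE[OF z] .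
  have z0: "z \<noteq> 0" using z zero_not_peripheral by blast
  have gm: "g m \<noteq> 0" using cmod_g[of m] by auto
  have chi: "\<chi> g_inv z = inverse (g m)" unfolding m(2) by (rule chi_peripheral[OF m(1)])
  \<comment> \<open>It gathers the constant numerator of \<open>c n\<close> and the factor
    \<open>z ^ q\<close> lost in the exponent \<open>n - q\<close>.\<close>
  define K where "K = complex_of_real (fact (r - 1) * \<rho> ^ (r - 1)) / z ^ q"
  have "convergent (\<lambda>n. real (n choose q) / real n ^ (r - 1))"
    by (rule LIMSEQ_choose_over_power) (use q in simp)
  then obtain L where L: "(\<lambda>n. real (n choose q) / real n ^ (r - 1)) \<longlonglongrightarrow> L"
    by (auto simp: convergent_def)
  have "(\<lambda>n. K * complex_of_real (real (n choose q) / real n ^ (r - 1))) \<longlonglongrightarrow> K * complex_of_real L"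
    by (intro tendsto_intros L)
  moreover have "\<forall>\<^sub>F n in sequentially. K * complex_of_real (real (n choose q) / real n ^ (r - 1)) =
      of_real (c n) * (\<chi> g_inv z ^ n * (of_nat (n choose q) * z ^ (n - q)))"
    using eventually_ge_at_top[of q]
  proof eventually_elim
    case (elim n)
    have "z ^ (n - q) = z ^ n / z ^ q" using z0 elim by (simp add: power_diff)
    moreover have "\<chi> g_inv z ^ n * z ^ n = complex_of_real (\<rho> ^ n)"
    proof -
      have "inverse (g m) * z = complex_of_real \<rho>" using gm by (simp add: m(2))
      then show ?thesis by (simp only: power_mult_distrib[symmetric] chi of_real_power)
    qed
    ultimately have e: "\<chi> g_inv z ^ n * (of_nat (n choose q) * z ^ (n - q)) =
        of_nat (n choose q) * complex_of_real (\<rho> ^ n) / z ^ q" by (simp add: mult_ac)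
    show ?case unfolding e c_eq K_def using rho_pos z0 by (simp add: field_simps)
  qed
  ultimately show ?thesis by (auto simp: convergent_def dest: Lim_transform_eventually)
qed

text \<open>There is no rotation here, and the decay of \<open>(cmod z / \<rho>) ^ n\<close> beats
  the polynomial growth of the binomial coefficient, so the limit is 0.\<close>

lemma nonperipheral_coefficient_converges:
  assumes z: "cmod z < \<rho>" "z \<notin> E"
  shows "convergent (\<lambda>n. of_real (c n) * (\<chi> g_inv z ^ n * (of_nat (n choose q) * z ^ (n - q))))"
proof -
  have chi: "\<chi> g_inv z = 1" by (rule chi_not_peripheral[OF z(2)])
  let ?F = "\<lambda>n. of_real (c n) * (\<chi> g_inv z ^ n * (of_nat (n choose q) * z ^ (n - q)))"
  define K where "K = fact (r - 1) * \<rho> ^ (r - 1)"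
  have K: "K \<ge> 0" using rho_pos by (simp add: K_def)
  define x where "x = cmod z / \<rho>"
  have x: "0 \<le> x" "x < 1" using z rho_pos by (auto simp: x_def)
  have "?F \<longlonglongrightarrow> 0"
  proof (cases "z = 0")
    \<comment> \<open>Treated apart because the bound below divides by a power of
      \<open>cmod z\<close>; here the terms vanish as soon as \<open>n\<close> exceeds
      \<open>q\<close>.\<close>
    case True
    have "\<forall>\<^sub>F n in sequentially. ?F n = 0"
      using eventually_gt_at_top[of q] by eventually_elim (simp add: True)
    then show ?thesis by (rule tendsto_eventually)
  next
    case False
    have "(\<lambda>n. K / cmod z ^ q * (real n ^ q * x ^ n)) \<longlonglongrightarrow> K / cmod z ^ q * 0"
      by (intro tendsto_intros LIMSEQ_power_times_geometric x)
    then have "(\<lambda>n. K / cmod z ^ q * (real n ^ q * x ^ n)) \<longlonglongrightarrow> 0" by simp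
    then show ?thesis
    proof (rule Lim_null_comparison[rotated])
      show "\<forall>\<^sub>F n in sequentially. norm (?F n) \<le> K / cmod z ^ q * (real n ^ q * x ^ n)"
        using eventually_ge_at_top[of "Suc q"]
      proof eventually_elim
        case (elim n)
        have n: "real n ^ (r - 1) \<ge> 1" using elim by (intro one_le_power) auto
        have "c n = K / (real n ^ (r - 1) * \<rho> ^ n)" by (simp add: c_eq K_def)
        also have "\<dots> = K / \<rho> ^ n / real n ^ (r - 1)" by simp
        also have "\<dots> \<le> K / \<rho> ^ n / 1"
          using K n rho_pos elim by (intro divide_left_mono) auto
        finally have cn: "c n \<le> K / \<rho> ^ n" by simp
        have "real (n choose q) \<le> real (n ^ q)"
          using elim by (intro of_nat_mono binomial_le_pow) auto
        then have b: "real (n choose q) \<le> real n ^ q" by simp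
        have zq: "cmod z ^ (n - q) = cmod z ^ n / cmod z ^ q"
          using False elim by (simp add: power_diff)
        have "norm (?F n) = c n * (real (n choose q) * cmod z ^ (n - q))"
          using c_pos[of n] elim by (simp add: chi norm_mult norm_power)
        also have "\<dots> \<le> K / \<rho> ^ n * (real n ^ q * cmod z ^ (n - q))"
          using cn b c_pos[of n] elim K rho_pos by (intro mult_mono) auto
        also have "\<dots> = K / cmod z ^ q * (real n ^ q * x ^ n)"
          unfolding zq x_def by (simp add: power_divide)
        finally show ?case .
      qed
    qed
  qed
  then show ?thesis by (rule convergentI)
qed

lemma coefficient_converges:
  assumes "i < d" "j < d"
  shows "convergent (\<lambda>n. of_real (c n) * (\<chi> g_inv (eig i) ^ n * (J ^\<^sub>m n) $$ (i, j)))"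
proof -
  have J0: "char_matrix J 0 = J"
    using J by (intro eq_matI) (auto simp: char_matrix_def)
  from J_entry[OF assms] show ?thesis
  proof (elim disjE conjE exE)
    assume "\<forall>z m. (char_matrix J z ^\<^sub>m m) $$ (i, j) = 0"
    then have "(J ^\<^sub>m n) $$ (i, j) = 0" for n using J0 by metis
    then show ?thesis by (simp add: convergent_const)
  next
    fix b
    assume ij: "i \<le> j" and b: "(b, eig i) \<in> set bs" "j - i < b"
      and e: "\<forall>z m. (char_matrix J z ^\<^sub>m m) $$ (i, j) = of_nat (m choose (j - i)) * (eig i - z) ^ (m + i - j)"
    have "(J ^\<^sub>m n) $$ (i, j) = of_nat (n choose (j - i)) * eig i ^ (n - (j - i))" for n
      using e[rule_format, of 0 n] ij unfolding J0 by simp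
    then show ?thesis
      using peripheral_coefficient_converges[of "eig i" "j - i"] max_block_ge[OF b(1)] b(2)
        nonperipheral_coefficient_converges[OF eigenvalue_norm_less[OF eigenvalue_eig[OF assms(1)]], of "j - i"]
      by (cases "eig i \<in> E") simp_all
  qed
qed

definition approx_mat :: "nat \<Rightarrow> complex mat" where
  "approx_mat n = of_real (c n) \<cdot>\<^sub>m (R_chi g_inv ^\<^sub>m n * N ^\<^sub>m n)"

lemma approx_mat: "approx_mat n \<in> carrier_mat d d"
  unfolding approx_mat_def
  by (intro smult_carrier_mat mult_carrier_mat[of _ d d] pow_carrier_mat R_chi N)

lemma approx_mat_vec:
  assumes y: "y \<in> carrier_vec d"
  shows "approx_mat n *\<^sub>v y = of_real (c n) \<cdot>\<^sub>v (R_chi g_inv ^\<^sub>m n *\<^sub>v (N ^\<^sub>m n *\<^sub>v y))"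
proof -
  have RN: "R_chi g_inv ^\<^sub>m n * N ^\<^sub>m n \<in> carrier_mat d d"
    by (intro mult_carrier_mat[of _ d d] pow_carrier_mat R_chi N)
  have "(a \<cdot>\<^sub>m M) *\<^sub>v y = a \<cdot>\<^sub>v (M *\<^sub>v y)" if "M \<in> carrier_mat d d" for a and M :: "complex mat"
    using that y by (intro eq_vecI) auto
  from this[OF RN] show ?thesis
    unfolding approx_mat_def
    using assoc_mult_mat_vec[OF pow_carrier_mat[OF R_chi] pow_carrier_mat[OF N] y, of g_inv n n]
    by (simp only:)
qed

lemma approx_mat_entry:
  assumes a: "a < d" and b: "b < d"
  shows "approx_mat n $$ (a, b) =
    (\<Sum>i<d. \<Sum>j<d. T $$ (a, i) * (of_real (c n) * (\<chi> g_inv (eig i) ^ n * (J ^\<^sub>m n) $$ (i, j))) * Q $$ (j, b))"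
proof -
  have Jn: "J ^\<^sub>m n \<in> carrier_mat d d" by (rule pow_carrier_mat[OF J])
  define e where "e = (unit_vec d b :: complex vec)"
  have e: "e \<in> carrier_vec d" by (simp add: e_def)
  have Qe: "Q *\<^sub>v e \<in> carrier_vec d" by (rule mult_mat_vec_carrier[OF Q e])
  define y where "y = J ^\<^sub>m n *\<^sub>v (Q *\<^sub>v e)"
  have y: "y \<in> carrier_vec d" unfolding y_def by (rule mult_mat_vec_carrier[OF Jn Qe])
  have Ty: "T *\<^sub>v y \<in> carrier_vec d" by (rule mult_mat_vec_carrier[OF T y])
  have Dy: "diag_chi (\<lambda>m. g_inv m ^ n) *\<^sub>v y \<in> carrier_vec d" by (rule mult_mat_vec_carrier[OF diag_chi y])
  have "N ^\<^sub>m n *\<^sub>v e = T *\<^sub>v y"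
    unfolding similar_mat_wit_pow_id[OF wit, of n] y_def by (rule conj_vec[OF Jn e])
  moreover have "R_chi g_inv ^\<^sub>m n *\<^sub>v (T *\<^sub>v y) = T *\<^sub>v (diag_chi (\<lambda>m. g_inv m ^ n) *\<^sub>v y)"
  proof -
    have "R_chi g_inv ^\<^sub>m n *\<^sub>v (T *\<^sub>v y) = R_chi (\<lambda>m. g_inv m ^ n) *\<^sub>v (T *\<^sub>v y)"
      by (simp only: R_chi_pow)
    also have "\<dots> = T *\<^sub>v (diag_chi (\<lambda>m. g_inv m ^ n) *\<^sub>v (Q *\<^sub>v (T *\<^sub>v y)))"
      unfolding R_chi_def by (rule conj_vec[OF diag_chi Ty])
    finally show ?thesis by (simp only: QT_vec[OF y])
  qed
  ultimately have eq: "approx_mat n *\<^sub>v e = of_real (c n) \<cdot>\<^sub>v (T *\<^sub>v (diag_chi (\<lambda>m. g_inv m ^ n) *\<^sub>v y))"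
    unfolding approx_mat_vec[OF e] by (simp only:)
  have "approx_mat n $$ (a, b) = (approx_mat n *\<^sub>v e) $ a"
    unfolding e_def by (rule mat_unit_vec_entry[OF approx_mat a b, symmetric])
  also have "\<dots> = of_real (c n) * (T *\<^sub>v (diag_chi (\<lambda>m. g_inv m ^ n) *\<^sub>v y)) $ a"
    unfolding eq by (rule index_smult_vec(1)) (use mult_mat_vec_carrier[OF T Dy] a in \<open>simp only: carrier_vecD\<close>)
  also have "(T *\<^sub>v (diag_chi (\<lambda>m. g_inv m ^ n) *\<^sub>v y)) $ a =
      (\<Sum>i<d. T $$ (a, i) * (\<chi> g_inv (eig i) ^ n * y $ i))"
    unfolding mat_vec_entry[OF T Dy a]
    by (intro sum.cong refl) (simp add: diag_chi_vec[OF y] chi_power del: index_mult_mat_vec)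
  also have "\<dots> = (\<Sum>i<d. T $$ (a, i) * (\<chi> g_inv (eig i) ^ n * (\<Sum>j<d. (J ^\<^sub>m n) $$ (i, j) * Q $$ (j, b))))"
  proof (intro sum.cong refl)
    fix i assume "i \<in> {..<d}"
    then have i: "i < d" by simp
    have "y $ i = (\<Sum>j<d. (J ^\<^sub>m n) $$ (i, j) * (Q *\<^sub>v e) $ j)"
      unfolding y_def by (rule mat_vec_entry[OF Jn Qe i])
    also have "\<dots> = (\<Sum>j<d. (J ^\<^sub>m n) $$ (i, j) * Q $$ (j, b))"
      unfolding e_def by (intro sum.cong refl) (simp only: lessThan_iff mat_unit_vec_entry[OF Q _ b])
    finally show "T $$ (a, i) * (\<chi> g_inv (eig i) ^ n * y $ i) =
        T $$ (a, i) * (\<chi> g_inv (eig i) ^ n * (\<Sum>j<d. (J ^\<^sub>m n) $$ (i, j) * Q $$ (j, b)))" by (simp only:)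
  qed
  finally show ?thesis by (simp only: sum_distrib_left sum_distrib_right mult_ac)
qed

abbreviation "P \<equiv> P_mat k d u A g"

lemma P: "P \<in> carrier_mat d d"
  by (simp add: P_mat_def Let_def)

text \<open>\<open>P_mat\<close> is defined by \<open>lim\<close>, which carries information only
  once convergence is known. In the Jordan basis every entry is a fixed finite combination of the
  convergent coefficients.\<close>

lemma approx_mat_tendsto:
  assumes a: "a < d" and b: "b < d"
  shows "(\<lambda>n. approx_mat n $$ (a, b)) \<longlonglongrightarrow> P $$ (a, b)"
proof -
  have "\<exists>L. \<forall>p\<in>{..<d} \<times> {..<d}.
      (\<lambda>n. of_real (c n) * (\<chi> g_inv (eig (fst p)) ^ n * (J ^\<^sub>m n) $$ (fst p, snd p))) \<longlonglongrightarrow> L p"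
    by (rule bchoice) (use coefficient_converges in \<open>auto simp: convergent_def\<close>)
  then obtain L where L: "\<And>i j. i < d \<Longrightarrow> j < d \<Longrightarrow>
      (\<lambda>n. of_real (c n) * (\<chi> g_inv (eig i) ^ n * (J ^\<^sub>m n) $$ (i, j))) \<longlonglongrightarrow> L (i, j)" by force
  have "(\<lambda>n. approx_mat n $$ (a, b)) \<longlonglongrightarrow> (\<Sum>i<d. \<Sum>j<d. T $$ (a, i) * L (i, j) * Q $$ (j, b))"
    unfolding approx_mat_entry[OF a b] by (intro tendsto_sum tendsto_mult tendsto_const L) auto
  then have "convergent (\<lambda>n. approx_mat n $$ (a, b))" by (rule convergentI)
  moreover have "P $$ (a, b) = lim (\<lambda>n. approx_mat n $$ (a, b))"
    using a b unfolding P_mat_def Let_def R_mat_eq approx_mat_def by simp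
  ultimately show ?thesis by (simp only: convergent_LIMSEQ_iff)
qed

definition limit_functional :: "real vec \<Rightarrow> (nat \<Rightarrow> complex) \<Rightarrow> complex" where
  "limit_functional x h = map_vec complex_of_real x \<bullet>
     (R_chi h *\<^sub>v (P *\<^sub>v map_vec complex_of_real v))"

lemma Pv: "P *\<^sub>v map_vec complex_of_real v \<in> carrier_vec d"
  using P v by (intro mult_mat_vec_carrier[of _ d d]) auto

lemma continuous_on_limit_functional:
  assumes x: "x \<in> carrier_vec d"
  shows "continuous_on UNIV (limit_functional x)"
proof -
  have xc: "map_vec complex_of_real x \<in> carrier_vec d" using x by simp
  show ?thesis
    unfolding limit_functional_def[abs_def] scalar_prod_R_chi[OF xc Pv]
    by (intro continuous_intros continuous_on_chi)
qed

text \<open>R_h for the n-th power of g undoes the rotation contained in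
  \<open>approx_mat n\<close>, so the scaled scalar product is exactly \<open>x\<close> against R_h
  applied to \<open>approx_mat n *\<^sub>v v\<close>. Although this R_h varies with
  \<open>n\<close>, in Jordan coordinates it acts by scalars of modulus 1, and the convergence of
  \<open>approx_mat n *\<^sub>v v\<close> survives.\<close>

lemma limit_functional_asymptotics:
  assumes x: "x \<in> V"
  shows "(\<lambda>n. of_real (c n * (x \<bullet> (S ^\<^sub>m n *\<^sub>v v))) - limit_functional x (\<lambda>m. g m ^ n)) \<longlonglongrightarrow> 0"
proof -
  let ?v = "map_vec complex_of_real v" and ?x = "map_vec complex_of_real x"
  have xc: "?x \<in> carrier_vec d" using vec_subspaceD(1)[OF subspace_V x] by simp
  have vc: "?v \<in> carrier_vec d" using v by simp
  define \<alpha> where "\<alpha> i = (transpose_mat T *\<^sub>v ?x) $ i" for i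
  have av: "approx_mat n *\<^sub>v ?v \<in> carrier_vec d" for n by (rule mult_mat_vec_carrier[OF approx_mat vc])
  have "(\<lambda>n. (approx_mat n *\<^sub>v ?v) $ i) \<longlonglongrightarrow> (P *\<^sub>v ?v) $ i" if i: "i < d" for i
    unfolding mat_vec_entry[OF approx_mat vc i] mat_vec_entry[OF P vc i]
    by (intro tendsto_sum tendsto_mult tendsto_const approx_mat_tendsto i) simp
  then have Qlim: "(\<lambda>n. (Q *\<^sub>v (approx_mat n *\<^sub>v ?v)) $ i) \<longlonglongrightarrow> (Q *\<^sub>v (P *\<^sub>v ?v)) $ i" if i: "i < d" for i
    unfolding mat_vec_entry[OF Q av i] mat_vec_entry[OF Q Pv i]
    by (intro tendsto_sum tendsto_mult tendsto_const) simp
  have main: "of_real (c n * (x \<bullet> (S ^\<^sub>m n *\<^sub>v v))) =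
      ?x \<bullet> (R_chi (\<lambda>m. g m ^ n) *\<^sub>v (approx_mat n *\<^sub>v ?v))" for n
  proof -
    let ?Nv = "N ^\<^sub>m n *\<^sub>v ?v" and ?h = "\<lambda>m. g m ^ n"
    have Nv: "?Nv \<in> carrier_vec d" by (rule mult_mat_vec_carrier[OF pow_carrier_mat[OF N] vc])
    have RNv: "R_chi (\<lambda>m. inverse (?h m)) *\<^sub>v ?Nv \<in> carrier_vec d" by (rule mult_mat_vec_carrier[OF R_chi Nv])
    have g0: "g m ^ n \<noteq> 0" for m using cmod_g[of m] by auto
    have "approx_mat n *\<^sub>v ?v = of_real (c n) \<cdot>\<^sub>v (R_chi (\<lambda>m. inverse (?h m)) *\<^sub>v ?Nv)"
      unfolding approx_mat_vec[OF vc] R_chi_pow power_inverse ..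
    then have "R_chi ?h *\<^sub>v (approx_mat n *\<^sub>v ?v) = of_real (c n) \<cdot>\<^sub>v ?Nv"
      unfolding mult_mat_vec[OF R_chi RNv, symmetric]
      by (simp only: mult_mat_vec[OF R_chi RNv] R_chi_inverse[OF Nv g0])
    then show ?thesis
      using scalar_prod_smult_distrib[OF xc Nv] scalar_prod_pow_A_tilde[OF x v, of n] by simp
  qed
  have "of_real (c n * (x \<bullet> (S ^\<^sub>m n *\<^sub>v v))) - limit_functional x (\<lambda>m. g m ^ n) =
      (\<Sum>i<d. \<chi> g (eig i) ^ n * (\<alpha> i * ((Q *\<^sub>v (approx_mat n *\<^sub>v ?v)) $ i - (Q *\<^sub>v (P *\<^sub>v ?v)) $ i)))" for n
    unfolding main limit_functional_def scalar_prod_R_chi[OF xc av] scalar_prod_R_chi[OF xc Pv] chi_power \<alpha>_def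
    by (simp only: sum_subtractf[symmetric] right_diff_distrib)
  moreover have "(\<lambda>n. \<Sum>i<d. \<chi> g (eig i) ^ n * (\<alpha> i * ((Q *\<^sub>v (approx_mat n *\<^sub>v ?v)) $ i - (Q *\<^sub>v (P *\<^sub>v ?v)) $ i))) \<longlonglongrightarrow> 0"
  proof (rule tendsto_null_sum)
    fix i assume "i \<in> {..<d}"
    then have i: "i < d" by simp
    let ?y = "\<lambda>n. \<alpha> i * ((Q *\<^sub>v (approx_mat n *\<^sub>v ?v)) $ i - (Q *\<^sub>v (P *\<^sub>v ?v)) $ i)"
    have "?y \<longlonglongrightarrow> \<alpha> i * ((Q *\<^sub>v (P *\<^sub>v ?v)) $ i - (Q *\<^sub>v (P *\<^sub>v ?v)) $ i)"
      by (intro tendsto_intros Qlim[OF i])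
    then have "?y \<longlonglongrightarrow> 0" by (simp only: diff_self mult_zero_right)
    then have "(\<lambda>n. norm (?y n)) \<longlonglongrightarrow> 0" by (rule tendsto_norm_zero)
    moreover have "norm (\<chi> g (eig i) ^ n * ?y n) = norm (?y n)" for n
      by (simp only: norm_mult norm_power cmod_chi_g power_one mult_1)
    ultimately have "(\<lambda>n. norm (\<chi> g (eig i) ^ n * ?y n)) \<longlonglongrightarrow> 0" by (simp only:)
    then show "(\<lambda>n. \<chi> g (eig i) ^ n * ?y n) \<longlonglongrightarrow> 0" by (rule tendsto_norm_zero_cancel)
  qed
  ultimately show ?thesis by (simp only:)
qed

end

subsection \<open>Masses of digit intervals\<close>

lemma sum_over_blocks:
  fixes h :: "nat \<Rightarrow> 'a::comm_monoid_add"
  assumes "a \<le> b"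
  shows "(\<Sum>m\<in>{a * K..<b * K}. h m) = (\<Sum>w\<in>{a..<b}. \<Sum>m\<in>{w * K..<(w + 1) * K}. h m)"
proof -
  have "(\<Sum>j<K. h (K * w + j)) = (\<Sum>m\<in>{w * K..<(w + 1) * K}. h m)" for w
    using sum_blocks[of w "w + 1" h K] by simp
  then show ?thesis by (simp only: sum_blocks[OF assms])
qed

lemma quotient_asymptotics:
  fixes a b :: "nat \<Rightarrow> real" and t :: "nat \<Rightarrow> 'a"
  assumes a: "(\<lambda>n. a n - \<alpha> (t n)) \<longlonglongrightarrow> 0" and b: "(\<lambda>n. b n - \<beta> (t n)) \<longlonglongrightarrow> 0"
    and \<alpha>: "\<And>n. \<bar>\<alpha> (t n)\<bar> \<le> B" and \<beta>: "\<And>n. \<beta> (t n) \<ge> \<delta>" and \<delta>: "\<delta> > 0"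
  shows "(\<lambda>n. a n / b n - \<alpha> (t n) / \<beta> (t n)) \<longlonglongrightarrow> 0"
proof -
  \<comment> \<open>The majorant comes from \<open>a/b - \<alpha>/\<beta> = (a - \<alpha>)/b -
    \<alpha> (b - \<beta>)/(b \<beta>)\<close>; the factor \<open>2 / \<delta>\<close> bounds
    \<open>1 / b n\<close> once \<open>b n\<close> is within \<open>\<delta> / 2\<close> of
    \<open>\<beta> (t n)\<close>.\<close>
  have "(\<lambda>n. \<bar>a n - \<alpha> (t n)\<bar> * (2 / \<delta>) + B * (\<bar>b n - \<beta> (t n)\<bar> * (2 / \<delta>) * (1 / \<delta>))) \<longlonglongrightarrow>
      0 * (2 / \<delta>) + B * (0 * (2 / \<delta>) * (1 / \<delta>))"
    by (intro tendsto_intros tendsto_rabs_zero a b)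
  then have "(\<lambda>n. \<bar>a n - \<alpha> (t n)\<bar> * (2 / \<delta>) + B * (\<bar>b n - \<beta> (t n)\<bar> * (2 / \<delta>) * (1 / \<delta>))) \<longlonglongrightarrow> 0"
    by simp
  then show ?thesis
  proof (rule Lim_null_comparison[rotated])
    have "\<forall>\<^sub>F n in sequentially. \<bar>b n - \<beta> (t n)\<bar> < \<delta> / 2"
      using tendstoD[OF b half_gt_zero[OF \<delta>]] by (simp add: dist_real_def)
    then show "\<forall>\<^sub>F n in sequentially. norm (a n / b n - \<alpha> (t n) / \<beta> (t n)) \<le>
        \<bar>a n - \<alpha> (t n)\<bar> * (2 / \<delta>) + B * (\<bar>b n - \<beta> (t n)\<bar> * (2 / \<delta>) * (1 / \<delta>))"
    proof eventually_elim
      case (elim n)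
      have bn: "b n \<ge> \<delta> / 2" using elim \<beta>[of n] by linarith
      have bpos: "b n > 0" "\<beta> (t n) > 0" using bn \<beta>[of n] \<delta> by linarith+
      have inv: "1 / b n \<le> 2 / \<delta>" "1 / \<beta> (t n) \<le> 1 / \<delta>"
        using bn \<beta>[of n] \<delta> bpos by (auto simp: field_simps)
      have "a n / b n - \<alpha> (t n) / \<beta> (t n) =
          (a n - \<alpha> (t n)) * (1 / b n) - \<alpha> (t n) * ((b n - \<beta> (t n)) * (1 / b n) * (1 / \<beta> (t n)))"
        using bpos by (simp add: field_simps)
      also have "\<bar>\<dots>\<bar> \<le> \<bar>(a n - \<alpha> (t n)) * (1 / b n)\<bar> +
          \<bar>\<alpha> (t n) * ((b n - \<beta> (t n)) * (1 / b n) * (1 / \<beta> (t n)))\<bar>" by (rule abs_triangle_ineq4)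
      also have "\<dots> = \<bar>a n - \<alpha> (t n)\<bar> * (1 / b n) +
          \<bar>\<alpha> (t n)\<bar> * (\<bar>b n - \<beta> (t n)\<bar> * (1 / b n) * (1 / \<beta> (t n)))"
        using bpos by (simp add: abs_mult)
      also have "\<dots> \<le> \<bar>a n - \<alpha> (t n)\<bar> * (2 / \<delta>) + B * (\<bar>b n - \<beta> (t n)\<bar> * (2 / \<delta>) * (1 / \<delta>))"
        using \<alpha>[of n] inv bpos \<delta>
        by (intro add_mono mult_mono mult_left_mono mult_nonneg_nonneg) auto
      finally show ?case by simp
    qed
  qed
qed

lemma
  assumes k: "k \<ge> 2" and f: "\<And>n. f n \<ge> 0" and pos: "block_sum k f N > 0"
  shows mu_N_circle_prob: "mu_N k f N \<in> circle_prob"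
    and integral_mu_N: "\<phi> \<in> circle_cont \<Longrightarrow> (\<integral>x. \<phi> x \<partial>mu_N k f N) =
      (\<Sum>n\<in>{k ^ N..<k ^ (N + 1)}. f n / block_sum k f N * \<phi> ((real n - real k ^ N) / (real k ^ N * (real k - 1))))"
proof -
  let ?M = "{..<k ^ (N + 1) - k ^ N}"
  let ?p = "\<lambda>m. f (k ^ N + m) / block_sum k f N"
  let ?x = "\<lambda>m. real m / (real k ^ N * (real k - 1))"
  have le: "k ^ N \<le> k ^ (N + 1)" using k by simp
  have reindex: "(\<Sum>m\<in>?M. h (k ^ N + m)) = (\<Sum>n\<in>{k ^ N..<k ^ (N + 1)}. h n)" for h :: "nat \<Rightarrow> real"
    by (rule sum.reindex_bij_witness[of _ "\<lambda>n. n - k ^ N" "\<lambda>m. k ^ N + m"]) (use le in auto)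
  have denom: "real k ^ N * (real k - 1) > 0" using k by (intro mult_pos_pos) auto
  have "?x m < 1" if "m \<in> ?M" for m
  proof -
    have "real m < real (k ^ (N + 1) - k ^ N)" using that by (simp del: of_nat_diff)
    also have "\<dots> = real k ^ N * (real k - 1)" using le by (simp add: of_nat_diff algebra_simps)
    finally show ?thesis using denom by (simp add: divide_less_eq)
  qed
  moreover have "0 \<le> ?x m" for m using denom by (intro divide_nonneg_pos) auto
  ultimately have x: "?x \<in> measurable (point_measure ?M (\<lambda>m. ennreal (?p m))) circle_borel"
    by (auto simp: circle_borel_def space_restrict_space)
  have p: "?p m \<ge> 0" for m using f pos by simp
  have total: "(\<Sum>m\<in>?M. ?p m) = 1"
    using reindex[of "\<lambda>n. f n / block_sum k f N"] pos
    by (simp add: sum_divide_distrib[symmetric] block_sum_def)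
  have "prob_space (point_measure ?M (\<lambda>m. ennreal (?p m)))"
  proof (rule prob_spaceI)
    have "emeasure (point_measure ?M (\<lambda>m. ennreal (?p m))) ?M = (\<Sum>m\<in>?M. ennreal (?p m))"
      by (rule emeasure_point_measure_finite) auto
    also have "\<dots> = 1" using p total by (simp add: sum_ennreal)
    finally show "emeasure (point_measure ?M (\<lambda>m. ennreal (?p m)))
        (space (point_measure ?M (\<lambda>m. ennreal (?p m)))) = 1" by (simp add: space_point_measure)
  qed
  from prob_space.prob_space_distr[OF this x] show "mu_N k f N \<in> circle_prob"
    by (simp add: circle_prob_def mu_N_def)
  assume \<phi>: "\<phi> \<in> circle_cont"
  have "\<phi> \<in> borel_measurable circle_borel"
    unfolding circle_borel_def by (intro measurable_restrict_space1 circle_cont_measurable \<phi>)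
  then have "(\<integral>x. \<phi> x \<partial>mu_N k f N) = (\<integral>m. \<phi> (?x m) \<partial>point_measure ?M (\<lambda>m. ennreal (?p m)))"
    unfolding mu_N_def by (rule integral_distr[OF x])
  also have "\<dots> = (\<Sum>m\<in>?M. ?p m *\<^sub>R \<phi> (?x m))"
    by (rule lebesgue_integral_point_measure_finite) (use p in auto)
  also have "\<dots> = (\<Sum>n\<in>{k ^ N..<k ^ (N + 1)}. f n / block_sum k f N * \<phi> ((real n - real k ^ N) / (real k ^ N * (real k - 1))))"
    by (subst reindex[symmetric]) simp
  finally show "(\<integral>x. \<phi> x \<partial>mu_N k f N) = \<dots>" .
qed

section \<open>Limiting masses of digit blocks and their normalisation\<close>

context phase_rep
begin

text \<open>The limit functional phrased through \<open>R_mat\<close> and \<open>P_mat\<close>,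
  hence free of the Jordan basis. The real part suffices because the scaled scalar products it
  approximates are real.\<close>

definition \<Phi> :: "real vec \<Rightarrow> (nat \<Rightarrow> complex) \<Rightarrow> real" where
  "\<Phi> x h = Re (map_vec complex_of_real x \<bullet>
     (R_mat k d u A g h *\<^sub>v (P_mat k d u A g *\<^sub>v map_vec complex_of_real v)))"

lemma
  shows Phi_asymptotics: "\<And>x. x \<in> V \<Longrightarrow> (\<lambda>n. c n * (x \<bullet> (S ^\<^sub>m n *\<^sub>v v)) - \<Phi> x (\<lambda>m. g m ^ n)) \<longlonglongrightarrow> 0"
    and continuous_on_Phi: "\<And>x X. x \<in> carrier_vec d \<Longrightarrow> continuous_on X (\<Phi> x)"
    and RPv_carrier: "\<And>h. R_mat k d u A g h *\<^sub>v (P_mat k d u A g *\<^sub>v map_vec complex_of_real v) \<in> carrier_vec d"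
proof -
  obtain bs T Q where "jordan_rep k d u A v f g bs T Q" by (rule jordan_rep_exists)
  then interpret jordan_rep k d u A v f g bs T Q .
  have Phi: "\<Phi> x h = Re (limit_functional x h)" for x h
    unfolding \<Phi>_def limit_functional_def R_mat_eq ..
  show "(\<lambda>n. c n * (x \<bullet> (S ^\<^sub>m n *\<^sub>v v)) - \<Phi> x (\<lambda>m. g m ^ n)) \<longlonglongrightarrow> 0" if x: "x \<in> V" for x
    using tendsto_Re[OF limit_functional_asymptotics[OF x]] by (simp add: Phi)
  show "continuous_on X (\<Phi> x)" if "x \<in> carrier_vec d" for x X
    unfolding Phi[abs_def]
    by (intro continuous_on_Re continuous_on_subset[OF continuous_on_limit_functional[OF that]]) simp
  show "R_mat k d u A g h *\<^sub>v (P_mat k d u A g *\<^sub>v map_vec complex_of_real v) \<in> carrier_vec d" for h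
    unfolding R_mat_eq by (rule mult_mat_vec_carrier[OF R_chi Pv])
qed

text \<open>The polynomial factors at \<open>n\<close> and \<open>n - l\<close> have ratio tending
  to 1; only the exponential factor remembers the shift.\<close>

lemma c_ratio: "(\<lambda>n. c n / c (n - l)) \<longlonglongrightarrow> 1 / \<rho> ^ l"
proof -
  have "(\<lambda>n. 1 - real l * (1 / real n)) \<longlonglongrightarrow> 1 - real l * 0"
    by (intro tendsto_intros lim_1_over_n)
  then have "(\<lambda>n. (1 - real l * (1 / real n)) ^ (r - 1) * (1 / \<rho> ^ l)) \<longlonglongrightarrow> (1 - real l * 0) ^ (r - 1) * (1 / \<rho> ^ l)"
    by (intro tendsto_intros)
  then have "(\<lambda>n. (1 - real l * (1 / real n)) ^ (r - 1) * (1 / \<rho> ^ l)) \<longlonglongrightarrow> 1 / \<rho> ^ l" by simp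
  moreover have "\<forall>\<^sub>F n in sequentially. (1 - real l * (1 / real n)) ^ (r - 1) * (1 / \<rho> ^ l) = c n / c (n - l)"
    using eventually_gt_at_top[of l]
  proof eventually_elim
    case (elim n)
    have 1: "1 - real l * (1 / real n) = real (n - l) / real n"
      using elim by (simp add: of_nat_diff field_simps)
    have 2: "\<rho> ^ n = \<rho> ^ (n - l) * \<rho> ^ l" using elim by (simp add: power_add[symmetric])
    have pos: "real (n - l) ^ (r - 1) > 0" "real n ^ (r - 1) > 0" using elim by simp_all
    show ?case unfolding c_eq 1 2 power_divide using pos rho_pos by (simp add: field_simps)
  qed
  ultimately show ?thesis by (rule Lim_transform_eventually)
qed

lemma compact_G: "compact (phase_group g)"
  by (rule compact_phase_group[OF cmod_g])

lemma Phi_bounded: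
  assumes "x \<in> carrier_vec d"
  obtains B where "\<forall>h\<in>phase_group g. \<bar>\<Phi> x h\<bar> \<le> B"
proof -
  have "bounded (\<Phi> x ` phase_group g)"
    by (intro compact_imp_bounded compact_continuous_image continuous_on_Phi assms compact_G)
  then obtain B where "\<forall>y\<in>\<Phi> x ` phase_group g. norm y \<le> B" unfolding bounded_iff ..
  then show thesis by (intro that[of B]) auto
qed

text \<open>The limiting mass of a \<open>k\<close>-adic interval of level \<open>l\<close>, before normalisation: passing from
  \<open>n\<close> to \<open>n - l\<close> multiplies the phase by \<open>g\<^sup>-\<^sup>l\<close> and the growth by \<open>\<rho>\<^sup>-\<^sup>l\<close>.\<close>

definition mass :: "nat \<Rightarrow> nat \<Rightarrow> (nat \<Rightarrow> complex) \<Rightarrow> real" where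
  "mass l w h = 1 / \<rho> ^ l * \<Phi> (row_vec w) (\<lambda>m. h m * inverse (g m) ^ l)"

lemma continuous_on_mass: "continuous_on X (mass l w)"
proof -
  have "continuous_on X (\<lambda>h m. h m * inverse (g m) ^ l)"
    by (intro continuous_on_coordinatewise_then_product continuous_intros
        continuous_on_subset[OF continuous_on_product_coordinates]) auto
  from continuous_on_compose2[OF continuous_on_Phi[OF row_vec_carrier, of UNIV] this]
  show ?thesis unfolding mass_def[abs_def] by (intro continuous_intros) auto
qed

lemma block_mass_asymptotics:
  assumes w: "w \<ge> 1"
  shows "(\<lambda>n. c n * (\<Sum>m\<in>{w * k ^ (n - l)..<(w + 1) * k ^ (n - l)}. f m) - mass l w (\<lambda>m. g m ^ n)) \<longlonglongrightarrow> 0"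
proof -
  let ?x = "row_vec w"
  have x: "?x \<in> V" "?x \<in> carrier_vec d" using row_vec_in_V[OF w] row_vec_carrier by auto
  have sum: "(\<Sum>m\<in>{w * k ^ j..<(w + 1) * k ^ j}. f m) = ?x \<bullet> (S ^\<^sub>m j *\<^sub>v v)" for j
    unfolding f by (rule sum_digit_block[OF w v])
  define Y where "Y n = c n * (?x \<bullet> (S ^\<^sub>m n *\<^sub>v v))" for n
  define Z where "Z n = \<Phi> ?x (\<lambda>m. g m ^ n)" for n
  have YZ: "(\<lambda>n. Y n - Z n) \<longlonglongrightarrow> 0" unfolding Y_def Z_def by (rule Phi_asymptotics[OF x(1)])
  obtain B where B: "\<forall>h\<in>phase_group g. \<bar>\<Phi> ?x h\<bar> \<le> B" by (rule Phi_bounded[OF x(2)])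
  have shift: "filterlim (\<lambda>n. n - l) at_top sequentially" by (rule filterlim_minus_const_nat_at_top)
  \<comment> \<open>With \<open>q = c n / c (n - l)\<close> and \<open>p = 1 / \<rho> ^ l\<close>,
    the difference \<open>q Y - p Z\<close> at index \<open>n - l\<close> is split into
    \<open>q (Y - Z)\<close> and \<open>(q - p) Z\<close>. The first part needs \<open>q\<close> to
    converge, the second needs \<open>Z\<close> bounded.\<close>
  have "(\<lambda>n. c n / c (n - l) * (Y (n - l) - Z (n - l))) \<longlonglongrightarrow> 1 / \<rho> ^ l * 0"
    by (intro tendsto_mult c_ratio filterlim_compose[OF YZ shift])
  moreover have "(\<lambda>n. (c n / c (n - l) - 1 / \<rho> ^ l) * Z (n - l)) \<longlonglongrightarrow> 0"
  proof (rule Lim_null_comparison)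
    show "\<forall>\<^sub>F n in sequentially. norm ((c n / c (n - l) - 1 / \<rho> ^ l) * Z (n - l)) \<le>
        \<bar>c n / c (n - l) - 1 / \<rho> ^ l\<bar> * B"
    proof (rule always_eventually, rule allI)
      fix n
      have "\<bar>Z (n - l)\<bar> \<le> B" unfolding Z_def by (rule bspec[OF B power_in_phase_group])
      then show "norm ((c n / c (n - l) - 1 / \<rho> ^ l) * Z (n - l)) \<le> \<bar>c n / c (n - l) - 1 / \<rho> ^ l\<bar> * B"
        unfolding real_norm_def abs_mult by (rule mult_left_mono) simp
    qed
    have "(\<lambda>n. \<bar>c n / c (n - l) - 1 / \<rho> ^ l\<bar> * B) \<longlonglongrightarrow> \<bar>1 / \<rho> ^ l - 1 / \<rho> ^ l\<bar> * B"
      by (intro tendsto_intros c_ratio)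
    then show "(\<lambda>n. \<bar>c n / c (n - l) - 1 / \<rho> ^ l\<bar> * B) \<longlonglongrightarrow> 0" by simp
  qed
  ultimately have "(\<lambda>n. c n / c (n - l) * (Y (n - l) - Z (n - l)) + (c n / c (n - l) - 1 / \<rho> ^ l) * Z (n - l))
      \<longlonglongrightarrow> 1 / \<rho> ^ l * 0 + 0" by (rule tendsto_add)
  then have lim: "(\<lambda>n. c n / c (n - l) * (Y (n - l) - Z (n - l)) + (c n / c (n - l) - 1 / \<rho> ^ l) * Z (n - l)) \<longlonglongrightarrow> 0"
    by simp
  have "\<forall>\<^sub>F n in sequentially. c n / c (n - l) * (Y (n - l) - Z (n - l)) + (c n / c (n - l) - 1 / \<rho> ^ l) * Z (n - l) =
      c n * (\<Sum>m\<in>{w * k ^ (n - l)..<(w + 1) * k ^ (n - l)}. f m) - mass l w (\<lambda>m. g m ^ n)"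
    using eventually_gt_at_top[of l]
  proof eventually_elim
    case (elim n)
    have "n - l \<ge> 1" using elim by linarith
    then have c0: "c (n - l) \<noteq> 0" using c_pos by (metis less_irrefl)
    have "(\<lambda>m. g m ^ n * inverse (g m) ^ l) = (\<lambda>m. g m ^ (n - l))"
    proof
      fix m
      have "g m \<noteq> 0" using cmod_g[of m] by auto
      then show "g m ^ n * inverse (g m) ^ l = g m ^ (n - l)"
        using elim by (simp add: power_diff power_inverse field_simps)
    qed
    then have mass: "mass l w (\<lambda>m. g m ^ n) = 1 / \<rho> ^ l * Z (n - l)" by (simp add: mass_def Z_def)
    have "c n / c (n - l) * Y (n - l) = c n * (\<Sum>m\<in>{w * k ^ (n - l)..<(w + 1) * k ^ (n - l)}. f m)"
      unfolding sum Y_def using c0 by simp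
    moreover have "q * (y - z) + (q - p) * z = q * y - p * z" for p q y z :: real
      by (simp add: algebra_simps)
    ultimately show ?case by (simp only: mass)
  qed
  with lim show ?thesis by (rule Lim_transform_eventually)
qed

text \<open>The limiting normaliser. The sum runs over the possible leading digits, which are
  nonzero.\<close>

definition total_mass :: "(nat \<Rightarrow> complex) \<Rightarrow> real" where
  "total_mass h = (\<Sum>w\<in>{1..<k}. mass 0 w h)"

lemma continuous_on_total_mass: "continuous_on X total_mass"
  unfolding total_mass_def[abs_def] by (intro continuous_intros continuous_on_mass)

lemma block_sum_asymptotics: "(\<lambda>n. c n * block_sum k f n - total_mass (\<lambda>m. g m ^ n)) \<longlonglongrightarrow> 0"
proof -
  have "block_sum k f n = (\<Sum>w\<in>{1..<k}. \<Sum>m\<in>{w * k ^ (n - 0)..<(w + 1) * k ^ (n - 0)}. f m)" for n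
    using sum_over_blocks[of 1 k f "k ^ n"] k by (simp add: block_sum_def)
  then have "c n * block_sum k f n - total_mass (\<lambda>m. g m ^ n) = (\<Sum>w\<in>{1..<k}.
      c n * (\<Sum>m\<in>{w * k ^ (n - 0)..<(w + 1) * k ^ (n - 0)}. f m) - mass 0 w (\<lambda>m. g m ^ n))" for n
    by (simp only: total_mass_def sum_subtractf sum_distrib_left)
  moreover have "(\<lambda>n. \<Sum>w\<in>{1..<k}.
      c n * (\<Sum>m\<in>{w * k ^ (n - 0)..<(w + 1) * k ^ (n - 0)}. f m) - mass 0 w (\<lambda>m. g m ^ n)) \<longlonglongrightarrow> 0"
    by (rule tendsto_null_sum) (rule block_mass_asymptotics, simp)
  ultimately show ?thesis by (simp only:)
qed

lemma row_vec_digit: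
  assumes w: "1 \<le> w" "w < k"
  shows "row_vec w = transpose_mat (A w) *\<^sub>v u"
proof -
  have "word 0 = 1\<^sub>m d" by (subst base_expansion.simps) (simp add: word_mat_def)
  then have "row_vec 0 = u" using u by (simp add: row_vec_def)
  then show ?thesis using row_vec_step[of 0 w] w by simp
qed

text \<open>\<open>S - A 0\<close> is the sum of the matrices of the nonzero digits, and
  \<open>u\<close> applied to the matrix of such a digit is the row vector of a one-digit word. So
  the quantity required to be positive by nondegeneracy is exactly the limiting normaliser.\<close>

lemma total_mass_eq:
  "total_mass h = Re (map_vec complex_of_real u \<bullet>
     (map_mat complex_of_real (S - A 0) *\<^sub>v
       (R_mat k d u A g h *\<^sub>v (P_mat k d u A g *\<^sub>v map_vec complex_of_real v))))"
proof -
  define y where "y = R_mat k d u A g h *\<^sub>v (P_mat k d u A g *\<^sub>v map_vec complex_of_real v)"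
  have y: "y \<in> carrier_vec d" unfolding y_def by (rule RPv_carrier)
  have A0: "A 0 \<in> carrier_mat d d" using A k by simp
  have SA: "(S - A 0) $$ (i, j) = (\<Sum>w\<in>{1..<k}. A w $$ (i, j))" if "i < d" "j < d" for i j
  proof -
    have "(\<Sum>l<k. A l $$ (i, j)) = A 0 $$ (i, j) + (\<Sum>w\<in>{1..<k}. A w $$ (i, j))"
      using k by (simp add: lessThan_atLeast0 sum.atLeast_Suc_lessThan)
    then show ?thesis using that A0 by (simp add: sum_mat_def)
  qed
  have M: "map_mat complex_of_real (S - A 0) \<in> carrier_mat d d"
    using minus_carrier_mat[OF A0, of S] by simp
  have My: "map_mat complex_of_real (S - A 0) *\<^sub>v y \<in> carrier_vec d" by (rule mult_mat_vec_carrier[OF M y])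
  have row: "row_vec w $ j = (\<Sum>i<d. A w $$ (i, j) * u $ i)" if "w \<in> {1..<k}" "j < d" for w j
  proof -
    have "transpose_mat (A w) \<in> carrier_mat d d" using A that by simp
    from mat_vec_entry[OF this u that(2)] show ?thesis
      using row_vec_digit[of w] A[of w] that by simp
  qed
  have "map_vec complex_of_real u \<bullet> (map_mat complex_of_real (S - A 0) *\<^sub>v y) =
      (\<Sum>i<d. complex_of_real (u $ i) * (\<Sum>j<d. complex_of_real ((S - A 0) $$ (i, j)) * y $ j))"
  proof -
    have "map_vec complex_of_real u \<bullet> (map_mat complex_of_real (S - A 0) *\<^sub>v y) =
      (\<Sum>i<d. map_vec complex_of_real u $ i * (map_mat complex_of_real (S - A 0) *\<^sub>v y) $ i)"
      unfolding scalar_prod_def carrier_vecD[OF My] lessThan_atLeast0 ..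
    also have "\<dots> = (\<Sum>i<d. complex_of_real (u $ i) * (\<Sum>j<d. complex_of_real ((S - A 0) $$ (i, j)) * y $ j))"
    proof (intro sum.cong refl)
      fix i assume "i \<in> {..<d}"
      then have i: "i < d" by simp
      have "(map_mat complex_of_real (S - A 0) *\<^sub>v y) $ i =
          (\<Sum>j<d. map_mat complex_of_real (S - A 0) $$ (i, j) * y $ j)"
        by (rule mat_vec_entry[OF M y i])
      also have "\<dots> = (\<Sum>j<d. complex_of_real ((S - A 0) $$ (i, j)) * y $ j)"
      proof (intro sum.cong refl)
        fix j assume "j \<in> {..<d}"
        then have "map_mat complex_of_real (S - A 0) $$ (i, j) = complex_of_real ((S - A 0) $$ (i, j))"
          using i S A0 by (intro index_map_mat(1)) auto
        then show "map_mat complex_of_real (S - A 0) $$ (i, j) * y $ j = complex_of_real ((S - A 0) $$ (i, j)) * y $ j"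
          by (simp only:)
      qed
      finally show "map_vec complex_of_real u $ i * (map_mat complex_of_real (S - A 0) *\<^sub>v y) $ i =
          complex_of_real (u $ i) * (\<Sum>j<d. complex_of_real ((S - A 0) $$ (i, j)) * y $ j)"
        using u i by simp
    qed
    finally show ?thesis .
  qed
  also have "\<dots> = (\<Sum>i<d. \<Sum>j<d. \<Sum>w\<in>{1..<k}. complex_of_real (u $ i * A w $$ (i, j)) * y $ j)"
    by (intro sum.cong refl)
       (simp add: SA sum_distrib_left sum_distrib_right mult.assoc)
  also have "\<dots> = (\<Sum>w\<in>{1..<k}. \<Sum>j<d. \<Sum>i<d. complex_of_real (u $ i * A w $$ (i, j)) * y $ j)"
  proof -
    have "(\<Sum>i<d. \<Sum>j<d. \<Sum>w\<in>{1..<k}. F i j w) = (\<Sum>w\<in>{1..<k}. \<Sum>j<d. \<Sum>i<d. F i j w)"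
      for F :: "nat \<Rightarrow> nat \<Rightarrow> nat \<Rightarrow> complex"
    proof -
      have "(\<Sum>i<d. \<Sum>j<d. \<Sum>w\<in>{1..<k}. F i j w) = (\<Sum>i<d. \<Sum>w\<in>{1..<k}. \<Sum>j<d. F i j w)"
        by (intro sum.cong refl sum.swap)
      also have "\<dots> = (\<Sum>w\<in>{1..<k}. \<Sum>i<d. \<Sum>j<d. F i j w)" by (rule sum.swap)
      also have "\<dots> = (\<Sum>w\<in>{1..<k}. \<Sum>j<d. \<Sum>i<d. F i j w)" by (intro sum.cong refl sum.swap)
      finally show ?thesis .
    qed
    then show ?thesis .
  qed
  also have "\<dots> = (\<Sum>w\<in>{1..<k}. map_vec complex_of_real (row_vec w) \<bullet> y)"
  proof (intro sum.cong refl)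
    fix w assume w: "w \<in> {1..<k}"
    have "map_vec complex_of_real (row_vec w) \<bullet> y = (\<Sum>j<d. complex_of_real (row_vec w $ j) * y $ j)"
      using y row_vec_carrier[of w] by (simp add: scalar_prod_def lessThan_atLeast0)
    also have "\<dots> = (\<Sum>j<d. \<Sum>i<d. complex_of_real (u $ i * A w $$ (i, j)) * y $ j)"
      by (intro sum.cong refl) (simp add: row[OF w] sum_distrib_left mult_ac)
    finally show "(\<Sum>j<d. \<Sum>i<d. complex_of_real (u $ i * A w $$ (i, j)) * y $ j) =
        map_vec complex_of_real (row_vec w) \<bullet> y" by (rule sym)
  qed
  finally show ?thesis
    unfolding y_def[symmetric] total_mass_def mass_def \<Phi>_def by (simp add: y_def)
qed

lemma total_mass_pos: "h \<in> phase_group g \<Longrightarrow> total_mass h > 0"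
  using nondeg unfolding nondegenerate_representation_def Let_def total_mass_eq by blast

lemma total_mass_lower_bound:
  obtains \<delta> where "\<delta> > 0" "\<And>h. h \<in> phase_group g \<Longrightarrow> total_mass h \<ge> \<delta>"
proof -
  have "phase_group g \<noteq> {}" using power_in_phase_group[of g 0] by blast
  from continuous_attains_inf[OF compact_G this continuous_on_total_mass]
  obtain h0 where "h0 \<in> phase_group g" "\<forall>h\<in>phase_group g. total_mass h0 \<le> total_mass h" by blast
  then show thesis by (intro that[of "total_mass h0"] total_mass_pos) auto
qed

lemma eventually_block_sum_pos: "\<forall>\<^sub>F n in sequentially. block_sum k f n > 0"
proof -
  obtain \<delta> where \<delta>: "\<delta> > 0" "\<And>h. h \<in> phase_group g \<Longrightarrow> total_mass h \<ge> \<delta>"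
    using total_mass_lower_bound by blast
  show ?thesis
    using tendstoD[OF block_sum_asymptotics \<delta>(1)] eventually_ge_at_top[of 1]
  proof eventually_elim
    case (elim n)
    have "\<delta> \<le> total_mass (\<lambda>m. g m ^ n)" by (rule \<delta>(2)[OF power_in_phase_group])
    then have "c n * block_sum k f n > 0" using elim by (simp add: dist_real_def)
    then show ?case using c_pos[OF elim(2)] by (simp add: zero_less_mult_iff)
  qed
qed

lemma interval_mass_asymptotics:
  assumes w: "w \<ge> 1"
  shows "(\<lambda>n. (\<Sum>m\<in>{w * k ^ (n - l)..<(w + 1) * k ^ (n - l)}. f m) / block_sum k f n -
    mass l w (\<lambda>m. g m ^ n) / total_mass (\<lambda>m. g m ^ n)) \<longlonglongrightarrow> 0"
proof -
  obtain \<delta> where \<delta>: "\<delta> > 0" "\<And>h. h \<in> phase_group g \<Longrightarrow> total_mass h \<ge> \<delta>"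
    using total_mass_lower_bound by blast
  have "bounded (mass l w ` phase_group g)"
    by (intro compact_imp_bounded compact_continuous_image continuous_on_mass compact_G)
  then obtain B where B: "\<forall>y\<in>mass l w ` phase_group g. norm y \<le> B" unfolding bounded_iff ..
  let ?s = "\<lambda>n. \<Sum>m\<in>{w * k ^ (n - l)..<(w + 1) * k ^ (n - l)}. f m"
  have lim: "(\<lambda>n. c n * ?s n / (c n * block_sum k f n) -
      mass l w (\<lambda>m. g m ^ n) / total_mass (\<lambda>m. g m ^ n)) \<longlonglongrightarrow> 0"
  proof (rule quotient_asymptotics[OF block_mass_asymptotics[OF w] block_sum_asymptotics])
    show "\<bar>mass l w (\<lambda>m. g m ^ n)\<bar> \<le> B" for n
      using B power_in_phase_group[of g n] by auto
    show "total_mass (\<lambda>m. g m ^ n) \<ge> \<delta>" for n by (rule \<delta>(2)[OF power_in_phase_group])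
  qed (rule \<delta>)
  have "\<forall>\<^sub>F n in sequentially. c n * ?s n / (c n * block_sum k f n) -
      mass l w (\<lambda>m. g m ^ n) / total_mass (\<lambda>m. g m ^ n) =
    ?s n / block_sum k f n - mass l w (\<lambda>m. g m ^ n) / total_mass (\<lambda>m. g m ^ n)"
    using eventually_ge_at_top[of 1]
  proof eventually_elim
    case (elim n)
    have "c n \<noteq> 0" using c_pos[OF elim] by simp
    then show ?case by simp
  qed
  with lim show ?thesis by (rule Lim_transform_eventually)
qed

text \<open>Numbers sharing a prefix \<open>w\<close> of \<open>l + 1\<close> digits have their
  atoms at or to the right of the point of \<open>w\<close>, at distance less than
  \<open>1 / (k^l (k - 1))\<close>, which is at most \<open>1 / k^l\<close>. Moving each atom to
  that point changes \<phi> by at most \<open>e\<close>, and the weights sum to 1.\<close>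

lemma integral_mu_N_step_approximation:
  assumes f0: "\<And>n. f n \<ge> 0" and \<phi>: "\<phi> \<in> circle_cont" and pos: "block_sum k f M > 0" and l: "l \<le> M"
    and \<delta>: "1 / real k ^ l < \<delta>"
    and unif: "\<And>x y. x \<in> {0..1} \<Longrightarrow> y \<in> {0..1} \<Longrightarrow> \<bar>x - y\<bar> < \<delta> \<Longrightarrow> \<bar>\<phi> x - \<phi> y\<bar> \<le> e"
  shows "\<bar>(\<integral>x. \<phi> x \<partial>mu_N k f M) - (\<Sum>w\<in>{k ^ l..<k ^ (l + 1)}.
      \<phi> ((real w - real k ^ l) / (real k ^ l * (real k - 1))) *
      ((\<Sum>m\<in>{w * k ^ (M - l)..<(w + 1) * k ^ (M - l)}. f m) / block_sum k f M))\<bar> \<le> e"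
proof -
  let ?K = "k ^ (M - l)" and ?B = "block_sum k f M"
  let ?x = "\<lambda>w. (real w - real k ^ l) / (real k ^ l * (real k - 1))"
  let ?X = "\<lambda>n. (real n - real k ^ M) / (real k ^ M * (real k - 1))"
  have kN: "k ^ M = k ^ l * ?K" and kN1: "k ^ (M + 1) = k ^ (l + 1) * ?K"
    using l by (simp_all add: power_add[symmetric])
  have rkN: "real k ^ M = real k ^ l * real ?K"
    using arg_cong[OF kN, of real] by simp
  have kl: "k ^ l \<le> k ^ (l + 1)" using k by simp
  have k1: "real k - 1 \<ge> 1" and kp: "real k ^ j > 0" for j using k by auto
  have in_unit: "(real n - real k ^ j) / (real k ^ j * (real k - 1)) \<in> {0..1}"
    if n: "n \<in> {k ^ j..<k ^ (j + 1)}" for n j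
  proof -
    have "real (k ^ j) \<le> real n" "real n \<le> real (k * k ^ j)"
      by (rule of_nat_mono, use n in simp)+
    then have "real k ^ j \<le> real n" "real n \<le> real k * real k ^ j" by simp_all
    then show ?thesis using k1 kp[of j] by (auto simp: divide_le_eq algebra_simps)
  qed
  have close: "\<bar>\<phi> (?X n) - \<phi> (?x w)\<bar> \<le> e"
    if w: "w \<in> {k ^ l..<k ^ (l + 1)}" and n: "n \<in> {w * ?K..<(w + 1) * ?K}" for w n
  proof (rule unif)
    have "w + 1 \<le> k ^ (l + 1)" using w by simp
    then have "(w + 1) * ?K \<le> k ^ (l + 1) * ?K" by (rule mult_right_mono) simp
    moreover have "k ^ l \<le> w" using w by simp
    then have "k ^ l * ?K \<le> w * ?K" by (rule mult_right_mono) simp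
    moreover have "w * ?K \<le> n" "n < (w + 1) * ?K" using n by (simp_all only: atLeastLessThan_iff)
    ultimately have "n \<in> {k ^ M..<k ^ (M + 1)}"
      unfolding kN kN1 atLeastLessThan_iff by linarith
    then show "?X n \<in> {0..1}" by (rule in_unit)
    show "?x w \<in> {0..1}" by (rule in_unit[OF w])
    have nw: "real (w * ?K) \<le> real n" "real n < real ((w + 1) * ?K)"
      using n by (simp_all only: atLeastLessThan_iff of_nat_le_iff of_nat_less_iff)
    define K where "K = real ?K"
    have K: "K > 0" using k by (simp add: K_def)
    have nw': "real w * K \<le> real n" "real n < real w * K + K"
      using nw by (simp_all add: K_def algebra_simps)
    \<comment> \<open>Since \<open>k^M\<close> is \<open>k^l\<close> times \<open>K\<close>, the
      point of \<open>w\<close> has the same coordinate as the number \<open>w * K\<close>, the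
      first of its block.\<close>
    have diff: "?X n - ?x w = (real n - real w * K) / (K * (real k ^ l * (real k - 1)))"
    proof -
      have "(x - a * K) / (a * K * b) - (y - a) / (a * b) = (x - y * K) / (K * (a * b))"
        if "a > 0" "b > 0" for x y a b :: real
        using that K by (simp add: field_simps)
      then show ?thesis unfolding rkN K_def[symmetric] using kp[of l] k1 by simp
    qed
    have "(real n - real w * K) / (K * (real k ^ l * (real k - 1))) \<le> K / (K * (real k ^ l * (real k - 1)))"
      using nw' K kp[of l] k1 by (intro divide_right_mono) auto
    also have "\<dots> = 1 / (real k ^ l * (real k - 1))" using K by simp
    also have "\<dots> \<le> 1 / (real k ^ l * 1)"
      using kp[of l] k1 by (intro divide_left_mono mult_left_mono) auto
    also have "\<dots> < \<delta>" using \<delta> by simp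
    finally have "?X n - ?x w < \<delta>" unfolding diff .
    moreover have "?X n - ?x w \<ge> 0"
      unfolding diff using nw' K kp[of l] k1 by (intro divide_nonneg_pos) auto
    ultimately show "\<bar>?X n - ?x w\<bar> < \<delta>" by simp
  qed
  have int: "(\<integral>x. \<phi> x \<partial>mu_N k f M) =
      (\<Sum>w\<in>{k ^ l..<k ^ (l + 1)}. \<Sum>n\<in>{w * ?K..<(w + 1) * ?K}. f n / ?B * \<phi> (?X n))"
    unfolding integral_mu_N[OF k f0 pos \<phi>] unfolding sum_over_blocks[OF kl, symmetric] kN[symmetric] kN1[symmetric] ..
  have one: "(\<Sum>w\<in>{k ^ l..<k ^ (l + 1)}. \<Sum>n\<in>{w * ?K..<(w + 1) * ?K}. f n / ?B) = 1"
    unfolding sum_over_blocks[OF kl, symmetric] kN[symmetric] kN1[symmetric]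
    using pos by (simp add: sum_divide_distrib[symmetric] block_sum_def)
  let ?I = "(\<integral>x. \<phi> x \<partial>mu_N k f M) - (\<Sum>w\<in>{k ^ l..<k ^ (l + 1)}. \<phi> (?x w) * ((\<Sum>n\<in>{w * ?K..<(w + 1) * ?K}. f n) / ?B))"
  have diff: "(\<integral>x. \<phi> x \<partial>mu_N k f M) - (\<Sum>w\<in>{k ^ l..<k ^ (l + 1)}. \<phi> (?x w) * ((\<Sum>n\<in>{w * ?K..<(w + 1) * ?K}. f n) / ?B)) =
      (\<Sum>w\<in>{k ^ l..<k ^ (l + 1)}. \<Sum>n\<in>{w * ?K..<(w + 1) * ?K}. f n / ?B * (\<phi> (?X n) - \<phi> (?x w)))"
    unfolding int sum_subtractf[symmetric]
    by (intro sum.cong refl)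
       (simp add: sum_subtractf right_diff_distrib sum_divide_distrib sum_distrib_left mult.commute)
  have "\<bar>?I\<bar> \<le> (\<Sum>w\<in>{k ^ l..<k ^ (l + 1)}. \<Sum>n\<in>{w * ?K..<(w + 1) * ?K}. f n / ?B * e)"
    unfolding diff
  proof (rule order.trans[OF sum_abs], rule sum_mono, rule order.trans[OF sum_abs], rule sum_mono)
    fix w n assume w: "w \<in> {k ^ l..<k ^ (l + 1)}" and n: "n \<in> {w * ?K..<(w + 1) * ?K}"
    have p: "f n / ?B \<ge> 0" using f0 pos by simp
    then have "\<bar>f n / ?B * (\<phi> (?X n) - \<phi> (?x w))\<bar> = f n / ?B * \<bar>\<phi> (?X n) - \<phi> (?x w)\<bar>"
      by (simp only: abs_mult abs_of_nonneg)
    also have "\<dots> \<le> f n / ?B * e" using close[OF w n] p by (rule mult_left_mono)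
    finally show "\<bar>f n / ?B * (\<phi> (?X n) - \<phi> (?x w))\<bar> \<le> f n / ?B * e" .
  qed
  also have "\<dots> = (\<Sum>w\<in>{k ^ l..<k ^ (l + 1)}. \<Sum>n\<in>{w * ?K..<(w + 1) * ?K}. f n / ?B) * e"
    by (simp only: sum_distrib_right)
  also have "\<dots> = e" unfolding one by simp
  finally show ?thesis .
qed

text \<open>The level \<open>l\<close> is fixed by \<open>e\<close> before \<open>M\<close> grows:
  half of \<open>e\<close> pays for replacing the integral by a Riemann sum of mesh below \<delta>,
  the other half for the convergence of finitely many block masses. The limit in \<open>l\<close> is
  left to \<open>asymptotic_function_on_phase_group\<close>.\<close>

lemma integral_mu_N_asymptotics:
  assumes f0: "\<And>n. f n \<ge> 0" and \<phi>: "\<phi> \<in> circle_cont"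
  shows "\<exists>F. continuous_on (phase_group g) F \<and>
    (\<lambda>M. (\<integral>x. \<phi> x \<partial>mu_N k f M) - F (\<lambda>m. g m ^ M)) \<longlonglongrightarrow> 0"
proof (rule asymptotic_function_on_phase_group[OF cmod_g])
  fix e :: real assume e: "e > 0"
  have "uniformly_continuous_on {0..1} \<phi>"
    by (intro compact_uniformly_continuous circle_cont_continuous \<phi>) simp
  then obtain \<delta> where \<delta>: "\<delta> > 0"
    "\<forall>x\<in>{0..1}. \<forall>y\<in>{0..1}. dist y x < \<delta> \<longrightarrow> dist (\<phi> y) (\<phi> x) < e / 2"
    unfolding uniformly_continuous_on_def using half_gt_zero[OF e] by blast
  have unif: "\<bar>\<phi> x - \<phi> y\<bar> \<le> e / 2" if "x \<in> {0..1}" "y \<in> {0..1}" "\<bar>x - y\<bar> < \<delta>" for x y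
  proof -
    have "dist (\<phi> x) (\<phi> y) < e / 2" using \<delta>(2) that by (simp add: dist_real_def)
    then show ?thesis unfolding dist_real_def by linarith
  qed
  have "1 / real k < 1" using k by simp
  from real_arch_pow_inv[OF \<delta>(1) this] obtain l where "(1 / real k) ^ l < \<delta>" by blast
  then have l: "1 / real k ^ l < \<delta>" by (simp add: power_one_over)
  let ?W = "{k ^ l..<k ^ (l + 1)}"
  let ?x = "\<lambda>w. (real w - real k ^ l) / (real k ^ l * (real k - 1))"
  let ?s = "\<lambda>M w. (\<Sum>m\<in>{w * k ^ (M - l)..<(w + 1) * k ^ (M - l)}. f m) / block_sum k f M"
  \<comment> \<open>The Riemann sum with the limiting masses as weights; it is continuous on the
    group because \<open>total_mass\<close> has no zero there.\<close>
  define F where "F h = (\<Sum>w\<in>?W. \<phi> (?x w) * (mass l w h / total_mass h))" for h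
  have "continuous_on (phase_group g) F"
    unfolding F_def
    by (intro continuous_intros continuous_on_mass continuous_on_total_mass)
       (use total_mass_pos in force)
  moreover have "(\<lambda>M. \<Sum>w\<in>?W. \<phi> (?x w) * (?s M w - mass l w (\<lambda>m. g m ^ M) / total_mass (\<lambda>m. g m ^ M))) \<longlonglongrightarrow> 0"
  proof (rule tendsto_null_sum)
    fix w assume "w \<in> ?W"
    moreover have "k ^ l \<ge> 1" using k by simp
    ultimately have w: "w \<ge> 1" by (simp only: atLeastLessThan_iff) linarith
    have "(\<lambda>M. \<phi> (?x w) * (?s M w - mass l w (\<lambda>m. g m ^ M) / total_mass (\<lambda>m. g m ^ M))) \<longlonglongrightarrow> \<phi> (?x w) * 0"
      by (intro tendsto_mult tendsto_const interval_mass_asymptotics w)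
    then show "(\<lambda>M. \<phi> (?x w) * (?s M w - mass l w (\<lambda>m. g m ^ M) / total_mass (\<lambda>m. g m ^ M))) \<longlonglongrightarrow> 0"
      by (simp only: mult_zero_right)
  qed
  from tendstoD[OF this half_gt_zero[OF e]] eventually_block_sum_pos eventually_ge_at_top[of l]
  have "\<forall>\<^sub>F M in sequentially. \<bar>(\<integral>x. \<phi> x \<partial>mu_N k f M) - F (\<lambda>m. g m ^ M)\<bar> \<le> e"
  proof eventually_elim
    case (elim M)
    have "\<bar>(\<integral>x. \<phi> x \<partial>mu_N k f M) - (\<Sum>w\<in>?W. \<phi> (?x w) * ?s M w)\<bar> \<le> e / 2"
      by (rule integral_mu_N_step_approximation[OF f0 \<phi> elim(2,3) l unif])
    moreover have "\<bar>(\<Sum>w\<in>?W. \<phi> (?x w) * ?s M w) - F (\<lambda>m. g m ^ M)\<bar> < e / 2"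
      using elim(1) unfolding F_def by (simp only: sum_subtractf[symmetric] right_diff_distrib[symmetric] dist_real_def diff_0_right)
    ultimately show ?case by linarith
  qed
  ultimately show "\<exists>S. continuous_on (phase_group g) S \<and>
      (\<forall>\<^sub>F M in sequentially. \<bar>(\<integral>x. \<phi> x \<partial>mu_N k f M) - S (\<lambda>m. g m ^ M)\<bar> \<le> e)" by blast
qed

end

theorem theorem1:
  fixes k d :: nat
    and f :: "nat \<Rightarrow> real"
    and u v :: "real vec"
    and A :: "nat \<Rightarrow> real mat"
    and g :: "nat \<Rightarrow> complex"
  assumes "k \<ge> 2"
    and "k_regular k f"
    and "\<forall>n. f n \<ge> 0"
    and "minimal_linear_representation k d u A v f"
    and "phase_tuple k d u A g"
    and "nondegenerate_representation k d u A v g"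
  shows "\<exists>\<Psi> :: (nat \<Rightarrow> complex) \<Rightarrow> real measure.
           continuous_map (top_of_set (phase_group g)) weak_topology \<Psi> \<and>
           ghost_measures k f = \<Psi> ` phase_group g \<and>
           (\<forall>(n :: nat \<Rightarrow> nat) \<mu>.
              filterlim n at_top sequentially \<longrightarrow> \<mu> \<in> circle_prob \<longrightarrow>
              (limitin weak_topology (\<lambda>j. mu_N k f (n j)) \<mu> sequentially \<longleftrightarrow>
               (\<forall>h. accumulation_point (top_of_set (phase_group g)) (\<lambda>j m. g m ^ n j) h \<longrightarrow>
                    \<mu> = \<Psi> h)))"
proof -
  interpret phase_rep k d u A v f g
    by unfold_locales (use assms in \<open>auto simp: minimal_linear_representation_def\<close>)
  have f0: "f n \<ge> 0" for n using assms(3) by blast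
  have "\<forall>\<^sub>F N in sequentially. mu_N k f N \<in> circle_prob"
    using eventually_block_sum_pos by eventually_elim (rule mu_N_circle_prob[OF \<open>k \<ge> 2\<close> f0])
  from ghost_measures_of_asymptotic_phase[OF cmod_g this integral_mu_N_asymptotics[OF f0]]
  show ?thesis unfolding ghost_measures_def .
qed

end
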